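(* Let $\mu>0$. The sequence $(\nu_N^{(\mu)})_{N\in\mathbb N}$ converges weakly to a Borel probability measure $\nu^{(\mu)}$ on $\mathcal T$ characterized by $$\nu^{(\mu)}\big(\mathcal B_{1/r}(T_0)\big)=e^{-\mu(r-1)}4^{-|T_0|}2^{K+1}\sum_{R=1}^K\binom KR\frac{\mu^{R-1}}{(R-1)!}$$ for every $T_0\in\mathcal T_{\rm fin}$ of height $r\ge1$, where $K=|D_r(T_0)|$.
   Context: Rooted planar trees (root of degree 1); $D_r(T)$ = vertices at height $r$; $|T|$ = number of edges; $h(T)$ = height. $\mathcal T$ = all finite and infinite (locally finite) trees with metric $\mathrm{dist}(T,T')=\inf\{1/r:B_r(T)=B_r(T')\}$, $B_r(T)$ the subtree spanned by vertices of height $\le r$, and $\mathcal B_{1/r}(T_0)=\{T:B_r(T)=T_0\}$ for $T_0$ of height $r$. $Z_N^{(\mu)}=\sum_{|T|=N}e^{-\mu h(T)}$ and $\nu_N^{(\mu)}(T)=e^{-\mu h(T)}/Z_N^{(\mu)}$ for $|T|=N$, viewed as a Borel probability measure on $\mathcal T$. *)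

theory Defs
  imports "HOL-Probability.Probability"
begin

text \<open>Rooted planar (plane) trees in Ulam--Harris--Neveu encoding: a tree is the set of
  addresses of its vertices (lists of naturals); the root is the empty list, the children
  of vertex v are v@[0], v@[1], ..., v@[k-1]. The height of a vertex is the length of its
  address. Locally finite = every vertex has finitely many children. The root has degree 1.\<close>

definition is_tree :: "nat list set \<Rightarrow> bool" where
  "is_tree T \<longleftrightarrow> [] \<in> T
     \<and> (\<forall>v i. v @ [i] \<in> T \<longrightarrow> v \<in> T)
     \<and> (\<forall>v i j. v @ [i] \<in> T \<and> j < i \<longrightarrow> v @ [j] \<in> T)
     \<and> (\<forall>v\<in>T. finite {i. v @ [i] \<in> T})
     \<and> {i. [i] \<in> T} = {0}"

definition Trees :: "nat list set set" where
  "Trees = {T. is_tree T}"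

definition Trees_fin :: "nat list set set" where
  "Trees_fin = {T \<in> Trees. finite T}"

definition edges :: "nat list set \<Rightarrow> nat" where
  "edges T = card T - 1"

definition height :: "nat list set \<Rightarrow> nat" where
  "height T = Max (length ` T)"

definition level :: "nat \<Rightarrow> nat list set \<Rightarrow> nat list set" where
  "level r T = {v \<in> T. length v = r}"

definition ball_tree :: "nat \<Rightarrow> nat list set \<Rightarrow> nat list set" where
  "ball_tree r T = {v \<in> T. length v \<le> r}"

definition tree_dist :: "nat list set \<Rightarrow> nat list set \<Rightarrow> real" where
  "tree_dist T T' = Inf ((\<lambda>r. 1 / real r) ` {r. r \<ge> 1 \<and> ball_tree r T = ball_tree r T'})"

definition tree_top :: "nat list set topology" where
  "tree_top = topology (\<lambda>U. U \<subseteq> Trees \<and>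
      (\<forall>T\<in>U. \<exists>e>0. {T' \<in> Trees. tree_dist T T' < e} \<subseteq> U))"

definition tree_borel :: "nat list set measure" where
  "tree_borel = sigma Trees {U. openin tree_top U}"

text \<open>The cylinder (closed ball) B_{1/r}(T0) = {T : B_r(T) = T0}, r = height of T0.\<close>
definition cyl :: "nat list set \<Rightarrow> nat list set set" where
  "cyl T0 = {T \<in> Trees. ball_tree (height T0) T = T0}"

definition trees_N :: "nat \<Rightarrow> nat list set set" where
  "trees_N N = {T \<in> Trees_fin. edges T = N}"

definition Z :: "real \<Rightarrow> nat \<Rightarrow> real" where
  "Z \<mu> N = (\<Sum>T\<in>trees_N N. exp (- \<mu> * real (height T)))"

definition nu_N :: "real \<Rightarrow> nat \<Rightarrow> nat list set measure" where
  "nu_N \<mu> N = measure_of Trees (sets tree_borel)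
     (\<lambda>A. ennreal (\<Sum>T\<in>A \<inter> trees_N N. exp (- \<mu> * real (height T)) / Z \<mu> N))"

definition weak_conv_trees :: "(nat \<Rightarrow> nat list set measure) \<Rightarrow> nat list set measure \<Rightarrow> bool" where
  "weak_conv_trees M L \<longleftrightarrow>
     (\<forall>f. continuous_map tree_top euclideanreal f \<and> (\<exists>B. \<forall>T\<in>Trees. \<bar>f T\<bar> \<le> B) \<longrightarrow>
        (\<lambda>N. integral\<^sup>L (M N) f) \<longlonglongrightarrow> integral\<^sup>L L f)"

definition cyl_formula :: "real \<Rightarrow> nat list set \<Rightarrow> real" where
  "cyl_formula \<mu> T0 =
     (let r = height T0; K = card (level r T0) in
      exp (- \<mu> * (real r - 1)) * (1 / 4) ^ edges T0 * 2 ^ (K + 1) *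
      (\<Sum>R=1..K. real (K choose R) * \<mu> ^ (R - 1) / fact (R - 1)))"

end

theory Submission
  imports Defs
begin

text \<open>Split by the number \<open>K\<close> of vertices at height \<open>r\<close>, the \<open>\<nu>\<^sub>N\<close>-weight of a cylinder is, up to
  explicit factors, the quotient of \<open>\<Sum>\<^sub>m e\<^sup>-\<^sup>\<mu>\<^sup>m [g\<^sup>n] x\<^sub>m\<^sup>K\<close> by the same sum with \<open>K = 1\<close>, where
  \<open>x\<^sub>0 = 1\<close> and \<open>x\<^sub>m\<^sub>+\<^sub>1 = 1 / (1 - g x\<^sub>m)\<close>. For \<open>g = 1 / (4 cos\<^sup>2 \<theta>)\<close> and \<open>M = m + 2\<close> one has
  \<open>Y\<^sub>m = 1 - 2 g x\<^sub>m = tan \<theta> cot (M \<theta>)\<close>, so \<open>Y\<^sub>m\<close> satisfies a Riccati equation, which turns into a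
  recursion in \<open>K\<close> for the coefficients of \<open>Y\<^sub>m\<^sup>K\<close>. Together with the spectral formula for \<open>K = 1\<close>
  (walks on a path with \<open>M - 1\<close> vertices, eigenvalues \<open>4 cos\<^sup>2 (\<pi> k / M)\<close>) it expresses them as
  spectral sums weighted by polynomials in \<open>v = n tan\<^sup>2 (\<pi> k / M) / M\<close>, \<open>1 / M\<close> and
  \<open>tan\<^sup>2 (\<pi> k / M)\<close>. A saddle point estimate concentrates the double sum over \<open>m\<close> and \<open>k\<close> at the
  extreme eigenvalue and at \<open>M \<approx> (2 \<pi>\<^sup>2 n / \<mu>)\<^sup>1\<^sup>/\<^sup>3\<close>, where \<open>v\<close> tends to \<open>\<mu> / 2\<close>: this produces the
  factors \<open>\<mu>\<^sup>R\<^sup>-\<^sup>1 / (R - 1)!\<close>. By Vandermonde's identity the limits of the cylinder weights are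
  consistent, so they are realised by a random infinite tree, and since no mass is lost,
  convergence on cylinders is weak convergence.\<close>

text \<open>The obstacle is the power K. For K = 1 the coefficients are a plain sum over
  eigenvalues, but x_m^K has poles of order K, and the resulting higher partial fractions would have
  to be controlled uniformly in m. The cotangent avoids them: since its derivative is -(1 + cot^2),
  a product of two factors Y_m can be traded for a derivative in g, which on coefficients is only a
  factor n. Every power thus becomes a sum over the same eigenvalues with a polynomial weight. The
  scale comes from balancing exp(-\<mu> M) against cos(\<pi>/M)^(2n), roughly exp(-\<pi>^2 n / M^2):
  the derivative of the exponent vanishes at \<mu> M^3 = 2 \<pi>^2 n, and there n tan(\<pi>/M)^2 / M
  is about \<pi>^2 n / M^3 = \<mu>/2. Only quotients of sums are compared, so the normalising sum
  itself needs no asymptotic expansion. A lower bound that loses a factor n suffices, because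
  everything away from the saddle is smaller by a factor exp(-c n^(1/3)).\<close>

section \<open>Generating functions of trees of bounded height\<close>

text \<open>\<open>fps_X * htgf m\<close> counts, by edges, the trees of height at most \<open>m + 1\<close>.\<close>

primrec htgf :: "nat \<Rightarrow> real fps" where
  "htgf 0 = 1"
| "htgf (Suc m) = inverse (1 - fps_X * htgf m)"

lemma htgf_Suc_mult: "htgf (Suc m) * (1 - fps_X * htgf m) = 1"
  by (simp add: inverse_mult_eq_1)

text \<open>The Y of the overview. Under the substitution for g, \<open>1 - 4 * fps_X\<close> is
  -tan(\<theta>)^2.\<close>

definition cotgf :: "nat \<Rightarrow> real fps" where
  "cotgf m = 1 - 2 * fps_X * htgf m"

lemma htgf_cotgf: "fps_X * htgf m = fps_const (1/2) * (1 - cotgf m)"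
proof -
  have "fps_const (1/2::real) * 2 = 1"
    by (simp add: numeral_fps_const)
  then have "fps_const (1/2) * (1 - cotgf m) = 1 * (fps_X * htgf m)"
    unfolding cotgf_def by (simp add: mult.assoc[symmetric])
  then show ?thesis by simp
qed

text \<open>This is the addition formula for the cotangent, cleared of its denominator; for formal
  series it uses only the recursion of \<open>htgf\<close>.\<close>

lemma cotgf_Suc: "cotgf (Suc m) * (1 + cotgf m) = cotgf m + (1 - 4 * fps_X)"
proof -
  have "cotgf (Suc m) * (1 + cotgf m)
      = 2 * (1 - fps_X * htgf m) - 4 * fps_X * (htgf (Suc m) * (1 - fps_X * htgf m))"
    by (simp add: cotgf_def algebra_simps)
  also have "\<dots> = cotgf m + (1 - 4 * fps_X)"
    unfolding htgf_Suc_mult by (simp add: cotgf_def algebra_simps)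
  finally show ?thesis .
qed

text \<open>The quotient rule for the fractional linear map behind \<open>cotgf_Suc\<close>,
  multiplied out so that no division of series occurs.\<close>

lemma fps_deriv_cotgf_Suc:
  "fps_deriv (cotgf (Suc m)) * (1 + cotgf m)\<^sup>2
     = 4 * fps_X * fps_deriv (cotgf m) - 4 * (1 + cotgf m)"
proof -
  have "fps_deriv (cotgf (Suc m) * (1 + cotgf m)) = fps_deriv (cotgf m + (1 - 4 * fps_X))"
    by (simp only: cotgf_Suc)
  then have *: "fps_deriv (cotgf (Suc m)) * (1 + cotgf m)
      = fps_deriv (cotgf m) - 4 - cotgf (Suc m) * fps_deriv (cotgf m)"
    by (simp add: numeral_fps_const algebra_simps)
  have "fps_deriv (cotgf (Suc m)) * (1 + cotgf m)\<^sup>2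
      = (fps_deriv (cotgf (Suc m)) * (1 + cotgf m)) * (1 + cotgf m)"
    by (simp add: power2_eq_square mult.assoc)
  also have "\<dots> = (fps_deriv (cotgf m) - 4 - cotgf (Suc m) * fps_deriv (cotgf m)) * (1 + cotgf m)"
    unfolding * ..
  also have "\<dots> = (fps_deriv (cotgf m) - 4) * (1 + cotgf m)
      - fps_deriv (cotgf m) * (cotgf (Suc m) * (1 + cotgf m))"
    by (simp add: algebra_simps)
  also have "\<dots> = 4 * fps_X * fps_deriv (cotgf m) - 4 * (1 + cotgf m)"
    unfolding cotgf_Suc by (simp add: algebra_simps)
  finally show ?thesis .
qed

text \<open>Along the substitution for g, this is the differential equation of cot(M \<theta>) with
  M = m + 2. The induction carries it through the fractional linear step from m to m + 1 and so
  stays within formal series.\<close>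

lemma cotgf_riccati:
  "of_nat (m + 2) * ((cotgf m)\<^sup>2 - (1 - 4 * fps_X))
     = 2 * fps_X * (1 - 4 * fps_X) * fps_deriv (cotgf m) + 4 * fps_X * cotgf m"
proof (induction m)
  case 0
  show ?case
    by (simp add: cotgf_def power2_eq_square numeral_fps_const algebra_simps)
next
  case (Suc m)
  let ?Y = "cotgf m" and ?Y' = "cotgf (Suc m)" and ?c = "1 - 4 * fps_X :: real fps"
  let ?L = "of_nat (Suc m + 2) * (?Y'\<^sup>2 - ?c)"
  let ?R = "2 * fps_X * ?c * fps_deriv ?Y' + 4 * fps_X * ?Y'"
  have "(1 + ?Y)\<^sup>2 * ?L = of_nat (Suc m + 2) * ((?Y' * (1 + ?Y))\<^sup>2 - ?c * (1 + ?Y)\<^sup>2)"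
    by (simp add: algebra_simps power2_eq_square)
  also have "\<dots> = of_nat (Suc m + 2) * ((?Y + ?c)\<^sup>2 - ?c * (1 + ?Y)\<^sup>2)"
    unfolding cotgf_Suc ..
  also have "\<dots> = 4 * fps_X * (of_nat (m + 2) * (?Y\<^sup>2 - ?c)) + 4 * fps_X * (?Y\<^sup>2 - ?c)"
    by (simp add: algebra_simps power2_eq_square)
  also have "\<dots> = 4 * fps_X * (2 * fps_X * ?c * fps_deriv ?Y + 4 * fps_X * ?Y)
       + 4 * fps_X * (?Y\<^sup>2 - ?c)"
    unfolding Suc.IH ..
  also have "\<dots> = 2 * fps_X * ?c * (4 * fps_X * fps_deriv ?Y - 4 * (1 + ?Y))
       + 4 * fps_X * ((?Y + ?c) * (1 + ?Y))"
    by (simp add: algebra_simps power2_eq_square)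
  also have "\<dots> = 2 * fps_X * ?c * (fps_deriv ?Y' * (1 + ?Y)\<^sup>2)
       + 4 * fps_X * (?Y' * (1 + ?Y) * (1 + ?Y))"
    unfolding fps_deriv_cotgf_Suc cotgf_Suc ..
  also have "\<dots> = (1 + ?Y)\<^sup>2 * ?R"
    by (simp add: algebra_simps power2_eq_square)
  finally have "(1 + ?Y)\<^sup>2 * ?L = (1 + ?Y)\<^sup>2 * ?R" .
  \<comment> \<open>The constant coefficient of \<open>1 + ?Y\<close> is 2, so the square can be
    cancelled.\<close>
  moreover have "(1 + ?Y)\<^sup>2 \<noteq> 0"
  proof
    assume "(1 + ?Y)\<^sup>2 = 0"
    then have "fps_nth (1 + ?Y) 0 = 0" by simp
    then show False by (simp add: cotgf_def)
  qed
  ultimately show ?case by simp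
qed

text \<open>Multiplying the Riccati equation by (K + 1) Y^K turns Y^K Y' into the derivative of Y^(K
  + 1), so reading off coefficients needs no convolution.\<close>

lemma cotgf_power_riccati:
  "of_nat (m + 2) * of_nat (Suc K) * (cotgf m ^ (K + 2) - (1 - 4 * fps_X) * cotgf m ^ K)
     = 2 * fps_X * (1 - 4 * fps_X) * fps_deriv (cotgf m ^ Suc K)
       + of_nat (Suc K) * (4 * fps_X * cotgf m ^ Suc K)"
proof -
  have deriv: "fps_deriv (cotgf m ^ Suc K) = of_nat (Suc K) * (cotgf m ^ K * fps_deriv (cotgf m))"
    by (simp add: fps_deriv_power fps_of_nat[symmetric] mult_ac del: power_Suc of_nat_Suc)
  have "of_nat (m + 2) * of_nat (Suc K) * (cotgf m ^ (K + 2) - (1 - 4 * fps_X) * cotgf m ^ K)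
     = of_nat (Suc K) * cotgf m ^ K * (of_nat (m + 2) * ((cotgf m)\<^sup>2 - (1 - 4 * fps_X)))"
    by (simp add: algebra_simps power2_eq_square)
  also have "\<dots> = of_nat (Suc K) * cotgf m ^ K *
      (2 * fps_X * (1 - 4 * fps_X) * fps_deriv (cotgf m) + 4 * fps_X * cotgf m)"
    unfolding cotgf_riccati ..
  also have "\<dots> = 2 * fps_X * (1 - 4 * fps_X) * fps_deriv (cotgf m ^ Suc K)
       + of_nat (Suc K) * (4 * fps_X * cotgf m ^ Suc K)"
    unfolding deriv by (simp add: algebra_simps del: of_nat_Suc)
  finally show ?thesis .
qed

text \<open>An eigenvalue near 4 almost cancels in a coefficient minus four times its predecessor,
  so these differences are kept together. The constant 8 arises when the n - 1 from the
  differentiated term is replaced by n.\<close>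

lemma cotgf_power_nth_rec:
  assumes "n > 0"
  shows "fps_nth (cotgf m ^ (K + 2)) n
     = (fps_nth (cotgf m ^ K) n - 4 * fps_nth (cotgf m ^ K) (n - 1))
     + 2 * real n / (real (K + 1) * real (m + 2))
         * (fps_nth (cotgf m ^ (K + 1)) n - 4 * fps_nth (cotgf m ^ (K + 1)) (n - 1))
     + (8 / real (K + 1) + 4) / real (m + 2) * fps_nth (cotgf m ^ (K + 1)) (n - 1)"
proof -
  obtain j where n: "n = Suc j" using assms by (cases n) auto
  have eq: "fps_nth (of_nat (m + 2) * of_nat (Suc K) * (cotgf m ^ (K + 2) - (1 - 4 * fps_X) * cotgf m ^ K)) n
     = fps_nth (2 * fps_X * (1 - 4 * fps_X) * fps_deriv (cotgf m ^ Suc K)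
       + of_nat (Suc K) * (4 * fps_X * cotgf m ^ Suc K)) n"
    unfolding cotgf_power_riccati ..
  have l: "fps_nth (of_nat (m + 2) * of_nat (Suc K) * (A - (1 - 4 * fps_X) * B)) n
     = real (m + 2) * real (Suc K) * (fps_nth A n - (fps_nth B n - 4 * fps_nth B (n - 1)))" for A B :: "real fps"
  proof -
    have "fps_const (real (m + 2) * real (Suc K)) = (of_nat (m + 2) * of_nat (Suc K) :: real fps)"
      "fps_const 4 = (4 :: real fps)"
      by (simp_all only: numeral_fps_const fps_of_nat[symmetric] fps_const_mult)
    then have e: "of_nat (m + 2) * of_nat (Suc K) * (A - (1 - 4 * fps_X) * B)
      = fps_const (real (m + 2) * real (Suc K)) * (A - (B - fps_const 4 * (fps_X * B)))"
      by (simp add: algebra_simps del: of_nat_Suc of_nat_add)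
    show ?thesis unfolding e n by (simp del: of_nat_Suc of_nat_add)
  qed
  have r: "fps_nth (2 * fps_X * (1 - 4 * fps_X) * fps_deriv A + of_nat (Suc K) * (4 * fps_X * A)) n
     = 2 * (real n * fps_nth A n - 4 * real (n - 1) * fps_nth A (n - 1))
       + real (Suc K) * 4 * fps_nth A (n - 1)" for A :: "real fps"
  proof -
    have "fps_const 2 = (2 :: real fps)" "fps_const 8 = (8 :: real fps)"
      "fps_const (4 * real (Suc K)) = (4 * of_nat (Suc K) :: real fps)"
      by (simp_all only: numeral_fps_const fps_of_nat[symmetric] fps_const_mult)
    note const = this
    have e: "2 * fps_X * (1 - 4 * fps_X) * fps_deriv A + of_nat (Suc K) * (4 * fps_X * A)
      = fps_const 2 * (fps_X * fps_deriv A) - fps_const 8 * (fps_X * (fps_X * fps_deriv A))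
       + fps_const (4 * real (Suc K)) * (fps_X * A)"
      unfolding const by (simp add: algebra_simps del: of_nat_Suc)
    have "fps_nth (fps_const c * (fps_X * A)) n = c * fps_nth A j" for c
      unfolding n by simp
    moreover have "fps_nth (fps_const c * (fps_X * (fps_X * fps_deriv A))) n = c * (real j * fps_nth A j)" for c
      unfolding n by (cases j) simp_all
    moreover have "fps_nth (fps_const c * (fps_X * fps_deriv A)) n = c * (real n * fps_nth A n)" for c
      unfolding n by simp
    ultimately show ?thesis unfolding e
      by (simp add: n algebra_simps del: of_nat_Suc fps_const_mult fps_mult_left_const_nth)
  qed
  have "real (m + 2) * real (Suc K) * (fps_nth (cotgf m ^ (K + 2)) n
       - (fps_nth (cotgf m ^ K) n - 4 * fps_nth (cotgf m ^ K) (n - 1)))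
     = 2 * (real n * fps_nth (cotgf m ^ Suc K) n - 4 * real (n - 1) * fps_nth (cotgf m ^ Suc K) (n - 1))
       + real (Suc K) * 4 * fps_nth (cotgf m ^ Suc K) (n - 1)"
    using eq unfolding l r .
  moreover have "real (n - 1) = real n - 1" using assms by (simp add: of_nat_diff)
  moreover have "A = B + 2 * x / (b * a) * (C - 4 * D) + (8 / b + 4) / a * D"
    if "a * b * (A - B) = 2 * (x * C - 4 * (x - 1) * D) + b * 4 * D" "a > 0" "b > 0"
    for a b x A B C D :: real
  proof -
    have "A = B + (2 * (x * C - 4 * (x - 1) * D) + b * 4 * D) / (a * b)"
      using that by (simp add: field_simps)
    also have "\<dots> = B + (2 * x * (C - 4 * D) / (b * a) + (8 * D / (b * a) + 4 * D / a))"
      using that by (simp add: field_simps)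
    finally show ?thesis by (simp add: add_divide_distrib distrib_right)
  qed
  ultimately show ?thesis by simp
qed

section \<open>Spectral representation\<close>

text \<open>Half the step is \<open>a\<close>; multiplication by \<open>2 * sin a\<close> makes the
  sum telescope, and the bounds on j keep \<open>sin a\<close> positive.\<close>

lemma sum_cos_equispaced:
  fixes j M :: nat
  assumes "0 < j" "j < 2 * M"
  shows "(\<Sum>k=1..<M. cos (pi * real k * real j / real M)) = - (1 + (-1) ^ j) / 2"
proof -
  define a where "a = pi * real j / (2 * real M)"
  have M: "M > 0" using assms by auto
  have a: "0 < a" "a < pi"
    using assms M by (auto simp: a_def field_simps)
  then have sa: "sin a > 0" by (rule sin_gt_zero)
  have step: "2 * sin a * cos (2 * a * real k) = sin (2 * a * real k + a) - sin (2 * a * real k - a)" for k :: nat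
    by (simp add: sin_add sin_diff)
  have tele: "2 * sin a * (\<Sum>k=1..<M. cos (2 * a * real k)) = sin (2 * a * real M - a) - sin a"
    using M
  proof (induction M rule: nat_induct_non_zero)
    case 1 show ?case by simp
  next
    case (Suc n)
    have "2 * sin a * (\<Sum>k=1..<Suc n. cos (2 * a * real k))
       = (sin (2 * a * real n - a) - sin a) + (sin (2 * a * real n + a) - sin (2 * a * real n - a))"
      using Suc step[of n] by (simp add: algebra_simps sum.atLeastLessThan_Suc)
    then show ?case by (simp add: algebra_simps)
  qed
  have "2 * a * real M = pi * real j" using M by (simp add: a_def field_simps)
  then have "sin (2 * a * real M - a) = - ((-1) ^ j * sin a)"
    by (simp add: sin_diff)
  then have "2 * sin a * (\<Sum>k=1..<M. cos (2 * a * real k)) = 2 * sin a * (- (1 + (-1) ^ j) / 2)"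
    unfolding tele by (simp add: algebra_simps)
  then have "(\<Sum>k=1..<M. cos (2 * a * real k)) = - (1 + (-1) ^ j) / 2"
    using sa by (simp only: mult_cancel_left) auto
  moreover have "2 * a * real k = pi * real k * real j / real M" for k
    by (simp add: a_def field_simps)
  ultimately show ?thesis by simp
qed

lemma discrete_sine_orthogonality:
  fixes i M :: nat
  assumes "1 \<le> i" "i < M"
  shows "(2 / real M) * (\<Sum>k=1..<M. sin (pi * real k * real i / real M) * sin (pi * real k / real M))
    = (if i = 1 then 1 else 0)"
proof -
  have M: "M > 0" "M \<ge> 2" using assms by auto
  have "sin (pi * real k * real i / real M) * sin (pi * real k / real M)
     = (cos (pi * real k * real (i - 1) / real M) - cos (pi * real k * real (i + 1) / real M)) / 2" for k
  proof -
    have "pi * real k * real (i - 1) / real M = pi * real k * real i / real M - pi * real k / real M"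
      "pi * real k * real (i + 1) / real M = pi * real k * real i / real M + pi * real k / real M"
      using assms by (simp_all add: of_nat_diff diff_divide_distrib add_divide_distrib algebra_simps)
    then show ?thesis by (simp only: sin_times_sin)
  qed
  then have "(\<Sum>k=1..<M. sin (pi * real k * real i / real M) * sin (pi * real k / real M))
    = ((\<Sum>k=1..<M. cos (pi * real k * real (i - 1) / real M))
       - (\<Sum>k=1..<M. cos (pi * real k * real (i + 1) / real M))) / 2"
    by (simp only: sum_subtractf sum_divide_distrib[symmetric])
  also have "(\<Sum>k=1..<M. cos (pi * real k * real (i + 1) / real M)) = - (1 + (-1) ^ (i + 1)) / 2"
    using assms M by (intro sum_cos_equispaced) auto
  also have "(\<Sum>k=1..<M. cos (pi * real k * real (i - 1) / real M))
     = (if i = 1 then real M - 1 else - (1 + (-1) ^ (i - 1)) / 2)"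
  proof (cases "i = 1")
    case False
    then show ?thesis using sum_cos_equispaced[of "i - 1" M] assms by simp
  qed (use M in \<open>simp add: of_nat_diff\<close>)
  finally have e: "(\<Sum>k=1..<M. sin (pi * real k * real i / real M) * sin (pi * real k / real M))
    = ((if i = 1 then real M - 1 else - (1 + (-1) ^ (i - 1)) / 2) - (- (1 + (-1) ^ (i + 1)) / 2)) / 2" .
  show ?thesis
  proof (cases "i = 1")
    case True
    then show ?thesis using e M by (simp add: field_simps)
  next
    case False
    then obtain j where "i = Suc j" "j > 0" using assms by (cases i) auto
    then show ?thesis using e by simp
  qed
qed

text \<open>The number of walks of length \<open>l\<close> from \<open>i\<close> to \<open>1\<close> on the path with vertices
  \<open>1, \<dots>, M - 1\<close>, diagonalised in the discrete sine basis.\<close>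
definition path_walks :: "nat \<Rightarrow> nat \<Rightarrow> nat \<Rightarrow> real" where
  "path_walks M i l = (2 / real M) * (\<Sum>k=1..<M. sin (pi * real k * real i / real M) *
      sin (pi * real k / real M) * (2 * cos (pi * real k / real M)) ^ l)"

lemma path_walks_Suc:
  assumes "1 \<le> i"
  shows "path_walks M i (Suc l) = path_walks M (i - 1) l + path_walks M (i + 1) l"
proof -
  have "sin (pi * real k * real i / real M) * (2 * cos (pi * real k / real M))
     = sin (pi * real k * real (i - 1) / real M) + sin (pi * real k * real (i + 1) / real M)" for k
  proof -
    have "pi * real k * real (i - 1) / real M = pi * real k * real i / real M - pi * real k / real M"
      "pi * real k * real (i + 1) / real M = pi * real k * real i / real M + pi * real k / real M"
      using assms by (simp_all add: of_nat_diff diff_divide_distrib add_divide_distrib algebra_simps)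
    then show ?thesis by (simp add: sin_add sin_diff)
  qed
  note sine_add = this
  have "sin (pi * real k * real i / real M) * sin (pi * real k / real M) * (2 * cos (pi * real k / real M)) ^ Suc l
     = (sin (pi * real k * real (i - 1) / real M) + sin (pi * real k * real (i + 1) / real M)) *
        sin (pi * real k / real M) * (2 * cos (pi * real k / real M)) ^ l" for k
    unfolding power_Suc sine_add[symmetric] by (simp only: mult_ac)
  then show ?thesis
    unfolding path_walks_def by (simp only: distrib_right sum.distrib distrib_left)
qed

lemma path_walks_0: "path_walks M 0 l = 0"
  by (simp add: path_walks_def)

lemma path_walks_end: "path_walks M M l = 0"
  by (cases "M = 0") (simp_all add: path_walks_def)

lemma path_walks_init:
  assumes "1 \<le> i" "i < M"
  shows "path_walks M i 0 = (if i = 1 then 1 else 0)"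
  unfolding path_walks_def using discrete_sine_orthogonality[OF assms] by simp

text \<open>A walk from i needs i - 1 steps to reach 1. Since \<open>path_walks\<close> is defined
  spectrally, this has to come from its recursion and boundary values.\<close>

lemma path_walks_eq_0:
  assumes "1 \<le> i" "i \<le> M" "l + 1 < i"
  shows "path_walks M i l = 0"
  using assms
proof (induction l arbitrary: i)
  case 0
  then show ?case
    by (cases "i = M") (auto simp: path_walks_end path_walks_init)
next
  case (Suc l)
  show ?case
  proof (cases "i = M")
    case False
    with Suc show ?thesis by (simp add: path_walks_Suc)
  qed (simp add: path_walks_end)
qed

text \<open>The length of a walk from i to 1 has the parity of i - 1, so g marks the pairs of steps
  beyond the shortest walk.\<close>

definition path_gf :: "nat \<Rightarrow> nat \<Rightarrow> real fps" where
  "path_gf M i = Abs_fps (\<lambda>n. path_walks M i (2 * n + i - 1))"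

lemma path_gf_1:
  assumes "M \<ge> 2"
  shows "path_gf M 1 = 1 + fps_X * path_gf M 2"
proof (rule fps_ext)
  fix n
  show "fps_nth (path_gf M 1) n = fps_nth (1 + fps_X * path_gf M 2) n"
    using assms
    by (cases n) (simp_all add: path_gf_def path_walks_init path_walks_Suc[of 1, simplified] path_walks_0
      Suc_1[symmetric] del: Suc_1)
qed

lemma path_gf_rec:
  assumes "2 \<le> i" "i < M"
  shows "path_gf M i = path_gf M (i - 1) + fps_X * path_gf M (i + 1)"
proof (rule fps_ext)
  fix n
  obtain j where i: "i = Suc (Suc j)" using assms by (metis add_2_eq_Suc le_Suc_ex)
  show "fps_nth (path_gf M i) n = fps_nth (path_gf M (i - 1) + fps_X * path_gf M (i + 1)) n"
  proof (cases n)
    case 0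
    then show ?thesis
      using assms path_walks_Suc[of i M j] path_walks_eq_0[of "i + 1" M j] unfolding i
      by (simp add: path_gf_def)
  next
    case (Suc n')
    then show ?thesis
      using path_walks_Suc[of i M "2 * n + j"] unfolding i by (simp add: path_gf_def)
  qed
qed

lemma path_gf_end: "path_gf M M = 0"
  by (rule fps_ext) (simp add: path_gf_def path_walks_end)

text \<open>With d counted from the far end of the path, quotients of neighbouring series obey the
  continued fraction that defines \<open>htgf\<close>; the zero boundary value at M starts it at
  \<open>htgf 0 = 1\<close>.\<close>

lemma path_gf_ratio:
  assumes "d + 2 < M"
  shows "path_gf M (M - 1 - d) = htgf d * path_gf M (M - 2 - d)"
  using assms
proof (induction d)
  case 0
  then show ?case
    using path_gf_rec[of "M - 1" M] by (simp add: path_gf_end numeral_2_eq_2)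
next
  case (Suc d)
  have eq: "M - 1 - Suc d = M - 2 - d" "M - 1 - Suc d - 1 = M - 2 - Suc d" "M - 1 - Suc d + 1 = M - 1 - d"
    using Suc.prems by auto
  have "path_gf M (M - 2 - d) = path_gf M (M - 2 - Suc d) + fps_X * path_gf M (M - 1 - d)"
    using path_gf_rec[of "M - 1 - Suc d" M, unfolded eq] Suc.prems eq by simp
  also have "path_gf M (M - 1 - d) = htgf d * path_gf M (M - 2 - d)"
    using Suc by simp
  finally have "(1 - fps_X * htgf d) * path_gf M (M - 2 - d) = path_gf M (M - 2 - Suc d)"
    by (simp add: algebra_simps)
  then have "htgf (Suc d) * (1 - fps_X * htgf d) * path_gf M (M - 2 - d)
     = htgf (Suc d) * path_gf M (M - 2 - Suc d)"
    by (simp add: mult.assoc)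
  then show ?case
    unfolding htgf_Suc_mult eq by simp
qed

lemma path_gf_eq_htgf: "path_gf (m + 2) 1 = htgf m"
proof (cases m)
  case 0
  then show ?thesis
    using path_gf_1[of 2] path_gf_end[of 2] by (simp add: numeral_2_eq_2)
next
  case (Suc d)
  have "path_gf (m + 2) 2 = htgf d * path_gf (m + 2) 1"
    using path_gf_ratio[of d "m + 2"] Suc by (simp add: numeral_2_eq_2)
  then have "path_gf (m + 2) 1 = 1 + fps_X * htgf d * path_gf (m + 2) 1"
    using path_gf_1[of "m + 2"] by (simp add: mult.assoc)
  then have "(1 - fps_X * htgf d) * path_gf (m + 2) 1 = 1"
    by (simp add: algebra_simps)
  then have "htgf m * (1 - fps_X * htgf d) * path_gf (m + 2) 1 = htgf m"
    by (simp add: mult.assoc)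
  then show ?thesis
    unfolding Suc htgf_Suc_mult by simp
qed

abbreviation eigenangle :: "nat \<Rightarrow> nat \<Rightarrow> real" where
  "eigenangle m k \<equiv> pi * real k / real (m + 2)"

lemma htgf_nth:
  "fps_nth (htgf m) n = (2 / real (m + 2)) *
     (\<Sum>k=1..m+1. (sin (eigenangle m k))\<^sup>2 * (4 * (cos (eigenangle m k))\<^sup>2) ^ n)"
proof -
  have "fps_nth (htgf m) n = path_walks (m + 2) 1 (2 * n)"
    unfolding path_gf_eq_htgf[symmetric] by (simp add: path_gf_def)
  also have "\<dots> = (2 / real (m + 2)) * (\<Sum>k\<in>{1..<m+2}. (sin (eigenangle m k))\<^sup>2 *
      (4 * (cos (eigenangle m k))\<^sup>2) ^ n)"
    by (simp only: path_walks_def power_mult power_mult_distrib)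
      (simp add: power2_eq_square)
  also have "{1..<m + 2} = {1..m+1}" by auto
  finally show ?thesis .
qed

section \<open>Coefficients of powers\<close>

text \<open>Polynomial functions of (v, e, t), given as a closure because only inductions over sums
  and products are made: for limits, growth and divisibility.\<close>

inductive polyfun3 :: "(real \<Rightarrow> real \<Rightarrow> real \<Rightarrow> real) \<Rightarrow> bool" where
  const: "polyfun3 (\<lambda>v e t. c)"
| fst: "polyfun3 (\<lambda>v e t. v)"
| snd: "polyfun3 (\<lambda>v e t. e)"
| trd: "polyfun3 (\<lambda>v e t. t)"
| add: "polyfun3 R \<Longrightarrow> polyfun3 S \<Longrightarrow> polyfun3 (\<lambda>v e t. R v e t + S v e t)"
| mult: "polyfun3 R \<Longrightarrow> polyfun3 S \<Longrightarrow> polyfun3 (\<lambda>v e t. R v e t * S v e t)"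

lemma polyfun3_diff:
  assumes "polyfun3 R" "polyfun3 S"
  shows "polyfun3 (\<lambda>v e t. R v e t - S v e t)"
  using polyfun3.add[OF assms(1) polyfun3.mult[OF polyfun3.const[of "-1"] assms(2)]] by simp

text \<open>The substitution is the effect on v = n t e of replacing n by n - 1.\<close>

lemma polyfun3_shift:
  assumes "polyfun3 R"
  shows "polyfun3 (\<lambda>v e t. R (v - t * e) e t)"
  using assms
  by (induction rule: polyfun3.induct) (auto intro!: polyfun3.intros polyfun3_diff)

text \<open>The extracted factor \<open>t * e\<close> tames the recursion for
  \<open>specpoly\<close>: there the difference is multiplied by n e, which is unbounded, but n e (t
  e) = v e.\<close>

lemma polyfun3_divided_difference:
  assumes "polyfun3 R"
  shows "\<exists>D. polyfun3 D \<and> (\<forall>v e t. R v e t - R (v - t * e) e t = t * e * D v e t)"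
  using assms
proof (induction rule: polyfun3.induct)
  case fst
  show ?case by (intro exI[of _ "\<lambda>v e t. 1"]) (auto intro: polyfun3.const)
next
  case (add R S)
  then obtain D E where D: "polyfun3 D" "\<And>v e t. R v e t - R (v - t * e) e t = t * e * D v e t"
    and E: "polyfun3 E" "\<And>v e t. S v e t - S (v - t * e) e t = t * e * E v e t"
    by blast
  have "R v e t + S v e t - (R (v - t * e) e t + S (v - t * e) e t) = t * e * (D v e t + E v e t)" for v e t
    using D(2)[of v e t] E(2)[of v e t] by (simp add: algebra_simps)
  with polyfun3.add[OF D(1) E(1)] show ?case by (intro exI) auto
next
  case (mult R S)
  then obtain D E where D: "polyfun3 D" "\<And>v e t. R v e t - R (v - t * e) e t = t * e * D v e t"
    and E: "polyfun3 E" "\<And>v e t. S v e t - S (v - t * e) e t = t * e * E v e t"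
    by blast
  have "R v e t * S v e t - R (v - t * e) e t * S (v - t * e) e t
      = t * e * (D v e t * S v e t + R (v - t * e) e t * E v e t)" for v e t
  proof -
    have "R v e t * S v e t - R (v - t * e) e t * S (v - t * e) e t
      = (R v e t - R (v - t * e) e t) * S v e t + R (v - t * e) e t * (S v e t - S (v - t * e) e t)"
      by (simp add: algebra_simps)
    then show ?thesis unfolding D(2) E(2) by (simp add: algebra_simps)
  qed
  moreover have "polyfun3 (\<lambda>v e t. D v e t * S v e t + R (v - t * e) e t * E v e t)"
    using D(1) E(1) mult.hyps by (intro polyfun3.add polyfun3.mult polyfun3_shift)
  ultimately show ?case by (intro exI) auto
qed (auto intro!: exI[of _ "\<lambda>v e t. 0"] polyfun3.const)

lemma polyfun3_tendsto:
  assumes "polyfun3 R" "(f \<longlongrightarrow> a) F" "(g \<longlongrightarrow> b) F" "(h \<longlongrightarrow> c) F"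
  shows "((\<lambda>x. R (f x) (g x) (h x)) \<longlongrightarrow> R a b c) F"
  using assms by (induction rule: polyfun3.induct) (auto intro: tendsto_intros)

lemma polyfun3_bound:
  assumes "polyfun3 R"
  shows "\<exists>C d. C \<ge> 0 \<and> (\<forall>v e t. \<bar>R v e t\<bar> \<le> C * (1 + \<bar>v\<bar> + \<bar>e\<bar> + \<bar>t\<bar>) ^ d)"
  using assms
proof (induction rule: polyfun3.induct)
  case (const c)
  show ?case by (intro exI[of _ "\<bar>c\<bar>"] exI[of _ 0]) auto
next
  case fst
  show ?case by (intro exI[of _ 1] exI[of _ 1]) auto
next
  case snd
  show ?case by (intro exI[of _ 1] exI[of _ 1]) auto
next
  case trd
  show ?case by (intro exI[of _ 1] exI[of _ 1]) auto
next
  case (add R S)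
  then obtain C d C' d' where b: "C \<ge> 0" "C' \<ge> 0"
    "\<And>v e t. \<bar>R v e t\<bar> \<le> C * (1 + \<bar>v\<bar> + \<bar>e\<bar> + \<bar>t\<bar>) ^ d"
    "\<And>v e t. \<bar>S v e t\<bar> \<le> C' * (1 + \<bar>v\<bar> + \<bar>e\<bar> + \<bar>t\<bar>) ^ d'" by blast
  have "\<bar>R v e t + S v e t\<bar> \<le> (C + C') * (1 + \<bar>v\<bar> + \<bar>e\<bar> + \<bar>t\<bar>) ^ (d + d')" for v e t
  proof -
    let ?x = "1 + \<bar>v\<bar> + \<bar>e\<bar> + \<bar>t\<bar>"
    have "C * ?x ^ d \<le> C * ?x ^ (d + d')" "C' * ?x ^ d' \<le> C' * ?x ^ (d + d')"
      using b by (auto intro!: mult_left_mono power_increasing)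
    then show ?thesis
      using b(3)[of v e t] b(4)[of v e t] abs_triangle_ineq[of "R v e t" "S v e t"]
      unfolding distrib_right by linarith
  qed
  then show ?case using b by (intro exI[of _ "C + C'"] exI[of _ "d + d'"]) auto
next
  case (mult R S)
  then obtain C d C' d' where b: "C \<ge> 0" "C' \<ge> 0"
    "\<And>v e t. \<bar>R v e t\<bar> \<le> C * (1 + \<bar>v\<bar> + \<bar>e\<bar> + \<bar>t\<bar>) ^ d"
    "\<And>v e t. \<bar>S v e t\<bar> \<le> C' * (1 + \<bar>v\<bar> + \<bar>e\<bar> + \<bar>t\<bar>) ^ d'" by blast
  have "\<bar>R v e t * S v e t\<bar> \<le> (C * C') * (1 + \<bar>v\<bar> + \<bar>e\<bar> + \<bar>t\<bar>) ^ (d + d')" for v e t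
  proof -
    have "\<bar>R v e t\<bar> * \<bar>S v e t\<bar> \<le> (C * (1 + \<bar>v\<bar> + \<bar>e\<bar> + \<bar>t\<bar>) ^ d) * (C' * (1 + \<bar>v\<bar> + \<bar>e\<bar> + \<bar>t\<bar>) ^ d')"
      using b by (intro mult_mono) auto
    then show ?thesis by (simp add: abs_mult power_add mult_ac)
  qed
  then show ?case using b by (intro exI[of _ "C * C'"] exI[of _ "d + d'"]) auto
qed

text \<open>The polynomial factor in the spectral representation of the coefficients of
  \<open>cotgf m ^ K\<close>; \<open>e\<close> stands for \<open>1 / (m + 2)\<close> and \<open>t\<close> for the squared tangent of an
  eigenangle. The recursion is \<open>cotgf_power_nth_rec\<close>.\<close>
fun specpoly :: "nat \<Rightarrow> real \<Rightarrow> real \<Rightarrow> real \<Rightarrow> real" where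
  "specpoly 0 e t x = 0"
| "specpoly (Suc 0) e t x = 1"
| "specpoly (Suc (Suc K)) e t x =
    (specpoly K e t x - (1 + t) * specpoly K e t (x - 1))
    + 2 * x * e / real (K + 1) * (specpoly (Suc K) e t x - (1 + t) * specpoly (Suc K) e t (x - 1))
    + (2 / real (K + 1) + 1) * e * (1 + t) * specpoly (Suc K) e t (x - 1)"

text \<open>In the recursion each factor \<open>x * e\<close> multiplies an expression divisible by
  t, so x enters only through v = x t e. At e = t = 0 a step reduces to multiplication by -2 v / (K
  + 1), whence the factorial.\<close>

lemma specpoly_polyfun3:
  "\<exists>R. polyfun3 R \<and> (\<forall>e t x. specpoly K e t x = R (x * t * e) e t)
     \<and> (\<forall>v. R v 0 0 = (if K = 0 then 0 else (- 2 * v) ^ (K - 1) / fact (K - 1)))"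
proof (induction K rule: induct_nat_012)
  case 0
  show ?case by (intro exI[of _ "\<lambda>v e t. 0"]) (auto intro: polyfun3.const)
next
  case 1
  show ?case by (intro exI[of _ "\<lambda>v e t. 1"]) (auto intro: polyfun3.const)
next
  case (ge2 K)
  from ge2(1) obtain R where R: "polyfun3 R" "\<And>e t x. specpoly K e t x = R (x * t * e) e t"
    by blast
  from ge2(2) obtain S where S: "polyfun3 S" "\<And>e t x. specpoly (Suc K) e t x = S (x * t * e) e t"
    "\<And>v. S v 0 0 = (- 2 * v) ^ K / fact K" by auto
  obtain D where D: "polyfun3 D" "\<And>v e t. S v e t - S (v - t * e) e t = t * e * D v e t"
    using polyfun3_divided_difference[OF S(1)] by blast
  define Q where "Q = (\<lambda>v e t. (R v e t - (1 + t) * R (v - t * e) e t)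
    + 2 / real (K + 1) * v * (e * D v e t - S (v - t * e) e t)
    + (2 / real (K + 1) + 1) * e * (1 + t) * S (v - t * e) e t)"
  have "polyfun3 Q"
    unfolding Q_def
    by (intro polyfun3.intros polyfun3_diff polyfun3_shift R S D)
  moreover have "specpoly (Suc (Suc K)) e t x = Q (x * t * e) e t" for e t x
  proof -
    let ?v = "x * t * e"
    have v: "(x - 1) * t * e = ?v - t * e" by (simp add: algebra_simps)
    have "2 * x * e / real (K + 1) * (S ?v e t - (1 + t) * S (?v - t * e) e t)
      = 2 * x * e / real (K + 1) * ((S ?v e t - S (?v - t * e) e t) - t * S (?v - t * e) e t)"
      by (simp add: algebra_simps)
    also have "\<dots> = 2 / real (K + 1) * ?v * (e * D ?v e t - S (?v - t * e) e t)"
      unfolding D(2) by (simp add: algebra_simps)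
    finally show ?thesis
      unfolding Q_def specpoly.simps R(2) S(2) v by simp
  qed
  moreover have "Q v 0 0 = (- 2 * v) ^ Suc K / fact (Suc K)" for v
    by (simp add: Q_def S(3))
  ultimately show ?case by (intro exI[of _ Q]) auto
qed

text \<open>By 1 + tan^2 = 1 / cos^2. Where the cosine is 0 the tangent has the value 0 by
  convention, and n \<ge> 3 makes both sides vanish.\<close>

lemma four_cos_power_pred:
  fixes \<theta> :: real
  assumes "n \<ge> 3"
  shows "4 * (4 * (cos \<theta>)\<^sup>2) ^ (n - 2) = (1 + (tan \<theta>)\<^sup>2) * (4 * (cos \<theta>)\<^sup>2) ^ (n - 1)"
proof (cases "cos \<theta> = 0")
  case True
  then show ?thesis using assms by (simp add: power_0_left)
next
  case False
  have n: "n - 1 = Suc (n - 2)" using assms by simp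
  have "(1 + (tan \<theta>)\<^sup>2) * (cos \<theta>)\<^sup>2 = 1"
    using False by (simp add: tan_def field_simps)
  then show ?thesis
    unfolding n by (simp add: mult_ac)
qed

text \<open>All K share the spectral weights of the case K = 1. The bound on n rises with K because
  each step of the recursion also reads the coefficient n - 1.\<close>

lemma cotgf_power_nth:
  assumes "n \<ge> K + 1"
  shows "fps_nth (cotgf m ^ K) n = - (4 / real (m + 2)) * (\<Sum>k=1..m+1.
     (sin (eigenangle m k))\<^sup>2 * (4 * (cos (eigenangle m k))\<^sup>2) ^ (n - 1) *
       specpoly K (1 / real (m + 2)) ((tan (eigenangle m k))\<^sup>2) (real n))"
  using assms
proof (induction K arbitrary: n rule: induct_nat_012)
  case 0
  then show ?case by simp
next
  case 1
  then obtain j where n: "n = Suc j" by (cases n) auto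
  have "fps_nth (cotgf m ^ Suc 0) n = - 2 * fps_nth (htgf m) j"
    unfolding n by (simp add: cotgf_def numeral_fps_const mult.assoc)
  then show ?case
    unfolding htgf_nth n by (simp del: sum.cl_ivl_Suc)
next
  case (ge2 K)
  let ?\<theta> = "\<lambda>k. eigenangle m k"
  let ?w = "\<lambda>k. (sin (?\<theta> k))\<^sup>2 * (4 * (cos (?\<theta> k))\<^sup>2) ^ (n - 1)"
  let ?e = "1 / real (m + 2)"
  let ?t = "\<lambda>k. (tan (?\<theta> k))\<^sup>2"
  \<comment> \<open>Absorbs the lowered exponent of the coefficient n - 1, so that all terms carry
    the common weight \<open>?w\<close>.\<close>
  let ?p = "\<lambda>L k. (1 + ?t k) / 4 * specpoly L ?e (?t k) (real n - 1)"
  have n3: "n \<ge> 3" using ge2.prems by simp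
  have pred: "fps_nth (cotgf m ^ L) (n - 1) = - (4 / real (m + 2)) * (\<Sum>k=1..m+1.
      ?w k * ?p L k)"
    if "fps_nth (cotgf m ^ L) (n - 1) = - (4 / real (m + 2)) * (\<Sum>k=1..m+1.
      (sin (?\<theta> k))\<^sup>2 * (4 * (cos (?\<theta> k))\<^sup>2) ^ (n - 1 - 1) * specpoly L ?e (?t k) (real (n - 1)))" for L
  proof -
    have eq: "(sin (?\<theta> k))\<^sup>2 * (4 * (cos (?\<theta> k))\<^sup>2) ^ (n - 1 - 1) * specpoly L ?e (?t k) (real (n - 1))
      = ?w k * ?p L k" for k
    proof -
      have e: "n - 1 - 1 = n - 2" "real (n - 1) = real n - 1" using n3 by (auto simp: of_nat_diff)
      have gen: "s * P * q = s * P' * ((1 + t) / 4 * q)" if "4 * P = (1 + t) * P'" for s P P' q t :: real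
      proof -
        have "P = (1 + t) * P' / 4" using that by simp
        then show ?thesis by simp
      qed
      show ?thesis
        unfolding e by (rule gen[OF four_cos_power_pred[OF n3, of "?\<theta> k"]])
    qed
    show ?thesis using that unfolding eq .
  qed
  let ?S = "\<lambda>k. ?w k * specpoly K ?e (?t k) (real n) - 4 * (?w k * ?p K k)
    + (2 * real n / (real (K + 1) * real (m + 2)) *
         (?w k * specpoly (Suc K) ?e (?t k) (real n) - 4 * (?w k * ?p (Suc K) k))
       + (8 / real (K + 1) + 4) / real (m + 2) * (?w k * ?p (Suc K) k))"
  note IH = ge2.IH(1)[of n] ge2.IH(2)[of n] pred[OF ge2.IH(1)[of "n - 1"]] pred[OF ge2.IH(2)[of "n - 1"]]
  have n: "K + 1 \<le> n" "Suc K + 1 \<le> n" "K + 1 \<le> n - 1" "Suc K + 1 \<le> n - 1" "n > 0"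
    using ge2.prems by auto
  have "fps_nth (cotgf m ^ Suc (Suc K)) n
     = (fps_nth (cotgf m ^ K) n - 4 * fps_nth (cotgf m ^ K) (n - 1))
     + 2 * real n / (real (K + 1) * real (m + 2))
         * (fps_nth (cotgf m ^ (Suc K)) n - 4 * fps_nth (cotgf m ^ (Suc K)) (n - 1))
     + (8 / real (K + 1) + 4) / real (m + 2) * fps_nth (cotgf m ^ (Suc K)) (n - 1)"
    using cotgf_power_nth_rec[OF n(5), of m K] by simp
  also have "\<dots> = - (4 / real (m + 2)) * (\<Sum>k=1..m+1. ?S k)"
    unfolding IH(1)[OF n(1)] IH(2)[OF n(2)] IH(3)[OF n(3)] IH(4)[OF n(4)]
      sum.distrib sum_subtractf sum_distrib_left[symmetric]
    by (simp only: algebra_simps)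
  also have "\<dots> = - (4 / real (m + 2)) * (\<Sum>k=1..m+1. ?w k * specpoly (Suc (Suc K)) ?e (?t k) (real n))"
  proof (intro arg_cong2[where f = "(*)"] refl sum.cong)
    fix k
    show "?S k = ?w k * specpoly (Suc (Suc K)) ?e (?t k) (real n)"
    proof -
      have gen: "W * a - 4 * (W * ((1 + t) / 4 * b)) + (2 * x / (j * M) * (W * c - 4 * (W * ((1 + t) / 4 * d)))
           + (8 / j + 4) / M * (W * ((1 + t) / 4 * d)))
        = W * (a - (1 + t) * b + 2 * x * (1 / M) / j * (c - (1 + t) * d)
           + (2 / j + 1) * (1 / M) * (1 + t) * d)"
        if "j > 0" "M > 0" for W a b c d t x j M :: real
        using that by (simp add: field_simps)
      show ?thesis unfolding specpoly.simps by (rule gen) auto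
    qed
  qed
  finally show ?case .
qed

section \<open>Saddle point analysis\<close>

lemma x_cos_le_sin:
  fixes x :: real
  assumes "0 \<le> x" "x \<le> pi"
  shows "x * cos x \<le> sin x"
proof -
  have "(\<lambda>x. sin x - x * cos x) 0 \<le> (\<lambda>x. sin x - x * cos x) x"
  proof (rule DERIV_nonneg_imp_nondecreasing[OF assms(1)])
    fix y assume y: "0 \<le> y" "y \<le> x"
    have "((\<lambda>x. sin x - x * cos x) has_real_derivative y * sin y) (at y)"
      by (auto intro!: derivative_eq_intros simp: algebra_simps)
    moreover have "0 \<le> y * sin y" using y assms by (intro mult_nonneg_nonneg sin_ge_zero) auto
    ultimately show "\<exists>z. ((\<lambda>x. sin x - x * cos x) has_real_derivative z) (at y) \<and> 0 \<le> z" by blast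
  qed
  then show ?thesis by simp
qed

lemma cos_le_exp_neg_square:
  fixes x :: real
  assumes "0 \<le> x" "x \<le> pi"
  shows "cos x \<le> exp (- (x\<^sup>2) / 2)"
proof -
  have "(\<lambda>x. cos x * exp (x\<^sup>2 / 2)) x \<le> (\<lambda>x. cos x * exp (x\<^sup>2 / 2)) 0"
  proof (rule DERIV_nonpos_imp_nonincreasing[OF assms(1)])
    fix y assume y: "0 \<le> y" "y \<le> x"
    have "((\<lambda>x. cos x * exp (x\<^sup>2 / 2)) has_real_derivative (y * cos y - sin y) * exp (y\<^sup>2 / 2)) (at y)"
      by (auto intro!: derivative_eq_intros simp: algebra_simps)
    moreover have "(y * cos y - sin y) * exp (y\<^sup>2 / 2) \<le> 0"
      using x_cos_le_sin[of y] y assms by (intro mult_nonpos_nonneg) auto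
    ultimately show "\<exists>z. ((\<lambda>x. cos x * exp (x\<^sup>2 / 2)) has_real_derivative z) (at y) \<and> z \<le> 0" by blast
  qed
  then show ?thesis by (simp add: exp_minus field_simps)
qed

lemma cos_ge_one_minus_square:
  fixes x :: real
  shows "1 - x\<^sup>2 / 2 \<le> cos x"
proof -
  have "\<bar>sin (x / 2)\<bar> \<le> \<bar>x / 2\<bar>" by (rule abs_sin_x_le_abs_x)
  then have "(sin (x / 2))\<^sup>2 \<le> (x / 2)\<^sup>2" by (rule abs_le_square_iff[THEN iffD1])
  then show ?thesis using cos_double_sin[of "x / 2"] by (simp add: power2_eq_square)
qed

text \<open>Together with \<open>cos_le_exp_neg_square\<close> this brackets the cosine. At the
  saddle x is of order n^(-1/3), so even in the power 2n the quartic loss stays bounded.\<close>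

lemma cos_ge_exp:
  fixes x :: real
  assumes "\<bar>x\<bar> \<le> 1"
  shows "exp (- (x\<^sup>2) / 2 - x ^ 4 / 2) \<le> cos x"
proof -
  have x2: "x\<^sup>2 \<le> 1" using assms by (simp add: abs_square_le_1)
  have "- (x\<^sup>2 / 2) - 2 * (x\<^sup>2 / 2)\<^sup>2 \<le> ln (1 - x\<^sup>2 / 2)"
    using x2 by (intro ln_one_minus_pos_lower_bound) auto
  then have "exp (- (x\<^sup>2 / 2) - 2 * (x\<^sup>2 / 2)\<^sup>2) \<le> 1 - x\<^sup>2 / 2"
    using x2 by (subst (asm) ln_ge_iff) auto
  also have "\<dots> \<le> cos x" by (rule cos_ge_one_minus_square)
  finally show ?thesis by (simp add: power2_eq_square power4_eq_xxxx mult.assoc)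
qed

lemma sin_ge_half:
  fixes x :: real
  assumes "0 \<le> x" "x \<le> 1"
  shows "x / 2 \<le> sin x"
proof -
  have x2: "x\<^sup>2 \<le> 1" using assms by (simp add: power_le_one)
  have "x * (1 / 2) \<le> x * (1 - x\<^sup>2 / 2)" using assms x2 by (intro mult_left_mono) auto
  also have "\<dots> \<le> x * cos x" using assms cos_ge_one_minus_square by (intro mult_left_mono) auto
  also have "\<dots> \<le> sin x" using assms pi_gt3 by (intro x_cos_le_sin) auto
  finally show ?thesis by simp
qed

text \<open>k and M - k have the same squared cosine; passing to the smaller one makes the angle at
  most \<pi>/2, where the cosine is nonnegative and its upper bound may be squared.\<close>

lemma cos_square_eigen_le:
  fixes k M N :: nat
  assumes "1 \<le> k" "k < M"
  shows "((cos (pi * real k / real M))\<^sup>2) ^ N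
     \<le> exp (- real N * (pi\<^sup>2 * (real (min k (M - k)))\<^sup>2 / (real M)\<^sup>2))"
proof -
  let ?\<kappa> = "min k (M - k)"
  have "(cos (pi * real k / real M))\<^sup>2 = (cos (pi * real ?\<kappa> / real M))\<^sup>2"
  proof (cases "k \<le> M - k")
    case False
    have "pi * real (M - k) / real M = pi - pi * real k / real M"
      using assms by (simp add: of_nat_diff field_simps)
    then have "cos (pi * real (M - k) / real M) = - cos (pi * real k / real M)"
      by simp
    then show ?thesis using False by (simp add: min_def)
  qed (simp add: min_def)
  moreover have "0 \<le> cos (pi * real ?\<kappa> / real M) \<and>
      cos (pi * real ?\<kappa> / real M) \<le> exp (- ((pi * real ?\<kappa> / real M)\<^sup>2) / 2)"
  proof
    have "2 * real ?\<kappa> \<le> real M" by auto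
    then have le: "pi * real ?\<kappa> / real M \<le> pi / 2"
      using assms by (simp add: field_simps)
    then show "0 \<le> cos (pi * real ?\<kappa> / real M)"
      by (intro cos_ge_zero) (auto intro: order.trans[of _ 0])
    show "cos (pi * real ?\<kappa> / real M) \<le> exp (- ((pi * real ?\<kappa> / real M)\<^sup>2) / 2)"
      using order.trans[OF le, of pi] by (intro cos_le_exp_neg_square) auto
  qed
  ultimately have "(cos (pi * real k / real M))\<^sup>2 \<le> (exp (- ((pi * real ?\<kappa> / real M)\<^sup>2) / 2))\<^sup>2"
    by (auto intro: power_mono)
  also have "\<dots> = exp (- ((pi * real ?\<kappa> / real M)\<^sup>2))"
    by (simp add: power2_eq_square flip: exp_add)
  finally have "((cos (pi * real k / real M))\<^sup>2) ^ N \<le> exp (- ((pi * real ?\<kappa> / real M)\<^sup>2)) ^ N"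
    by (intro power_mono) auto
  also have "\<dots> = exp (- real N * (pi\<^sup>2 * (real ?\<kappa>)\<^sup>2 / (real M)\<^sup>2))"
    by (simp add: exp_of_nat_mult[symmetric] power_mult_distrib power_divide)
  finally show ?thesis .
qed

lemma tan_square_over_square_tendsto: "((\<lambda>x::real. (tan x)\<^sup>2 / x\<^sup>2) \<longlongrightarrow> 1) (at 0)"
proof -
  have "((\<lambda>x::real. (sin x / x / cos x)\<^sup>2) \<longlongrightarrow> (1 / cos 0)\<^sup>2) (at 0)"
    by (intro tendsto_intros sinc_at_0) auto
  then show ?thesis by (simp add: tan_def power_divide field_simps)
qed

text \<open>The saddle point: with \<open>M = x n\<^sup>1\<^sup>/\<^sup>3\<close> the summand of height \<open>m = M - 2\<close> behaves
  like \<open>exp (- n\<^sup>1\<^sup>/\<^sup>3 (\<mu> x + \<pi>\<^sup>2 / x\<^sup>2))\<close>.\<close>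
locale height_coupling =
  fixes \<mu> :: real
  assumes \<mu>_pos: "\<mu> > 0"
begin

text \<open>The minimiser of \<mu> x + \<pi>^2 / x^2, whose derivative vanishes at \<mu> x^3 = 2
  \<pi>^2; \<open>\<phi>0\<close> is the minimum.\<close>

definition x0 :: real where "x0 = root 3 (2 * pi\<^sup>2 / \<mu>)"
definition \<phi>0 :: real where "\<phi>0 = \<mu> * x0 + pi\<^sup>2 / x0\<^sup>2"

lemma x0_pos: "x0 > 0"
  unfolding x0_def using \<mu>_pos by simp

lemma x0_cube: "\<mu> * x0 ^ 3 = 2 * pi\<^sup>2"
  unfolding x0_def using \<mu>_pos by (simp add: odd_real_root_pow)

text \<open>The double zero at \<open>x0\<close> is factored out exactly, which replaces a Taylor
  expansion.\<close>

lemma saddle_identity: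
  assumes "x > 0"
  shows "\<mu> * x + pi\<^sup>2 / x\<^sup>2 - \<phi>0 = \<mu> * (x - x0)\<^sup>2 * (2 * x + x0) / (2 * x\<^sup>2)"
proof -
  have p: "pi\<^sup>2 = \<mu> * x0 ^ 3 / 2" using x0_cube by simp
  have "\<phi>0 = 3 / 2 * \<mu> * x0"
    unfolding \<phi>0_def p using x0_pos by (simp add: field_simps power2_eq_square power3_eq_cube)
  then show ?thesis
    unfolding p using assms x0_pos
    by (simp add: field_simps power2_eq_square power3_eq_cube)
qed

text \<open>There are two ways to leave the saddle: x away from \<open>x0\<close>, or an eigenvalue
  index \<kappa> \<ge> 2. The gap grows with x: after multiplication by n^(1/3) its constant part
  gives the exponential gain, and its linear part a decay in M that makes the sum over m
  converge.\<close>

lemma saddle_gap: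
  assumes "\<delta> > 0"
  shows "\<exists>\<eta>>0. \<forall>x>0. \<forall>\<kappa>::nat. 1 \<le> \<kappa> \<longrightarrow> 2 \<le> \<kappa> \<or> \<bar>x - x0\<bar> \<ge> \<delta> \<longrightarrow>
     \<phi>0 + \<eta> * (1 + x) \<le> \<mu> * x + pi\<^sup>2 * (real \<kappa>)\<^sup>2 / x\<^sup>2"
proof -
  \<comment> \<open>Chosen so that \<open>x \<le> A * \<bar>x - x0\<bar>\<close> and
    \<open>1 + x \<le> B * \<bar>x - x0\<bar>\<close> whenever
    \<open>\<bar>x - x0\<bar> \<ge> \<delta>\<close>.\<close>
  define A where "A = (1 + x0 / \<delta>)"
  define B where "B = 1 / \<delta> + A"
  have A: "A > 0" and B: "B > 0"
    using assms x0_pos by (auto simp: A_def B_def add_pos_pos)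
  define \<eta>1 where "\<eta>1 = \<mu> / (A * B)"
  \<comment> \<open>For \<open>x < x0 + \<delta>\<close> the excess 3 \<pi>^2 / x^2 of \<kappa> = 2
    over \<kappa> = 1 is at least \<open>\<eta>2 * (1 + x)\<close>.\<close>
  define \<eta>2 where "\<eta>2 = 3 * pi\<^sup>2 / ((x0 + \<delta>)\<^sup>2 * (1 + x0 + \<delta>))"
  define \<eta> where "\<eta> = min \<eta>1 \<eta>2"
  have \<eta>1: "\<eta>1 > 0" unfolding \<eta>1_def using A B \<mu>_pos by simp
  have \<eta>2: "\<eta>2 > 0" unfolding \<eta>2_def using assms x0_pos by (simp add: add_pos_pos)
  have far: "\<phi>0 + \<eta> * (1 + x) \<le> \<mu> * x + pi\<^sup>2 / x\<^sup>2" if "x > 0" "\<bar>x - x0\<bar> \<ge> \<delta>" for x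
  proof -
    let ?y = "\<bar>x - x0\<bar>"
    have "x \<le> ?y + x0" by linarith
    moreover have "x0 \<le> ?y * (x0 / \<delta>)" using that assms x0_pos by (simp add: field_simps)
    ultimately have 1: "x \<le> ?y * A" unfolding A_def distrib_left mult_1_right by linarith
    have "1 \<le> ?y * (1 / \<delta>)" using that assms by (simp add: field_simps)
    with 1 have 2: "1 + x \<le> ?y * B" unfolding B_def distrib_left by linarith
    have "x * (1 + x) \<le> (?y * A) * (?y * B)"
      using 1 2 that by (intro mult_mono) auto
    also have "\<dots> = (x - x0)\<^sup>2 * (A * B)" by (simp add: power2_eq_square abs_mult_self_eq algebra_simps)
    finally have "\<mu> * (x * (1 + x)) \<le> \<mu> * ((x - x0)\<^sup>2 * (A * B))"
      using \<mu>_pos by (intro mult_left_mono) auto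
    then have 3: "\<eta>1 * (1 + x) \<le> \<mu> * (x - x0)\<^sup>2 / x"
      unfolding \<eta>1_def using A B that by (simp add: field_simps)
    have "\<mu> * (x - x0)\<^sup>2 / x = \<mu> * (x - x0)\<^sup>2 * (2 * x) / (2 * x\<^sup>2)"
      using that by (simp add: field_simps power2_eq_square)
    also have "\<dots> \<le> \<mu> * (x - x0)\<^sup>2 * (2 * x + x0) / (2 * x\<^sup>2)"
      using that x0_pos \<mu>_pos by (intro divide_right_mono mult_left_mono) auto
    finally have "\<eta>1 * (1 + x) \<le> \<mu> * x + pi\<^sup>2 / x\<^sup>2 - \<phi>0"
      using 3 saddle_identity[OF that(1)] by simp
    moreover have "\<eta> * (1 + x) \<le> \<eta>1 * (1 + x)"
      using that by (intro mult_right_mono) (auto simp: \<eta>_def)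
    ultimately show ?thesis by simp
  qed
  have near: "\<phi>0 + \<eta> * (1 + x) \<le> \<mu> * x + pi\<^sup>2 * 4 / x\<^sup>2" if "x > 0" "\<bar>x - x0\<bar> < \<delta>" for x
  proof -
    have x: "x \<le> x0 + \<delta>" using that by linarith
    define a where "a = pi\<^sup>2 / x\<^sup>2"
    have "\<eta> * (1 + x) \<le> \<eta>2 * (1 + x0 + \<delta>)"
      using that x \<eta>2 \<eta>1 by (intro mult_mono) (auto simp: \<eta>_def)
    also have "\<dots> = 3 * pi\<^sup>2 / (x0 + \<delta>)\<^sup>2"
    proof -
      have "p / (a * b) * b = p / a" if "b > 0" for p a b :: real
        using that by simp
      then show ?thesis using assms x0_pos unfolding \<eta>2_def by simp
    qed
    also have "\<dots> \<le> 3 * pi\<^sup>2 / x\<^sup>2"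
      using that x by (intro divide_left_mono power_mono) auto
    finally have 1: "\<eta> * (1 + x) \<le> 3 * a" by (simp add: a_def)
    have "0 \<le> \<mu> * x + a - \<phi>0"
      unfolding a_def saddle_identity[OF that(1)] using that x0_pos \<mu>_pos by simp
    with 1 have "\<phi>0 + \<eta> * (1 + x) \<le> \<mu> * x + 4 * a" by linarith
    then show ?thesis by (simp add: a_def mult.commute)
  qed
  have "\<phi>0 + \<eta> * (1 + x) \<le> \<mu> * x + pi\<^sup>2 * (real \<kappa>)\<^sup>2 / x\<^sup>2"
    if x: "x > 0" "1 \<le> \<kappa>" "2 \<le> \<kappa> \<or> \<bar>x - x0\<bar> \<ge> \<delta>" for x :: real and \<kappa> :: nat
  proof (cases "\<bar>x - x0\<bar> \<ge> \<delta>")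
    case True
    have "(1::real)\<^sup>2 \<le> (real \<kappa>)\<^sup>2" using x by (intro power_mono) auto
    then have "pi\<^sup>2 / x\<^sup>2 \<le> pi\<^sup>2 * (real \<kappa>)\<^sup>2 / x\<^sup>2"
      by (intro divide_right_mono) (auto intro: mult_left_mono[of 1, simplified])
    then show ?thesis using far[OF x(1) True] by linarith
  next
    case False
    then have "(2::real)\<^sup>2 \<le> (real \<kappa>)\<^sup>2" using x by (intro power_mono) auto
    then have "pi\<^sup>2 * 4 / x\<^sup>2 \<le> pi\<^sup>2 * (real \<kappa>)\<^sup>2 / x\<^sup>2"
      by (intro divide_right_mono mult_left_mono) auto
    then show ?thesis using near[OF x(1)] False by linarith
  qed
  moreover have "\<eta> > 0" using \<eta>1 \<eta>2 by (simp add: \<eta>_def)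
  ultimately show ?thesis by blast
qed

end

section \<open>Spectral weights and their concentration at the saddle\<close>

lemma root3_at_top: "filterlim (\<lambda>n. root 3 (real n)) at_top sequentially"
  by real_asymp

lemma root3_cube: "root 3 (real n) ^ 3 = real n"
  by (simp add: odd_real_root_pow)

context height_coupling
begin

abbreviation at_eigen :: "(real \<Rightarrow> real \<Rightarrow> real \<Rightarrow> real) \<Rightarrow> nat \<Rightarrow> nat \<Rightarrow> nat \<Rightarrow> real" where
  "at_eigen R n m k \<equiv> R (real n * (tan (eigenangle m k))\<^sup>2 * (1 / real (m + 2))) (1 / real (m + 2))
     ((tan (eigenangle m k))\<^sup>2)"

text \<open>Up to the factor -(4^n) these are the spectral summands of the n-th coefficient of Y_m,
  weighted by exp(-\<mu> m). They are nonnegative and so can serve as averaging weights.\<close>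

definition wt :: "nat \<Rightarrow> nat \<Rightarrow> nat \<Rightarrow> real" where
  "wt n m k = exp (- \<mu> * real m) * (1 / real (m + 2)) * (sin (eigenangle m k))\<^sup>2 *
     ((cos (eigenangle m k))\<^sup>2) ^ (n - 1)"

text \<open>The normalising sum, with its exponential growth \<open>4\<^sup>n\<close> removed.\<close>
definition part :: "nat \<Rightarrow> real" where
  "part n = (\<Sum>m. \<Sum>k=1..m+1. wt n m k)"

lemma wt_nonneg: "wt n m k \<ge> 0"
  by (simp add: wt_def)

lemma wt_le: "wt n m k \<le> exp (- \<mu> * real m) / real (m + 2)"
proof -
  have "(sin x)\<^sup>2 \<le> 1" "((cos x)\<^sup>2) ^ j \<le> 1" for x :: real and j
    using power_le_one[of "(cos x)\<^sup>2" j] by (auto simp: abs_square_le_1)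
  then have "(sin (eigenangle m k))\<^sup>2 * ((cos (eigenangle m k))\<^sup>2) ^ (n - 1) \<le> 1 * 1"
    by (intro mult_mono) auto
  then have "exp (- \<mu> * real m) / real (m + 2) * ((sin (eigenangle m k))\<^sup>2 *
      ((cos (eigenangle m k))\<^sup>2) ^ (n - 1)) \<le> exp (- \<mu> * real m) / real (m + 2) * 1"
    by (intro mult_left_mono) auto
  then show ?thesis by (simp add: wt_def mult.assoc)
qed

lemma summable_exp_neg:
  assumes "c > 0"
  shows "summable (\<lambda>m. exp (- c * real m))"
proof -
  have "exp (- c * real m) = exp (- c) ^ m" for m
    by (simp add: exp_of_nat_mult[symmetric] mult.commute)
  moreover have "norm (exp (- c)) < 1" using assms by simp
  ultimately show ?thesis by (simp add: summable_geometric)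
qed

lemma summable_wt: "summable (\<lambda>m. \<Sum>k=1..m+1. wt n m k)"
proof (rule summable_comparison_test'[OF summable_exp_neg[OF \<mu>_pos]])
  fix m :: nat
  have "(\<Sum>k=1..m+1. wt n m k) \<le> (\<Sum>k=1..m+1. exp (- \<mu> * real m) / real (m + 2))"
    by (intro sum_mono wt_le)
  also have "\<dots> = exp (- \<mu> * real m) * (real (m + 1) / real (m + 2))"
    by simp
  also have "\<dots> \<le> exp (- \<mu> * real m) * 1"
    by (intro mult_left_mono) auto
  finally show "norm (\<Sum>k=1..m+1. wt n m k) \<le> exp (- \<mu> * real m)"
    by (simp add: sum_nonneg wt_nonneg del: sum.cl_ivl_Suc)
qed

abbreviation decay :: "nat \<Rightarrow> nat \<Rightarrow> nat \<Rightarrow> real" where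
  "decay N m k \<equiv> exp (- \<mu> * real m) * ((cos (eigenangle m k))\<^sup>2) ^ N"

text \<open>The exponent gives up d powers of cos^2, which are later spent on polynomial factors in
  tan^2. The bound is \<open>saddle_gap\<close> at x = (m + 2) / n^(1/3), multiplied by
  n^(1/3).\<close>

lemma weight_outside_bound:
  assumes "\<delta> > 0"
  shows "\<exists>\<eta>>0. \<exists>C\<ge>0. \<forall>n\<ge>d + 1. \<forall>m k. 1 \<le> k \<longrightarrow> k \<le> m + 1 \<longrightarrow>
    (2 \<le> k \<and> k \<le> m) \<or> \<bar>real (m + 2) / root 3 (real n) - x0\<bar> \<ge> \<delta> \<longrightarrow>
    decay (n - 1 - d) m k
      \<le> C * exp (- root 3 (real n) * (\<phi>0 + \<eta>)) * exp (- \<eta> * real (m + 2))"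
proof -
  obtain \<eta> where \<eta>: "\<eta> > 0" "\<And>x \<kappa>. x > 0 \<Longrightarrow> 1 \<le> \<kappa> \<Longrightarrow> 2 \<le> \<kappa> \<or> \<bar>x - x0\<bar> \<ge> \<delta> \<Longrightarrow>
     \<phi>0 + \<eta> * (1 + x) \<le> \<mu> * x + pi\<^sup>2 * (real \<kappa>)\<^sup>2 / x\<^sup>2"
    using saddle_gap[OF assms] by blast
  \<comment> \<open>The term \<open>2 * \<mu>\<close> accounts for m = M - 2, the other one for the
    d + 1 missing powers of cos^2, each costing at most exp(\<pi>^2).\<close>
  define C where "C = exp (2 * \<mu> + real (d + 1) * pi\<^sup>2)"
  have "decay (n - 1 - d) m k
      \<le> C * exp (- root 3 (real n) * (\<phi>0 + \<eta>)) * exp (- \<eta> * real (m + 2))"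
    if n: "n \<ge> d + 1" and k: "1 \<le> k" "k \<le> m + 1"
      and out: "(2 \<le> k \<and> k \<le> m) \<or> \<bar>real (m + 2) / root 3 (real n) - x0\<bar> \<ge> \<delta>" for n m k
  proof -
    define \<kappa> where "\<kappa> = min k (m + 2 - k)"
    define M where "M = real (m + 2)"
    define r where "r = root 3 (real n)"
    have M: "M > 0" and r: "r > 0" using n by (auto simp: M_def r_def)
    have \<kappa>: "1 \<le> \<kappa>" "2 \<le> \<kappa> \<or> \<bar>M / r - x0\<bar> \<ge> \<delta>" "real \<kappa> \<le> M"
      using k out by (auto simp: \<kappa>_def M_def r_def)
    define q where "q = pi\<^sup>2 * (real \<kappa>)\<^sup>2 / M\<^sup>2"
    have "(real \<kappa>)\<^sup>2 \<le> M\<^sup>2" using \<kappa> by (intro power_mono) auto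
    then have q: "q \<le> pi\<^sup>2" using M by (simp add: q_def field_simps)
    have "((cos (eigenangle m k))\<^sup>2) ^ (n - 1 - d) \<le> exp (- real (n - 1 - d) * q)"
      using cos_square_eigen_le[of k "m + 2" "n - 1 - d"] k by (simp add: q_def \<kappa>_def M_def)
    also have "\<dots> = exp (real (d + 1) * q - real n * q)"
      using n by (simp add: of_nat_diff algebra_simps)
    also have "\<dots> \<le> exp (real (d + 1) * pi\<^sup>2 - real n * q)"
      using mult_left_mono[OF q, of "real (d + 1)"] by simp
    finally have c: "((cos (eigenangle m k))\<^sup>2) ^ (n - 1 - d) \<le> exp (real (d + 1) * pi\<^sup>2 - real n * q)" .
    have nr: "real n = r ^ 3" unfolding r_def by (simp add: root3_cube)
    have "\<phi>0 + \<eta> * (1 + M / r) \<le> \<mu> * (M / r) + pi\<^sup>2 * (real \<kappa>)\<^sup>2 / (M / r)\<^sup>2"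
      using \<kappa> M r by (intro \<eta>(2)) auto
    then have "r * (\<phi>0 + \<eta> * (1 + M / r)) \<le> r * (\<mu> * (M / r) + pi\<^sup>2 * (real \<kappa>)\<^sup>2 / (M / r)\<^sup>2)"
      using r by (intro mult_left_mono) auto
    also have "\<dots> = \<mu> * M + real n * q"
      unfolding nr q_def using r M by (simp add: field_simps power2_eq_square power3_eq_cube)
    also have "r * (\<phi>0 + \<eta> * (1 + M / r)) = r * (\<phi>0 + \<eta>) + \<eta> * M"
      using r by (simp add: field_simps)
    finally have le: "r * (\<phi>0 + \<eta>) + \<eta> * M \<le> \<mu> * M + real n * q" .
    have "decay (n - 1 - d) m k
       \<le> exp (2 * \<mu> - \<mu> * M) * exp (real (d + 1) * pi\<^sup>2 - real n * q)"
      using c by (intro mult_mono) (auto simp: M_def algebra_simps)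
    also have "\<dots> = C * exp (- (\<mu> * M + real n * q))"
      by (simp add: C_def exp_add[symmetric] algebra_simps)
    also have "\<dots> \<le> C * exp (- (r * (\<phi>0 + \<eta>) + \<eta> * M))"
      using le by (intro mult_left_mono) (auto simp: C_def)
    also have "\<dots> = C * exp (- r * (\<phi>0 + \<eta>)) * exp (- \<eta> * M)"
      by (simp add: exp_add[symmetric] algebra_simps)
    finally show ?thesis unfolding r_def M_def .
  qed
  then show ?thesis using \<eta>(1) by (intro exI[of _ \<eta>] conjI exI[of _ C]) (auto simp: C_def)
qed

text \<open>A single summand suffices: k = 1, with M equal to x0 n^(1/3) rounded up. Its prefactor
  sin(\<pi>/M)^2 / M is of order 1 / n.\<close>

lemma part_lower_bound:
  "\<exists>c>0. \<forall>\<^sub>F n in sequentially. c * exp (- root 3 (real n) * \<phi>0) / real n \<le> part n"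
proof -
  \<comment> \<open>The losses are \<mu> from rounding M up, \<pi>^4 / x0^4 from the quartic term of
    \<open>cos_ge_exp\<close>, and the cube from M \<le> (x0 + 1) n^(1/3).\<close>
  define c where "c = exp (- \<mu> - pi ^ 4 / x0 ^ 4) / (x0 + 1) ^ 3"
  have c: "c > 0" using x0_pos by (simp add: c_def)
  \<comment> \<open>The bound \<open>4 / x0\<close> forces M \<ge> 4, hence \<pi>/M \<le> 1, as
    \<open>cos_ge_exp\<close> requires.\<close>
  have "\<forall>\<^sub>F n in sequentially. root 3 (real n) \<ge> max 1 (4 / x0)"
    using root3_at_top unfolding filterlim_at_top by blast
  then have "\<forall>\<^sub>F n in sequentially. c * exp (- root 3 (real n) * \<phi>0) / real n \<le> part n"
  proof eventually_elim
    case (elim n)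
    define r where "r = root 3 (real n)"
    have r: "r \<ge> 1" "r \<ge> 4 / x0" using elim by (auto simp: r_def)
    have nr: "real n = r ^ 3" unfolding r_def by (simp add: root3_cube)
    have xr: "x0 * r \<ge> 4" using r x0_pos by (simp add: field_simps)
    define M where "M = nat \<lceil>x0 * r\<rceil>"
    have M: "real M \<ge> x0 * r" "real M \<le> x0 * r + 1" using xr by (auto simp: M_def of_nat_nat)
    have M4: "M \<ge> 4" using M xr by linarith
    define m where "m = M - 2"
    have m: "m + 2 = M" using M4 by (simp add: m_def)
    define y where "y = pi / real M"
    have y: "y > 0" "y \<le> pi / (x0 * r)" "y \<le> 1"
      using M xr M4 pi_less_4 x0_pos r by (auto simp: y_def field_simps intro!: divide_left_mono)
    have "exp (- (\<mu> * (x0 * r + 1))) \<le> exp (- \<mu> * real m)"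
      using \<mu>_pos M m by (auto simp: mult_left_mono)
    moreover have "1 / ((x0 + 1) ^ 3 * real n) \<le> (1 / real M) * (sin y)\<^sup>2"
    proof -
      have "x0 * r + 1 \<le> (x0 + 1) * r" using r by (simp add: algebra_simps)
      then have "real M \<le> (x0 + 1) * r" using M by linarith
      then have "real M ^ 3 \<le> ((x0 + 1) * r) ^ 3" by (intro power_mono) auto
      then have "1 / ((x0 + 1) ^ 3 * real n) \<le> 1 / real M ^ 3"
        using M4 x0_pos r unfolding nr by (intro divide_left_mono) (auto simp: power_mult_distrib)
      also have "\<dots> = 1 / real M * (1 / real M)\<^sup>2" by (simp add: power2_eq_square power3_eq_cube)
      also have "1 / real M \<le> y / 2" unfolding y_def using M4 pi_gt3 by (simp add: field_simps)
      then have "1 / real M * (1 / real M)\<^sup>2 \<le> 1 / real M * (y / 2)\<^sup>2"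
        by (intro mult_left_mono power_mono) auto
      also have "\<dots> \<le> 1 / real M * (sin y)\<^sup>2"
        using sin_ge_half[of y] y by (intro mult_left_mono power_mono) auto
      finally show ?thesis .
    qed
    moreover have "exp (- (r * (pi\<^sup>2 / x0\<^sup>2) + pi ^ 4 / x0 ^ 4)) \<le> ((cos y)\<^sup>2) ^ (n - 1)"
    proof -
      have "y\<^sup>2 \<le> (pi / (x0 * r))\<^sup>2" "y ^ 4 \<le> (pi / (x0 * r)) ^ 4"
        using y by (auto intro!: power_mono)
      then have "real n * y\<^sup>2 + real n * y ^ 4 \<le> real n * (pi / (x0 * r))\<^sup>2 + real n * (pi / (x0 * r)) ^ 4"
        by (intro add_mono mult_left_mono) auto
      also have "\<dots> = r * (pi\<^sup>2 / x0\<^sup>2) + (pi ^ 4 / x0 ^ 4) / r"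
        unfolding nr using r x0_pos
        by (simp add: field_simps power2_eq_square power3_eq_cube power4_eq_xxxx)
      also have "(pi ^ 4 / x0 ^ 4) / r \<le> (pi ^ 4 / x0 ^ 4) / 1"
        using r x0_pos by (intro divide_left_mono) auto
      finally have le: "real n * y\<^sup>2 + real n * y ^ 4 \<le> r * (pi\<^sup>2 / x0\<^sup>2) + pi ^ 4 / x0 ^ 4" by simp
      have "exp (- (r * (pi\<^sup>2 / x0\<^sup>2) + pi ^ 4 / x0 ^ 4)) \<le> exp (- (real n * y\<^sup>2 + real n * y ^ 4))"
        using le by simp
      also have "\<dots> = (exp (- (y\<^sup>2) / 2 - y ^ 4 / 2))\<^sup>2 ^ n"
        by (simp add: exp_of_nat_mult[symmetric] power2_eq_square exp_add[symmetric] algebra_simps)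
      also have "\<dots> \<le> ((cos y)\<^sup>2) ^ n"
        using cos_ge_exp[of y] y by (intro power_mono) auto
      also have "\<dots> \<le> ((cos y)\<^sup>2) ^ (n - 1)"
        by (intro power_decreasing) (auto simp: abs_square_le_1)
      finally show ?thesis .
    qed
    ultimately have "exp (- (\<mu> * (x0 * r + 1))) * (1 / ((x0 + 1) ^ 3 * real n)) *
        exp (- (r * (pi\<^sup>2 / x0\<^sup>2) + pi ^ 4 / x0 ^ 4))
      \<le> exp (- \<mu> * real m) * ((1 / real M) * (sin y)\<^sup>2) * ((cos y)\<^sup>2) ^ (n - 1)"
      using x0_pos by (intro mult_mono) auto
    also have "\<dots> = wt n m 1" unfolding wt_def m y_def by (simp add: mult.assoc)
    also have "\<dots> \<le> (\<Sum>k=1..m+1. wt n m k)"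
      by (rule member_le_sum) (auto simp: wt_nonneg)
    also have "\<dots> = (\<Sum>m\<in>{m}. \<Sum>k=1..m+1. wt n m k)" by simp
    also have "\<dots> \<le> part n"
      unfolding part_def by (intro sum_le_suminf summable_wt) (auto intro!: sum_nonneg wt_nonneg simp del: sum.cl_ivl_Suc)
    also have "exp (- (\<mu> * (x0 * r + 1))) * (1 / ((x0 + 1) ^ 3 * real n)) *
        exp (- (r * (pi\<^sup>2 / x0\<^sup>2) + pi ^ 4 / x0 ^ 4)) = c * exp (- r * \<phi>0) / real n"
    proof -
      have "exp (- (\<mu> * (x0 * r + 1))) * exp (- (r * (pi\<^sup>2 / x0\<^sup>2) + pi ^ 4 / x0 ^ 4))
        = exp (- \<mu> - pi ^ 4 / x0 ^ 4) * exp (- r * \<phi>0)"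
        unfolding exp_add[symmetric] \<phi>0_def by (simp add: algebra_simps)
      then show ?thesis unfolding c_def by (simp add: field_simps)
    qed
    finally show ?case unfolding r_def .
  qed
  then show ?thesis using c by blast
qed

lemma part_pos: "\<forall>\<^sub>F n in sequentially. part n > 0"
proof -
  obtain c where c: "c > 0" "\<forall>\<^sub>F n in sequentially. c * exp (- root 3 (real n) * \<phi>0) / real n \<le> part n"
    using part_lower_bound by blast
  show ?thesis using c(2) eventually_gt_at_top[of 0]
    by eventually_elim (use c(1) in \<open>auto intro: less_le_trans[rotated]\<close>)
qed

text \<open>At the two extreme indices the arguments (v, e, t) tend to (\<mu>/2, 0, 0) as n grows
  and (m + 2) / n^(1/3) approaches \<open>x0\<close>.\<close>

lemma polyfun3_window:
  assumes R: "polyfun3 R" and "\<epsilon> > 0"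
  shows "\<exists>\<delta>>0. \<forall>\<^sub>F n in sequentially. \<forall>m k. \<bar>real (m + 2) / root 3 (real n) - x0\<bar> < \<delta> \<longrightarrow>
    k = 1 \<or> k = m + 1 \<longrightarrow>
    \<bar>at_eigen R n m k - R (\<mu> / 2) 0 0\<bar> < \<epsilon>"
proof -
  define x :: "nat \<times> nat \<Rightarrow> real" where "x p = real (snd p + 2) / root 3 (real (fst p))" for p
  \<comment> \<open>The joint limit in n and (m + 2) / n^(1/3) is a filter on pairs (n, m);
    unfolding \<open>eventually\<close> in it yields the width \<delta> and the threshold for n
    separately.\<close>
  define F where "F = inf (filtercomap x (nhds x0)) (filtercomap fst sequentially)"
  define M :: "nat \<times> nat \<Rightarrow> real" where "M p = real (snd p + 2)" for p
  define t where "t p = (tan (pi / M p))\<^sup>2" for p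
  have x: "(x \<longlongrightarrow> x0) F"
    unfolding F_def by (intro filterlim_mono[OF filterlim_filtercomap[of x "nhds x0"]]) auto
  have fst: "filterlim fst sequentially F"
    unfolding F_def by (intro filterlim_mono[OF filterlim_filtercomap[of fst sequentially]]) auto
  have r: "filterlim (\<lambda>p. root 3 (real (fst p))) at_top F"
    using filterlim_compose[OF root3_at_top fst] .
  have pos: "\<forall>\<^sub>F p in F. root 3 (real (fst p)) > 0"
    using r unfolding filterlim_at_top_dense by blast
  have Mx: "\<forall>\<^sub>F p in F. x p * root 3 (real (fst p)) = M p"
    using pos by eventually_elim (auto simp: x_def M_def)
  have M: "filterlim M at_top F"
    using filterlim_tendsto_pos_mult_at_top[OF x x0_pos r] by (rule filterlim_cong[THEN iffD1, rotated -1]) (use Mx in auto)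
  have e: "((\<lambda>p. 1 / M p) \<longlongrightarrow> 0) F"
    using tendsto_divide_0[OF tendsto_const filterlim_at_top_imp_at_infinity[OF M]] .
  have y0: "((\<lambda>p. pi / M p) \<longlongrightarrow> 0) F"
    using tendsto_divide_0[OF tendsto_const filterlim_at_top_imp_at_infinity[OF M]] .
  have y: "filterlim (\<lambda>p. pi / M p) (at 0) F"
    using y0 by (auto simp: filterlim_at M_def)
  have t: "(t \<longlongrightarrow> 0) F"
    using tendsto_power[OF tendsto_divide[OF tendsto_sin[OF y0] tendsto_cos[OF y0]], of 2]
    by (simp add: t_def[abs_def] tan_def)
  \<comment> \<open>The argument v is (n^(1/3) / M)^3 \<pi>^2 times the quotient tan(y)^2 / y^2 at y
    = \<pi>/M, which tends to 1.\<close>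
  have v: "((\<lambda>p. real (fst p) * t p * (1 / M p)) \<longlongrightarrow> \<mu> / 2) F"
  proof -
    have lim: "((\<lambda>p. (1 / x p) ^ 3 * pi\<^sup>2 * ((tan (pi / M p))\<^sup>2 / (pi / M p)\<^sup>2)) \<longlongrightarrow> (1 / x0) ^ 3 * pi\<^sup>2 * 1) F"
      using x0_pos by (intro tendsto_intros x filterlim_compose[OF tan_square_over_square_tendsto y]) auto
    have val: "(1 / x0) ^ 3 * pi\<^sup>2 * 1 = \<mu> / 2"
      using x0_cube x0_pos by (simp add: field_simps)
    have ev: "\<forall>\<^sub>F p in F. (1 / x p) ^ 3 * pi\<^sup>2 * ((tan (pi / M p))\<^sup>2 / (pi / M p)\<^sup>2)
       = real (fst p) * t p * (1 / M p)"
      using pos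
    proof eventually_elim
      case (elim p)
      have "1 / x p = root 3 (real (fst p)) / M p" by (simp add: x_def M_def)
      then have "(1 / x p) ^ 3 = real (fst p) / M p ^ 3"
        by (simp add: power_divide root3_cube)
      moreover have "N / b ^ 3 * pi\<^sup>2 * (c / (pi / b)\<^sup>2) = N * c * (1 / b)" if "b \<noteq> 0" for N b c :: real
        using that by (simp add: field_simps power2_eq_square power3_eq_cube)
      ultimately show ?case by (simp add: t_def M_def)
    qed
    show ?thesis using lim unfolding val tendsto_cong[OF ev] .
  qed
  have "((\<lambda>p. R (real (fst p) * t p * (1 / M p)) (1 / M p) (t p)) \<longlongrightarrow> R (\<mu> / 2) 0 0) F"
    by (rule polyfun3_tendsto[OF R v e t])
  then have "\<forall>\<^sub>F p in F. \<bar>R (real (fst p) * t p * (1 / M p)) (1 / M p) (t p) - R (\<mu> / 2) 0 0\<bar> < \<epsilon>"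
    using \<open>\<epsilon> > 0\<close> by (auto simp: tendsto_iff dist_real_def)
  then obtain P Q where P: "eventually P (nhds x0)" and Q: "eventually Q sequentially"
    and PQ: "\<And>p. P (x p) \<Longrightarrow> Q (fst p) \<Longrightarrow>
       \<bar>R (real (fst p) * t p * (1 / M p)) (1 / M p) (t p) - R (\<mu> / 2) 0 0\<bar> < \<epsilon>"
    unfolding F_def eventually_inf eventually_filtercomap by blast
  from P obtain \<delta> where \<delta>: "\<delta> > 0" "\<And>z. \<bar>z - x0\<bar> < \<delta> \<Longrightarrow> P z"
    by (auto simp: eventually_nhds_metric dist_real_def)
  have tk: "(tan (eigenangle m k))\<^sup>2 = t (n, m)" if "k = 1 \<or> k = m + 1" for n m k
  proof (cases "k = 1")
    case False
    then have k: "k = m + 1" using that by simp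
    have "eigenangle m k = pi - pi / real (m + 2)"
      unfolding k by (simp add: field_simps)
    then show ?thesis by (simp add: t_def M_def tan_def)
  qed (simp add: t_def M_def)
  from Q have "\<forall>\<^sub>F n in sequentially. \<forall>m k. \<bar>real (m + 2) / root 3 (real n) - x0\<bar> < \<delta> \<longrightarrow>
    k = 1 \<or> k = m + 1 \<longrightarrow>
    \<bar>at_eigen R n m k - R (\<mu> / 2) 0 0\<bar> < \<epsilon>"
  proof eventually_elim
    case (elim n)
    show ?case
    proof (intro allI impI)
      fix m k assume a: "\<bar>real (m + 2) / root 3 (real n) - x0\<bar> < \<delta>" "k = 1 \<or> k = m + 1"
      show "\<bar>at_eigen R n m k - R (\<mu> / 2) 0 0\<bar> < \<epsilon>"
        using PQ[of "(n, m)"] \<delta>(2)[of "x (n, m)"] a elim tk[OF a(2), of n]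
        by (simp add: x_def M_def)
    qed
  qed
  then show ?thesis using \<delta>(1) by blast
qed

end

context height_coupling
begin

definition wavg :: "(real \<Rightarrow> real \<Rightarrow> real \<Rightarrow> real) \<Rightarrow> nat \<Rightarrow> nat \<Rightarrow> real" where
  "wavg R n m = (\<Sum>k=1..m+1. wt n m k *
     at_eigen R n m k)"

text \<open>Pays for the m + 1 eigenvalues of a row with half of the exponential decay.\<close>

lemma linear_times_exp_le:
  assumes "c > 0"
  shows "real (m + 1) * exp (- c * real m) \<le> 2 / c * exp (c / 2) * exp (- (c / 2) * real m)"
proof -
  have "c / 2 * real (m + 1) \<le> exp (c / 2 * real (m + 1))"
    using exp_ge_add_one_self[of "c / 2 * real (m + 1)"] by linarith
  then have "real (m + 1) \<le> 2 / c * exp (c / 2 * real (m + 1))"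
    using assms by (simp add: field_simps)
  then have "real (m + 1) * exp (- c * real m) \<le> 2 / c * exp (c / 2 * real (m + 1)) * exp (- c * real m)"
    by (intro mult_right_mono) auto
  also have "\<dots> = 2 / c * exp (c / 2) * exp (- (c / 2) * real m)"
  proof -
    have "c / 2 * real (m + 1) + - c * real m = c / 2 + - (c / 2) * real m"
      by (simp add: field_simps)
    then show ?thesis unfolding mult.assoc exp_add[symmetric] by simp
  qed
  finally show ?thesis .
qed

text \<open>As 1 + tan^2 = 1 / cos^2, growth of order d in tan^2 costs at most d of the n - 1 powers
  of cos^2; the power of n comes from the argument v.\<close>

lemma wt_polyfun3_bound:
  assumes "polyfun3 R"
  shows "\<exists>C\<ge>0. \<exists>d. \<forall>n\<ge>d + 2. \<forall>m k. wt n m k *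
     \<bar>at_eigen R n m k\<bar>
     \<le> C * real n ^ d * decay (n - 1 - d) m k"
proof -
  obtain C d where C: "C \<ge> 0" "\<And>v e t. \<bar>R v e t\<bar> \<le> C * (1 + \<bar>v\<bar> + \<bar>e\<bar> + \<bar>t\<bar>) ^ d"
    using polyfun3_bound[OF assms] by blast
  have "wt n m k * \<bar>at_eigen R n m k\<bar>
     \<le> C * 2 ^ d * real n ^ d * decay (n - 1 - d) m k"
    if n: "n \<ge> d + 2" for n m k
  proof -
    define \<theta> where "\<theta> = eigenangle m k"
    define t where "t = (tan \<theta>)\<^sup>2"
    define e where "e = 1 / real (m + 2)"
    have t: "t \<ge> 0" and e: "e \<ge> 0" "e \<le> 1" by (auto simp: t_def e_def)
    have "real n * t * e \<le> real n * t" using t e n by (intro mult_left_le) auto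
    moreover have "t \<le> real n * t" using t n mult_right_mono[of 1 "real n" t] by simp
    ultimately have "1 + \<bar>real n * t * e\<bar> + \<bar>e\<bar> + \<bar>t\<bar> \<le> 2 * real n * (1 + t)"
      using t e n by (simp add: algebra_simps)
    then have "\<bar>R (real n * t * e) e t\<bar> \<le> C * (2 * real n * (1 + t)) ^ d"
      using C(1) t e by (intro order.trans[OF C(2)] mult_left_mono power_mono) auto
    then have "wt n m k * \<bar>R (real n * t * e) e t\<bar> \<le> wt n m k * (C * (2 * real n * (1 + t)) ^ d)"
      by (intro mult_left_mono wt_nonneg) auto
    also have "\<dots> = (C * 2 ^ d * real n ^ d) * (wt n m k * (1 + t) ^ d)"
      unfolding power_mult_distrib by (simp only: mult_ac)
    also have "\<dots> \<le> (C * 2 ^ d * real n ^ d) * (exp (- \<mu> * real m) * ((cos \<theta>)\<^sup>2) ^ (n - 1 - d))"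
    proof (intro mult_left_mono)
      have 1: "((cos \<theta>)\<^sup>2) ^ (n - 1) * (1 + t) ^ d \<le> ((cos \<theta>)\<^sup>2) ^ (n - 1 - d)"
      proof (cases "cos \<theta> = 0")
        case False
        have "((cos \<theta>)\<^sup>2) ^ (n - 1) = ((cos \<theta>)\<^sup>2) ^ (n - 1 - d) * ((cos \<theta>)\<^sup>2) ^ d"
          using n by (simp add: power_add[symmetric])
        moreover have "(cos \<theta>)\<^sup>2 * (1 + t) = 1"
          using False by (simp add: t_def tan_def field_simps)
        then have "((cos \<theta>)\<^sup>2) ^ d * (1 + t) ^ d = 1" by (simp add: power_mult_distrib[symmetric])
        ultimately show ?thesis by (simp add: mult.assoc)
      qed (use n in \<open>simp add: power_0_left\<close>)
      have 2: "e * (sin \<theta>)\<^sup>2 \<le> 1 * 1"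
        using e by (intro mult_mono) (auto simp: abs_square_le_1)
      have "(e * (sin \<theta>)\<^sup>2) * (((cos \<theta>)\<^sup>2) ^ (n - 1) * (1 + t) ^ d) \<le> (1 * 1) * ((cos \<theta>)\<^sup>2) ^ (n - 1 - d)"
        using t by (intro mult_mono[OF 2 1]) auto
      then have "exp (- \<mu> * real m) * ((e * (sin \<theta>)\<^sup>2) * (((cos \<theta>)\<^sup>2) ^ (n - 1) * (1 + t) ^ d))
          \<le> exp (- \<mu> * real m) * ((1 * 1) * ((cos \<theta>)\<^sup>2) ^ (n - 1 - d))"
        by (rule mult_left_mono) simp
      then show "wt n m k * (1 + t) ^ d \<le> exp (- \<mu> * real m) * ((cos \<theta>)\<^sup>2) ^ (n - 1 - d)"
        by (simp add: wt_def e_def \<theta>_def mult_ac)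
    qed (use C in auto)
    finally show ?thesis by (simp add: t_def e_def \<theta>_def)
  qed
  then show ?thesis using C(1) by (intro exI[of _ "C * 2 ^ d"] conjI exI[of _ d]) auto
qed

lemma summable_wavg:
  assumes "polyfun3 R"
  shows "\<forall>\<^sub>F n in sequentially. summable (wavg R n)"
proof -
  obtain C d where C: "C \<ge> 0" "\<And>n m k. n \<ge> d + 2 \<Longrightarrow> wt n m k *
     \<bar>at_eigen R n m k\<bar>
     \<le> C * real n ^ d * decay (n - 1 - d) m k"
    using wt_polyfun3_bound[OF assms] by blast
  have "summable (wavg R n)" if n: "n \<ge> d + 2" for n
  proof (rule summable_comparison_test')
    have "summable (\<lambda>m. 2 / \<mu> * exp (\<mu> / 2) * exp (- (\<mu> / 2) * real m))"
      using \<mu>_pos by (intro summable_mult summable_exp_neg) auto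
    then show "summable (\<lambda>m. C * real n ^ d * (2 / \<mu> * exp (\<mu> / 2) * exp (- (\<mu> / 2) * real m)))"
      by (rule summable_mult)
    fix m :: nat
    have "\<bar>wavg R n m\<bar> \<le> (\<Sum>k=1..m+1. C * real n ^ d * exp (- \<mu> * real m))"
      unfolding wavg_def
    proof (rule order.trans[OF sum_abs sum_mono])
      fix k
      have "((cos (eigenangle m k))\<^sup>2) ^ (n - 1 - d) \<le> 1"
        by (rule power_le_one) (auto simp: abs_square_le_1)
      then have "C * real n ^ d * decay (n - 1 - d) m k
         \<le> C * real n ^ d * (exp (- \<mu> * real m) * 1)"
        using C(1) by (intro mult_left_mono) auto
      with C(2)[OF n, of m k]
      show "\<bar>wt n m k * at_eigen R n m k\<bar> \<le> C * real n ^ d * exp (- \<mu> * real m)"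
        by (simp add: abs_mult wt_nonneg)
    qed
    also have "\<dots> = C * real n ^ d * (real (m + 1) * exp (- \<mu> * real m))" by simp
    also have "real (m + 1) * exp (- \<mu> * real m) \<le> 2 / \<mu> * exp (\<mu> / 2) * exp (- (\<mu> / 2) * real m)"
      by (rule linear_times_exp_le[OF \<mu>_pos])
    finally show "norm (wavg R n m) \<le> C * real n ^ d * (2 / \<mu> * exp (\<mu> / 2) * exp (- (\<mu> / 2) * real m))"
      using C(1) by (auto simp: mult_left_mono)
  qed
  then show ?thesis unfolding eventually_sequentially by blast
qed

lemma power_exp_root3_tendsto:
  assumes "\<eta> > 0"
  shows "(\<lambda>n. real n ^ d * exp (- \<eta> * root 3 (real n))) \<longlonglongrightarrow> 0"
proof -
  have *: "((\<lambda>x::real. x ^ (3 * d) / exp x) \<longlongrightarrow> 0) at_top"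
    by (rule tendsto_power_div_exp_0)
  have "filterlim (\<lambda>n. \<eta> * root 3 (real n)) at_top sequentially"
    using filterlim_tendsto_pos_mult_at_top[OF tendsto_const assms root3_at_top] .
  from filterlim_compose[OF * this]
  have "(\<lambda>n. (\<eta> * root 3 (real n)) ^ (3 * d) / exp (\<eta> * root 3 (real n)) / \<eta> ^ (3 * d)) \<longlonglongrightarrow> 0 / \<eta> ^ (3 * d)"
    by (rule tendsto_divide[OF _ tendsto_const]) (use assms in auto)
  moreover have "(\<eta> * root 3 (real n)) ^ (3 * d) / exp (\<eta> * root 3 (real n)) / \<eta> ^ (3 * d)
     = real n ^ d * exp (- \<eta> * root 3 (real n))" for n
  proof -
    have "root 3 (real n) ^ (3 * d) = real n ^ d" by (simp add: power_mult root3_cube)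
    then show ?thesis using assms by (simp add: power_mult_distrib exp_minus field_simps)
  qed
  ultimately show ?thesis by simp
qed

text \<open>Extreme indices inside the window have a polynomial factor below \<epsilon>/2. All other
  entries are exponentially small in n^(1/3) relative to the saddle, which beats both the growth n^d
  and the factor n lost in \<open>part_lower_bound\<close>.\<close>

lemma wavg_tendsto_0:
  assumes R: "polyfun3 R" and R0: "R (\<mu> / 2) 0 0 = 0"
  shows "(\<lambda>n. (\<Sum>m. wavg R n m) / part n) \<longlonglongrightarrow> 0"
proof (rule tendstoI)
  fix \<epsilon> :: real assume "\<epsilon> > 0"
  then have e2: "\<epsilon> / 2 > 0" by simp
  obtain \<delta> where \<delta>: "\<delta> > 0" and window: "\<forall>\<^sub>F n in sequentially. \<forall>m k. \<bar>real (m + 2) / root 3 (real n) - x0\<bar> < \<delta> \<longrightarrow>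
    k = 1 \<or> k = m + 1 \<longrightarrow>
    \<bar>at_eigen R n m k\<bar> < \<epsilon> / 2"
    using polyfun3_window[OF R e2] unfolding R0 by auto
  obtain C d where C: "C \<ge> 0" "\<And>n m k. n \<ge> d + 2 \<Longrightarrow> wt n m k *
     \<bar>at_eigen R n m k\<bar>
     \<le> C * real n ^ d * decay (n - 1 - d) m k"
    using wt_polyfun3_bound[OF R] by blast
  obtain \<eta> C' where \<eta>: "\<eta> > 0" "C' \<ge> 0" and outside: "\<And>n m k. n \<ge> d + 1 \<Longrightarrow> 1 \<le> k \<Longrightarrow> k \<le> m + 1 \<Longrightarrow>
    (2 \<le> k \<and> k \<le> m) \<or> \<bar>real (m + 2) / root 3 (real n) - x0\<bar> \<ge> \<delta> \<Longrightarrow>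
    decay (n - 1 - d) m k
      \<le> C' * exp (- root 3 (real n) * (\<phi>0 + \<eta>)) * exp (- \<eta> * real (m + 2))"
    using weight_outside_bound[OF \<delta>, of d] by blast
  obtain c where c: "c > 0" "\<forall>\<^sub>F n in sequentially. c * exp (- root 3 (real n) * \<phi>0) / real n \<le> part n"
    using part_lower_bound by blast
  define g where "g m = 2 / \<eta> * exp (\<eta> / 2) * exp (- (\<eta> / 2) * real m)" for m
  define G where "G = (\<Sum>m. g m)"
  have sumG: "summable g"
    unfolding g_def[abs_def] using \<eta> by (intro summable_mult summable_exp_neg) auto
  define B where "B n = C * real n ^ d * (C' * exp (- root 3 (real n) * (\<phi>0 + \<eta>)))" for n
  have B: "B n \<ge> 0" for n unfolding B_def using C \<eta> by simp
  have small: "(\<lambda>n. C * C' * G / c * (real n ^ (d + 1) * exp (- \<eta> * root 3 (real n)))) \<longlonglongrightarrow> C * C' * G / c * 0"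
    by (intro tendsto_mult tendsto_const power_exp_root3_tendsto \<eta>)
  then have "\<forall>\<^sub>F n in sequentially. C * C' * G / c * (real n ^ (d + 1) * exp (- \<eta> * root 3 (real n))) < \<epsilon> / 2"
    using e2 by (intro order_tendstoD) auto
  with window c(2) summable_wavg[OF R] part_pos eventually_ge_at_top[of "d + 2"]
  show "\<forall>\<^sub>F n in sequentially. dist ((\<Sum>m. wavg R n m) / part n) 0 < \<epsilon>"
  proof eventually_elim
    case (elim n)
    let ?R = "\<lambda>m k. at_eigen R n m k"
    have entry: "wt n m k * \<bar>?R m k\<bar> \<le> \<epsilon> / 2 * wt n m k + B n * exp (- \<eta> * real (m + 2))"
      if k: "1 \<le> k" "k \<le> m + 1" for m k
    proof (cases "(2 \<le> k \<and> k \<le> m) \<or> \<bar>real (m + 2) / root 3 (real n) - x0\<bar> \<ge> \<delta>")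
      case True
      have "wt n m k * \<bar>?R m k\<bar> \<le> C * real n ^ d *
          decay (n - 1 - d) m k"
        using elim by (intro C(2))
      also have "\<dots> \<le> C * real n ^ d * (C' * exp (- root 3 (real n) * (\<phi>0 + \<eta>)) * exp (- \<eta> * real (m + 2)))"
        using elim k True C(1) by (intro mult_left_mono outside) auto
      finally have "wt n m k * \<bar>?R m k\<bar> \<le> B n * exp (- \<eta> * real (m + 2))" by (simp add: B_def mult.assoc)
      moreover have "0 \<le> \<epsilon> / 2 * wt n m k" using e2 wt_nonneg[of n m k] by simp
      ultimately show ?thesis by linarith
    next
      case False
      then have "k = 1 \<or> k = m + 1" using k by linarith
      then have "\<bar>?R m k\<bar> \<le> \<epsilon> / 2" using elim(1) False by (intro less_imp_le) auto
      then have "wt n m k * \<bar>?R m k\<bar> \<le> wt n m k * (\<epsilon> / 2)" by (intro mult_left_mono wt_nonneg)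
      moreover have "0 \<le> B n * exp (- \<eta> * real (m + 2))" using B by simp
      ultimately show ?thesis by (simp add: mult.commute)
    qed
    have row: "\<bar>wavg R n m\<bar> \<le> \<epsilon> / 2 * (\<Sum>k=1..m+1. wt n m k) + B n * g m" for m
    proof -
      have "\<bar>wavg R n m\<bar> \<le> (\<Sum>k=1..m+1. wt n m k * \<bar>?R m k\<bar>)"
        unfolding wavg_def by (rule order.trans[OF sum_abs]) (simp add: abs_mult wt_nonneg del: sum.cl_ivl_Suc)
      also have "\<dots> \<le> (\<Sum>k=1..m+1. \<epsilon> / 2 * wt n m k + B n * exp (- \<eta> * real (m + 2)))"
        by (intro sum_mono entry) auto
      also have "\<dots> = \<epsilon> / 2 * (\<Sum>k=1..m+1. wt n m k) + B n * (real (m + 1) * exp (- \<eta> * real (m + 2)))"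
        unfolding sum.distrib sum_distrib_left[symmetric] by (simp del: sum.cl_ivl_Suc)
      also have "real (m + 1) * exp (- \<eta> * real (m + 2)) \<le> real (m + 1) * exp (- \<eta> * real m)"
        using \<eta> by (intro mult_left_mono) auto
      also have "\<dots> \<le> g m"
        unfolding g_def by (rule linear_times_exp_le[OF \<eta>(1)])
      finally show ?thesis using B[of n] by (simp add: mult_left_mono)
    qed
    have sumr: "summable (\<lambda>m. \<epsilon> / 2 * (\<Sum>k=1..m+1. wt n m k) + B n * g m)"
      by (intro summable_add summable_mult[OF summable_wt] summable_mult[OF sumG])
    have "\<bar>\<Sum>m. wavg R n m\<bar> \<le> (\<Sum>m. \<epsilon> / 2 * (\<Sum>k=1..m+1. wt n m k) + B n * g m)"
      using norm_suminf_le[OF _ sumr, of "wavg R n"] row by simp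
    also have "\<dots> = \<epsilon> / 2 * part n + B n * G"
      unfolding part_def G_def suminf_mult[OF summable_wt, symmetric] suminf_mult[OF sumG, symmetric]
      by (rule suminf_add[symmetric, OF summable_mult[OF summable_wt] summable_mult[OF sumG]])
    finally have le: "\<bar>\<Sum>m. wavg R n m\<bar> \<le> \<epsilon> / 2 * part n + B n * G" .
    have G: "G \<ge> 0" unfolding G_def using \<eta> by (intro suminf_nonneg sumG) (auto simp: g_def)
    have "B n * G / part n \<le> B n * G / (c * exp (- root 3 (real n) * \<phi>0) / real n)"
      using elim B G c(1) by (intro divide_left_mono mult_nonneg_nonneg mult_pos_pos divide_pos_pos) auto
    also have "\<dots> = C * C' * G / c * (real n ^ (d + 1) * exp (- \<eta> * root 3 (real n)))"
      unfolding B_def using elim c(1) by (simp add: field_simps exp_add[symmetric] exp_minus)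
    also have "\<dots> < \<epsilon> / 2" using elim by simp
    finally have "B n * G / part n < \<epsilon> / 2" .
    moreover have "\<bar>\<Sum>m. wavg R n m\<bar> / part n \<le> (\<epsilon> / 2 * part n + B n * G) / part n"
      using le elim by (intro divide_right_mono) auto
    moreover have "(\<epsilon> / 2 * part n + B n * G) / part n = \<epsilon> / 2 + B n * G / part n"
      using elim by (simp add: add_divide_distrib)
    ultimately show ?case using elim by (simp add: dist_real_def abs_divide)
  qed
qed

lemma wavg_tendsto:
  assumes R: "polyfun3 R"
  shows "(\<lambda>n. (\<Sum>m. wavg R n m) / part n) \<longlonglongrightarrow> R (\<mu> / 2) 0 0"
proof -
  let ?c = "R (\<mu> / 2) 0 0"
  define S where "S = (\<lambda>v e t. R v e t - ?c)"
  have S: "polyfun3 S" unfolding S_def by (intro polyfun3_diff R polyfun3.const)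
  have lim: "(\<lambda>n. (\<Sum>m. wavg S n m) / part n + ?c) \<longlonglongrightarrow> 0 + ?c"
    by (intro tendsto_add wavg_tendsto_0 S tendsto_const) (simp add: S_def)
  have eq: "wavg R n m = wavg S n m + ?c * (\<Sum>k=1..m+1. wt n m k)" for n m
    unfolding wavg_def S_def
    by (simp add: right_diff_distrib sum_subtractf sum_distrib_left mult.commute del: sum.cl_ivl_Suc)
  have "\<forall>\<^sub>F n in sequentially. (\<Sum>m. wavg S n m) / part n + ?c = (\<Sum>m. wavg R n m) / part n"
    using summable_wavg[OF S] part_pos
  proof eventually_elim
    case (elim n)
    have "(\<Sum>m. wavg R n m) = (\<Sum>m. wavg S n m) + ?c * part n"
      unfolding eq part_def suminf_mult[OF summable_wt, symmetric]
      by (rule suminf_add[symmetric, OF elim(1) summable_mult[OF summable_wt]])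
    then show ?case using elim by (simp add: add_divide_distrib)
  qed
  with lim show ?thesis by (auto elim: Lim_transform_eventually)
qed

end

section \<open>Limits of quotients of height sums\<close>

text \<open>For K \<ge> 1 this is the generalised Laguerre polynomial of degree K - 1 and parameter
  1, evaluated at -\<mu>.\<close>

definition branch_poly :: "real \<Rightarrow> nat \<Rightarrow> real" where
  "branch_poly \<mu> K = (\<Sum>R=1..K. real (K choose R) * \<mu> ^ (R - 1) / fact (R - 1))"

text \<open>Expands (g x_m)^K = ((1 - Y_m) / 2)^K; the factor g^K shifts the coefficient to n +
  K.\<close>

lemma htgf_power_nth_binomial:
  "fps_nth (htgf m ^ K) n = (1 / 2) ^ K *
     (\<Sum>R\<le>K. real (K choose R) * (- 1) ^ R * fps_nth (cotgf m ^ R) (n + K))"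
proof -
  have "fps_nth (htgf m ^ K) n = fps_nth ((fps_X * htgf m) ^ K) (n + K)"
    by (simp add: power_mult_distrib fps_X_power_mult_nth)
  also have "(fps_X * htgf m) ^ K = fps_const ((1 / 2) ^ K) * (- cotgf m + 1) ^ K"
    unfolding htgf_cotgf power_mult_distrib fps_const_power by simp
  also have "(- cotgf m + 1) ^ K = (\<Sum>R\<le>K. of_nat (K choose R) * (- cotgf m) ^ R * 1 ^ (K - R))"
    by (rule binomial_ring)
  also have "\<dots> = (\<Sum>R\<le>K. fps_const (real (K choose R) * (- 1) ^ R) * cotgf m ^ R)"
  proof (rule sum.cong[OF refl])
    fix R
    have "(- 1 :: real fps) = fps_const (- 1)" by (metis fps_const_neg fps_const_1_eq_1)
    then have "(- cotgf m) ^ R = fps_const ((- 1) ^ R) * cotgf m ^ R"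
      by (subst power_minus) (simp only: fps_const_power)
    then show "of_nat (K choose R) * (- cotgf m) ^ R * 1 ^ (K - R)
        = fps_const (real (K choose R) * (- 1) ^ R) * cotgf m ^ R"
      by (simp only: fps_of_nat[symmetric] fps_const_mult[symmetric] power_one mult_1_right mult.assoc)
  qed
  also have "fps_nth (fps_const ((1 / 2) ^ K) * \<dots>) (n + K) = (1 / 2) ^ K *
     (\<Sum>R\<le>K. real (K choose R) * (- 1) ^ R * fps_nth (cotgf m ^ R) (n + K))"
    by (simp only: fps_mult_left_const_nth fps_sum_nth)
  finally show ?thesis .
qed

context height_coupling
begin

text \<open>The coefficient counts forests of height at most m, not exactly m;
  \<open>weighted_sum_cyl\<close> accounts for the difference.\<close>

definition hsum :: "nat \<Rightarrow> nat \<Rightarrow> real" where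
  "hsum K n = (\<Sum>m. exp (- \<mu> * real m) * fps_nth (htgf m ^ K) n)"

lemma cotgf_power_nth_wavg:
  assumes "n \<ge> R + 1" and "\<And>e t x. specpoly R e t x = f (x * t * e) e t"
  shows "exp (- \<mu> * real m) * fps_nth (cotgf m ^ R) n = - (4 ^ n * wavg f n m)"
proof -
  let ?\<theta> = "\<lambda>k. eigenangle m k"
  have n: "(4::real) ^ n = 4 * 4 ^ (n - 1)" using assms(1) by (simp add: power_eq_if)
  have "exp (- \<mu> * real m) * fps_nth (cotgf m ^ R) n = (\<Sum>k=1..m+1. - (4 * exp (- \<mu> * real m) / real (m + 2)) *
     ((sin (?\<theta> k))\<^sup>2 * (4 * (cos (?\<theta> k))\<^sup>2) ^ (n - 1) * specpoly R (1 / real (m + 2)) ((tan (?\<theta> k))\<^sup>2) (real n)))"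
    unfolding cotgf_power_nth[OF assms(1)] sum_distrib_left[symmetric] by simp
  also have "\<dots> = (\<Sum>k=1..m+1. - (4 ^ n) * (wt n m k * f (real n * (tan (?\<theta> k))\<^sup>2 * (1 / real (m + 2))) (1 / real (m + 2)) ((tan (?\<theta> k))\<^sup>2)))"
    unfolding wt_def n assms(2) by (intro sum.cong refl) (simp only: power_mult_distrib, simp)
  also have "\<dots> = - (4 ^ n * wavg f n m)"
    unfolding wavg_def sum_distrib_left[symmetric] by simp
  finally show ?thesis .
qed

text \<open>Each power Y^R with R \<ge> 1 contributes the limit (-\<mu>)^(R - 1) / (R - 1)! of its
  polynomial factor, and the signs cancel against those of the binomial expansion. The power R = 0
  has no coefficient of positive index and drops out.\<close>

lemma hsum_asymptotics:
  "(\<lambda>n. hsum K n / (4 ^ (n + K) * part (n + K))) \<longlonglongrightarrow>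
     (1 / 2) ^ K * branch_poly \<mu> K"
proof -
  obtain f where f: "\<And>R. polyfun3 (f R)" "\<And>R e t x. specpoly R e t x = f R (x * t * e) e t"
     "\<And>R v. f R v 0 0 = (if R = 0 then 0 else (- 2 * v) ^ (R - 1) / fact (R - 1))"
    using specpoly_polyfun3 by metis
  define A where "A R n = (\<Sum>m. wavg (f R) n m)" for R n
  have lim: "(\<lambda>n. A R (n + K) / part (n + K)) \<longlonglongrightarrow> f R (\<mu> / 2) 0 0" for R
    unfolding A_def using LIMSEQ_ignore_initial_segment[OF wavg_tendsto[OF f(1)]] .
  have "\<forall>\<^sub>F n in sequentially. \<forall>R\<in>{..K}. summable (wavg (f R) n)"
    by (intro eventually_ball_finite ballI summable_wavg f) auto
  then have ev: "\<forall>\<^sub>F n in sequentially. \<forall>R\<in>{..K}. summable (wavg (f R) (n + K))"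
    by (rule eventually_sequentially_seg[THEN iffD2])
  have pos: "\<forall>\<^sub>F n in sequentially. part (n + K) > 0"
    using part_pos by (rule eventually_sequentially_seg[THEN iffD2])
  have eq: "\<forall>\<^sub>F n in sequentially. (1 / 2) ^ K * (\<Sum>R\<le>K. real (K choose R) * (- 1) ^ R * - (A R (n + K) / part (n + K)))
      = hsum K n / (4 ^ (n + K) * part (n + K))"
    using ev pos eventually_ge_at_top[of 1]
  proof eventually_elim
    case (elim n)
    let ?c = "\<lambda>R. (1 / 2) ^ K * (real (K choose R) * (- 1) ^ R * - (4 ^ (n + K)))"
    have "exp (- \<mu> * real m) * fps_nth (htgf m ^ K) n = (\<Sum>R\<le>K. ?c R * wavg (f R) (n + K) m)" for m
    proof -
      have "exp (- \<mu> * real m) * fps_nth (htgf m ^ K) n = (\<Sum>R\<le>K. (1 / 2) ^ K * (real (K choose R) * (- 1) ^ R *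
         (exp (- \<mu> * real m) * fps_nth (cotgf m ^ R) (n + K))))"
        unfolding htgf_power_nth_binomial sum_distrib_left by (intro sum.cong refl) (simp only: mult_ac)
      also have "\<dots> = (\<Sum>R\<le>K. ?c R * wavg (f R) (n + K) m)"
        using elim(3) by (intro sum.cong refl, subst cotgf_power_nth_wavg[OF _ f(2)]) auto
      finally show ?thesis .
    qed
    then have "hsum K n = (\<Sum>m. \<Sum>R\<le>K. ?c R * wavg (f R) (n + K) m)" by (simp add: hsum_def)
    also have "\<dots> = (\<Sum>R\<le>K. \<Sum>m. ?c R * wavg (f R) (n + K) m)"
      using elim(1) by (intro suminf_sum summable_mult) auto
    also have "\<dots> = (\<Sum>R\<le>K. ?c R * A R (n + K))"
      using elim(1) unfolding A_def by (intro sum.cong refl suminf_mult) auto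
    finally have "hsum K n / (4 ^ (n + K) * part (n + K))
      = (\<Sum>R\<le>K. ?c R * A R (n + K) / (4 ^ (n + K) * part (n + K)))"
      by (simp only: sum_divide_distrib)
    also have "\<dots> = (\<Sum>R\<le>K. (1 / 2) ^ K * (real (K choose R) * (- 1) ^ R * - (A R (n + K) / part (n + K))))"
    proof (intro sum.cong refl)
      fix R
      have "h * (b * s * - q) * a / (q * p) = h * (b * s * - (a / p))" if "q \<noteq> 0" for h b s q a p :: real
        using that by simp
      then show "?c R * A R (n + K) / (4 ^ (n + K) * part (n + K))
        = (1 / 2) ^ K * (real (K choose R) * (- 1) ^ R * - (A R (n + K) / part (n + K)))" by simp
    qed
    finally show ?case by (simp only: sum_distrib_left)
  qed
  have lim2: "(\<lambda>n. (1 / 2) ^ K * (\<Sum>R\<le>K. real (K choose R) * (- 1) ^ R * - (A R (n + K) / part (n + K))))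
    \<longlonglongrightarrow> (1 / 2) ^ K * (\<Sum>R\<le>K. real (K choose R) * (- 1) ^ R * - f R (\<mu> / 2) 0 0)"
    by (intro tendsto_intros lim)
  have "(\<Sum>R\<le>K. real (K choose R) * (- 1) ^ R * - f R (\<mu> / 2) 0 0)
     = (\<Sum>R=1..K. real (K choose R) * \<mu> ^ (R - 1) / fact (R - 1))"
  proof (rule sum.mono_neutral_cong_right)
    fix R assume "R \<in> {1..K}"
    then obtain j where R: "R = Suc j" by (cases R) auto
    have "(- \<mu>) ^ j = (- 1) ^ j * \<mu> ^ j" by (rule power_minus)
    moreover have "(- 1 :: real) ^ j * (- 1) ^ j = 1" by (simp add: power_add[symmetric])
    ultimately show "real (K choose R) * (- 1) ^ R * - f R (\<mu> / 2) 0 0 = real (K choose R) * \<mu> ^ (R - 1) / fact (R - 1)"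
      unfolding f(3) R by (simp add: mult.assoc[symmetric])
  qed (auto simp: f(3) not_le)
  then have val: "(\<Sum>R\<le>K. real (K choose R) * (- 1) ^ R * - f R (\<mu> / 2) 0 0) = branch_poly \<mu> K"
    by (simp only: branch_poly_def)
  show ?thesis using lim2 unfolding val tendsto_cong[OF eq] .
qed

text \<open>Since cos^2 (1 + tan^2) = 1, \<open>part n\<close> is the sum of 1 + t against the
  weights for n + 1, and t tends to 0 at the saddle.\<close>

lemma part_ratio_Suc: "(\<lambda>n. part n / part (Suc n)) \<longlonglongrightarrow> 1"
proof -
  let ?R = "\<lambda>v e t :: real. 1 + t"
  have R: "polyfun3 ?R" by (intro polyfun3.add polyfun3.const polyfun3.trd)
  have lim: "(\<lambda>n. (\<Sum>m. wavg ?R (Suc n) m) / part (Suc n)) \<longlonglongrightarrow> 1"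
    using LIMSEQ_Suc[OF wavg_tendsto[OF R]] by simp
  have ev: "\<forall>\<^sub>F n in sequentially. (\<Sum>m. wavg ?R (Suc n) m) / part (Suc n) = part n / part (Suc n)"
    using eventually_ge_at_top[of 2]
  proof eventually_elim
    case (elim n)
    have "wt (Suc n) m k * (1 + (tan (eigenangle m k))\<^sup>2) = wt n m k" for m k
    proof -
      let ?\<theta> = "eigenangle m k"
      have "((cos ?\<theta>)\<^sup>2) ^ n * (1 + (tan ?\<theta>)\<^sup>2) = ((cos ?\<theta>)\<^sup>2) ^ (n - 1)"
      proof (cases "cos ?\<theta> = 0")
        case True
        then show ?thesis unfolding True using elim by (simp add: power_0_left)
      next
        case False
        have "n = Suc (n - 1)" using elim by simp
        then have "((cos ?\<theta>)\<^sup>2) ^ n = ((cos ?\<theta>)\<^sup>2) ^ (n - 1) * (cos ?\<theta>)\<^sup>2" by (metis power_Suc2)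
        moreover have "(cos ?\<theta>)\<^sup>2 * (1 + (tan ?\<theta>)\<^sup>2) = 1"
          using False by (simp only: tan_def) (simp add: field_simps del: of_nat_add)
        ultimately show ?thesis by (simp only: mult.assoc mult_1_right)
      qed
      then show ?thesis unfolding wt_def by (simp only: diff_Suc_1 mult.assoc)
    qed
    then have "wavg ?R (Suc n) m = (\<Sum>k=1..m+1. wt n m k)" for m
      unfolding wavg_def by simp
    then show ?case by (simp only: part_def)
  qed
  show ?thesis using lim unfolding tendsto_cong[OF ev] .
qed

lemma part_ratio: "(\<lambda>n. part n / part (n + j)) \<longlonglongrightarrow> 1"
proof (induction j)
  case 0
  have "\<forall>\<^sub>F n in sequentially. 1 = part n / part (n + 0)"
    using part_pos by eventually_elim simp
  then show ?case by (intro Lim_transform_eventually[OF tendsto_const])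
next
  case (Suc j)
  have lim: "(\<lambda>n. part n / part (n + j) * (part (n + j) / part (Suc (n + j)))) \<longlonglongrightarrow> 1 * 1"
    by (intro tendsto_mult Suc LIMSEQ_ignore_initial_segment[OF part_ratio_Suc])
  have "\<forall>\<^sub>F n in sequentially. part (n + j) > 0"
    using part_pos by (rule eventually_sequentially_seg[THEN iffD2])
  then have ev: "\<forall>\<^sub>F n in sequentially. part n / part (n + j) * (part (n + j) / part (Suc (n + j))) = part n / part (n + Suc j)"
    by eventually_elim simp
  show ?case using lim unfolding tendsto_cong[OF ev] by simp
qed

text \<open>With n = N - e, the numerator is compared with \<open>part\<close> at n + K and the
  denominator at n + e. By \<open>part_ratio\<close> the distance e - K costs nothing in the limit,
  while the powers of 4 leave (1/4)^(e - K). One factor 2 is the reciprocal of the limit for K =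
  1.\<close>

theorem hsum_ratio:
  assumes "K \<ge> 1" "e \<ge> K"
  shows "(\<lambda>N. hsum K (N - e) / hsum 1 (N - 1)) \<longlonglongrightarrow>
    (1 / 4) ^ e * 2 ^ (K + 1) * branch_poly \<mu> K"
proof (rule LIMSEQ_offset[where k = e])
  define j where "j = e - K"
  have e: "e = K + j" using assms by (simp add: j_def)
  let ?S = "branch_poly \<mu> K"
  let ?a = "\<lambda>n. hsum K n / (4 ^ (n + K) * part (n + K))"
  let ?b = "\<lambda>n. hsum 1 n / (4 ^ (n + 1) * part (n + 1))"
  have b: "?b \<longlonglongrightarrow> 1 / 2" using hsum_asymptotics[of 1] by (simp add: branch_poly_def)
  have lim: "(\<lambda>n. ?a n * (part (n + K) / part (n + K + j)) / ?b (n + (e - 1)) * (1 / 4) ^ j) \<longlonglongrightarrow> ((1 / 2) ^ K * ?S) * 1 / (1 / 2) * (1 / 4) ^ j"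
    by (intro tendsto_mult tendsto_divide hsum_asymptotics LIMSEQ_ignore_initial_segment[OF b]
        LIMSEQ_ignore_initial_segment[OF part_ratio] tendsto_const) auto
  have val: "((1 / 2) ^ K * ?S) * 1 / (1 / 2) * (1 / 4) ^ j = (1 / 4) ^ e * 2 ^ (K + 1) * ?S"
  proof -
    have "(1 / 4 :: real) ^ K * 2 ^ K = (1 / 2) ^ K" by (simp add: power_mult_distrib[symmetric])
    then show ?thesis unfolding e by (simp add: power_add mult_ac)
  qed
  have "\<forall>\<^sub>F n in sequentially. part (n + K) > 0" "\<forall>\<^sub>F n in sequentially. part (n + e) > 0"
    by (rule eventually_sequentially_seg[THEN iffD2], rule part_pos)+
  then have ev: "\<forall>\<^sub>F n in sequentially. ?a n * (part (n + K) / part (n + K + j)) / ?b (n + (e - 1)) * (1 / 4) ^ j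
     = hsum K (n + e - e) / hsum 1 (n + e - 1)"
  proof eventually_elim
    case (elim n)
    have i: "n + (e - 1) + 1 = n + e" "n + K + j = n + e" "n + e - 1 = n + (e - 1)" "n + e - e = n"
      using assms e by auto
    have p: "(4::real) ^ (n + e) = 4 ^ (n + K) * 4 ^ j" by (simp add: e power_add)
    have "h / (q * p) * (p / p') / (h' / (q * r * p')) * (1 / r) = h / h'"
      if "p > 0" "p' > 0" "q > 0" "r > 0" for h h' p p' q r :: real
      using that by (simp add: field_simps)
    from this[of "part (n + K)" "part (n + e)" "4 ^ (n + K)" "4 ^ j"] elim
    show ?case unfolding i p by (simp add: power_divide)
  qed
  show "(\<lambda>n. hsum K (n + e - e) / hsum 1 (n + e - 1)) \<longlonglongrightarrow> (1 / 4) ^ e * 2 ^ (K + 1) * ?S"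
    using lim unfolding val tendsto_cong[OF ev] .
qed

end

section \<open>Counting trees level by level\<close>

lemma Trees_D:
  assumes "T \<in> Trees"
  shows "[] \<in> T" "\<And>v i. v @ [i] \<in> T \<Longrightarrow> v \<in> T" "\<And>v i j. v @ [i] \<in> T \<Longrightarrow> j < i \<Longrightarrow> v @ [j] \<in> T"
    "\<And>v. v \<in> T \<Longrightarrow> finite {i. v @ [i] \<in> T}" "\<And>i. [i] \<in> T \<longleftrightarrow> i = 0"
  using assms by (auto simp: Trees_def is_tree_def)

lemma ball_tree_ball_tree: "ball_tree r (ball_tree s T) = ball_tree (min r s) T"
  by (auto simp: ball_tree_def)

lemma mem_ball_tree: "v \<in> ball_tree r T \<longleftrightarrow> v \<in> T \<and> length v \<le> r"
  by (auto simp: ball_tree_def)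

lemma mem_level: "v \<in> level r T \<longleftrightarrow> v \<in> T \<and> length v = r"
  by (auto simp: level_def)

lemma ball_tree_mono_eq:
  assumes "ball_tree s T = ball_tree s T'" "r \<le> s"
  shows "ball_tree r T = ball_tree r T'"
  using assms ball_tree_ball_tree[of r s T] ball_tree_ball_tree[of r s T'] by (simp add: min_absorb1)

lemma level_ball_tree: "s \<le> r \<Longrightarrow> level s (ball_tree r T) = level s T"
  by (auto simp: ball_tree_def level_def)

lemma ball_tree_Suc: "ball_tree (Suc r) T = ball_tree r T \<union> level (Suc r) T"
  by (auto simp: ball_tree_def level_def)

lemma level_Suc:
  assumes "T \<in> Trees"
  shows "level (Suc r) T = (\<Union>v\<in>level r T. (\<lambda>i. v @ [i]) ` {i. v @ [i] \<in> T})"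
proof (intro set_eqI iffI)
  fix w assume w: "w \<in> level (Suc r) T"
  then obtain v i where "w = v @ [i]" by (cases w rule: rev_cases) (auto simp: mem_level)
  then show "w \<in> (\<Union>v\<in>level r T. (\<lambda>i. v @ [i]) ` {i. v @ [i] \<in> T})"
    using w Trees_D(2)[OF assms] by (auto simp: mem_level)
qed (auto simp: mem_level)

lemma finite_level:
  assumes "T \<in> Trees"
  shows "finite (level r T)"
proof (induction r)
  case 0
  have "level 0 T \<subseteq> {[]}" by (auto simp: mem_level)
  then show ?case by (rule finite_subset) auto
next
  case (Suc r)
  then show ?case
    unfolding level_Suc[OF assms] by (intro finite_UN_I finite_imageI Trees_D(4)[OF assms]) (auto simp: mem_level)
qed

lemma finite_ball_tree:
  assumes "T \<in> Trees"
  shows "finite (ball_tree r T)"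
proof (induction r)
  case 0
  have "ball_tree 0 T \<subseteq> {[]}" by (auto simp: mem_ball_tree)
  then show ?case by (rule finite_subset) auto
qed (simp add: ball_tree_Suc finite_level[OF assms])

lemma ball_tree_in_Trees:
  assumes "T \<in> Trees" "r \<ge> 1"
  shows "ball_tree r T \<in> Trees"
  unfolding Trees_def is_tree_def mem_Collect_eq
proof (intro conjI allI impI ballI)
  show "[] \<in> ball_tree r T" using Trees_D(1)[OF assms(1)] by (simp add: mem_ball_tree)
  show "v \<in> ball_tree r T" if "v @ [i] \<in> ball_tree r T" for v i
    using that Trees_D(2)[OF assms(1), of v i] by (simp add: mem_ball_tree)
  show "v @ [j] \<in> ball_tree r T" if "v @ [i] \<in> ball_tree r T \<and> j < i" for v i j
    using that Trees_D(3)[OF assms(1)] by (auto simp: mem_ball_tree)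
  show "finite {i. v @ [i] \<in> ball_tree r T}" if "v \<in> ball_tree r T" for v
    by (rule finite_subset[OF _ Trees_D(4)[OF assms(1), of v]]) (use that in \<open>auto simp: mem_ball_tree\<close>)
  show "{i. [i] \<in> ball_tree r T} = {0}"
    using assms(2) Trees_D(5)[OF assms(1)] by (auto simp: mem_ball_tree)
qed

lemma ball_tree_in_Trees_fin: "T \<in> Trees \<Longrightarrow> r \<ge> 1 \<Longrightarrow> ball_tree r T \<in> Trees_fin"
  by (simp add: Trees_fin_def ball_tree_in_Trees finite_ball_tree)

lemma Trees_fin_D: "T \<in> Trees_fin \<Longrightarrow> T \<in> Trees" "T \<in> Trees_fin \<Longrightarrow> finite T" "T \<in> Trees_fin \<Longrightarrow> T \<noteq> {}"
  using Trees_D(1) by (auto simp: Trees_fin_def)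

lemma height_le_iff:
  assumes "T \<in> Trees_fin"
  shows "height T \<le> h \<longleftrightarrow> (\<forall>v\<in>T. length v \<le> h)"
  unfolding height_def using Trees_fin_D[OF assms] by (subst Max_le_iff) auto

lemma level_height_nonempty:
  assumes "T \<in> Trees_fin"
  shows "level (height T) T \<noteq> {}"
proof -
  have "height T \<in> length ` T"
    unfolding height_def using Trees_fin_D[OF assms] by (intro Max_in) auto
  then show ?thesis by (auto simp: level_def)
qed

lemma ball_tree_height_id:
  assumes "T \<in> Trees_fin" "height T \<le> r"
  shows "ball_tree r T = T"
  using assms height_le_iff by (auto simp: ball_tree_def)

lemma height_ball_tree:
  assumes "T \<in> Trees" "r \<ge> 1" "level r T \<noteq> {}"
  shows "height (ball_tree r T) = r"
proof (rule antisym)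
  have fin: "ball_tree r T \<in> Trees_fin" using assms by (intro ball_tree_in_Trees_fin)
  then show "height (ball_tree r T) \<le> r" by (simp add: height_le_iff mem_ball_tree)
  obtain v where "v \<in> level r T" using assms(3) by blast
  then have "v \<in> ball_tree r T" "length v = r"
    by (auto simp: mem_level mem_ball_tree)
  then show "r \<le> height (ball_tree r T)"
    using height_le_iff[OF fin, of "height (ball_tree r T)"] by auto
qed

lemma height_ge_ball:
  assumes "T \<in> Trees_fin" "ball_tree (height T0) T = T0" "T0 \<in> Trees_fin"
  shows "height T0 \<le> height T"
proof -
  obtain v where "v \<in> level (height T0) T0"
    using level_height_nonempty[OF assms(3)] by blast
  then have "v \<in> T0" "length v = height T0" by (auto simp: mem_level)
  then have "v \<in> T" using assms(2) by (auto simp: mem_ball_tree)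
  then show ?thesis using \<open>length v = height T0\<close> height_le_iff[OF assms(1), of "height T"] by auto
qed

text \<open>Every tree has this ball of radius 1, so its cylinder is the whole space, and the
  partition function becomes a special case of a cylinder weight.\<close>

definition edge_tree :: "nat list set" where "edge_tree = {[], [0]}"

lemma edge_tree_Trees_fin: "edge_tree \<in> Trees_fin"
proof -
  have "finite {i. v @ [i] \<in> edge_tree}" for v
    by (rule finite_subset[of _ "{0}"]) (auto simp: edge_tree_def)
  then show ?thesis by (auto simp: edge_tree_def Trees_fin_def Trees_def is_tree_def)
qed

lemma height_edge_tree: "height edge_tree = 1"
  by (simp add: height_def edge_tree_def)

lemma level_edge_tree: "level 1 edge_tree = {[0]}"
  by (auto simp: level_def edge_tree_def)

lemma edges_edge_tree: "edges edge_tree = 1"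
  by (simp add: edges_def edge_tree_def)

lemma ball_tree_1:
  assumes "T \<in> Trees"
  shows "ball_tree 1 T = edge_tree"
proof -
  have "w = [] \<or> w = [0]" if "w \<in> T" "length w \<le> 1" for w
    using that Trees_D(5)[OF assms] by (cases w) auto
  then show ?thesis
    using Trees_D(1)[OF assms] Trees_D(5)[OF assms, of 0] by (auto simp: ball_tree_def edge_tree_def)
qed

lemma cyl_edge_tree: "cyl edge_tree = Trees"
  using ball_tree_1 by (auto simp: cyl_def height_edge_tree)

lemma height_ge_1: "T \<in> Trees_fin \<Longrightarrow> height T \<ge> 1"
  using height_ge_ball[of T edge_tree] ball_tree_1[of T] edge_tree_Trees_fin height_edge_tree
  by (simp add: Trees_fin_D)

section \<open>Extending a tree by one level\<close>

definition grow :: "nat \<Rightarrow> nat list set \<Rightarrow> (nat list \<Rightarrow> nat) \<Rightarrow> nat list set" where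
  "grow r T c = T \<union> (\<Union>v\<in>level r T. (\<lambda>i. v @ [i]) ` {..<c v})"

text \<open>The height is only bounded, not prescribed, so that j = 0 covers a tree that stops
  growing.\<close>

definition extensions :: "nat \<Rightarrow> nat list set \<Rightarrow> nat \<Rightarrow> nat list set set" where
  "extensions r T j = {T' \<in> Trees_fin. ball_tree r T' = T \<and> (\<forall>v\<in>T'. length v \<le> Suc r)
     \<and> card (level (Suc r) T') = j}"

lemma mem_grow:
  assumes "\<forall>v\<in>T. length v \<le> r"
  shows "v @ [i] \<in> grow r T c \<longleftrightarrow> v @ [i] \<in> T \<or> v \<in> level r T \<and> i < c v"
  by (auto simp: grow_def)

lemma grow_Trees_fin:
  assumes T: "T \<in> Trees_fin" "\<forall>v\<in>T. length v \<le> r" and r: "r \<ge> 1"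
  shows "grow r T c \<in> Trees_fin"
proof -
  note D = Trees_D[OF Trees_fin_D(1)[OF T(1)]]
  have fin: "finite (grow r T c)"
    unfolding grow_def using Trees_fin_D[OF T(1)] finite_level[OF Trees_fin_D(1)[OF T(1)]] by auto
  have sub: "T \<subseteq> grow r T c" by (auto simp: grow_def)
  have "is_tree (grow r T c)"
    unfolding is_tree_def
  proof (intro conjI allI impI ballI)
    show "[] \<in> grow r T c" using D(1) sub by blast
    show "v \<in> grow r T c" if "v @ [i] \<in> grow r T c" for v i
      using that D(2)[of v i] sub unfolding mem_grow[OF T(2)] mem_level by blast
    show "v @ [j] \<in> grow r T c" if "v @ [i] \<in> grow r T c \<and> j < i" for v i j
      using that D(3)[of v i j] less_trans[of j i "c v"] unfolding mem_grow[OF T(2)] by blast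
    show "finite {i. v @ [i] \<in> grow r T c}" for v
      by (rule finite_imageD[of "\<lambda>i. v @ [i]"]) (auto intro: finite_subset[OF _ fin] inj_onI)
    show "{i. [i] \<in> grow r T c} = {0}"
      using D(5) r mem_grow[OF T(2), of "[]" _ c] by (auto simp: mem_level)
  qed
  then show ?thesis using fin by (simp add: Trees_fin_def Trees_def)
qed

lemma ball_tree_grow:
  assumes "\<forall>v\<in>T. length v \<le> r"
  shows "ball_tree r (grow r T c) = T"
  using assms by (auto simp: ball_tree_def grow_def mem_level)

lemma level_Suc_grow:
  assumes "\<forall>v\<in>T. length v \<le> r"
  shows "level (Suc r) (grow r T c) = (\<Union>v\<in>level r T. (\<lambda>i. v @ [i]) ` {..<c v})"
  using assms by (auto simp: grow_def level_def)

lemma card_level_Suc_grow: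
  assumes "T \<in> Trees" "\<forall>v\<in>T. length v \<le> r"
  shows "card (level (Suc r) (grow r T c)) = (\<Sum>v\<in>level r T. c v)"
proof -
  have "card (\<Union>v\<in>level r T. (\<lambda>i. v @ [i]) ` {..<c v}) = (\<Sum>v\<in>level r T. card ((\<lambda>i. v @ [i]) ` {..<c v}))"
    by (rule card_UN_disjoint) (auto simp: finite_level[OF assms(1)])
  also have "\<dots> = (\<Sum>v\<in>level r T. c v)"
    by (intro sum.cong refl) (subst card_image, auto intro: inj_onI)
  finally show ?thesis unfolding level_Suc_grow[OF assms(2)] .
qed

lemma lower_set_nat:
  fixes A :: "nat set"
  assumes "finite A" "\<And>i j. i \<in> A \<Longrightarrow> j < i \<Longrightarrow> j \<in> A"
  shows "A = {..<card A}"
proof (cases "A = {}")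
  case False
  have "A = {..Max A}"
  proof (intro set_eqI iffI)
    fix j assume "j \<in> {..Max A}"
    then show "j \<in> A"
      using assms(2)[OF Max_in[OF assms(1) False], of j] Max_in[OF assms(1) False]
      by (cases "j = Max A") auto
  qed (use assms(1) in auto)
  then have "A = {..<Suc (Max A)}" by (simp add: lessThan_Suc_atMost)
  then show ?thesis by (metis card_lessThan)
qed simp

text \<open>The sets of child indices are initial segments of the naturals, so their sizes determine
  them. The restriction makes the function extensional, so that it is counted once.\<close>

lemma extension_eq_grow:
  assumes T': "T' \<in> Trees" "\<forall>v\<in>T'. length v \<le> Suc r"
  shows "T' = grow r (ball_tree r T') (\<lambda>v\<in>level r (ball_tree r T'). card {i. v @ [i] \<in> T'})"
proof -
  have "{i. v @ [i] \<in> T'} = {..<card {i. v @ [i] \<in> T'}}" if "v \<in> T'" for v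
    using Trees_D(3,4)[OF T'(1)] that by (intro lower_set_nat) auto
  then have "(\<Union>v\<in>level r T'. (\<lambda>i. v @ [i]) ` {i. v @ [i] \<in> T'})
      = (\<Union>v\<in>level r T'. (\<lambda>i. v @ [i]) ` {..<card {i. v @ [i] \<in> T'}})"
    by (intro SUP_cong refl) (metis mem_level)
  moreover have "T' = ball_tree r T' \<union> level (Suc r) T'"
    using T'(2) by (auto simp: ball_tree_def level_def)
  ultimately show ?thesis
    unfolding grow_def level_ball_tree[OF le_refl] level_Suc[OF T'(1)] by simp
qed

abbreviation compositions :: "'a set \<Rightarrow> nat \<Rightarrow> ('a \<Rightarrow> nat) set" where
  "compositions A j \<equiv> {c \<in> A \<rightarrow>\<^sub>E UNIV. (\<Sum>v\<in>A. c v) = j}"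

lemma bij_betw_grow:
  assumes T: "T \<in> Trees_fin" "\<forall>v\<in>T. length v \<le> r" and r: "r \<ge> 1"
  shows "bij_betw (grow r T) (compositions (level r T) j) (extensions r T j)"
proof (rule bij_betwI')
  note D = Trees_fin_D[OF T(1)]
  have grow_c: "{i. v @ [i] \<in> grow r T c} = {..<c v}" if "v \<in> level r T" for v c
    using that T(2) by (auto simp: mem_grow mem_level)
  show "grow r T c = grow r T c' \<longleftrightarrow> c = c'"
    if "c \<in> compositions (level r T) j"
       "c' \<in> compositions (level r T) j" for c c'
  proof
    assume "grow r T c = grow r T c'"
    then have "c v = c' v" if "v \<in> level r T" for v
      using grow_c[OF that, of c] grow_c[OF that, of c'] by simp
    then show "c = c'" using that by (intro PiE_ext[of c "level r T" "\<lambda>_. UNIV"]) auto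
  qed simp
  show "grow r T c \<in> extensions r T j"
    if "c \<in> compositions (level r T) j" for c
    using that T grow_Trees_fin[OF T r] ball_tree_grow[OF T(2)] card_level_Suc_grow[OF D(1) T(2)]
    by (auto simp: extensions_def grow_def mem_level)
  show "\<exists>c\<in>compositions (level r T) j. T' = grow r T c"
    if "T' \<in> extensions r T j" for T'
  proof -
    have T': "T' \<in> Trees" "\<forall>v\<in>T'. length v \<le> Suc r" "ball_tree r T' = T" "card (level (Suc r) T') = j"
      using that by (auto simp: extensions_def Trees_fin_D)
    let ?c = "\<lambda>v\<in>level r T. card {i. v @ [i] \<in> T'}"
    have eq: "T' = grow r T ?c"
      using extension_eq_grow[OF T'(1,2)] unfolding T'(3) .
    have "(\<Sum>v\<in>level r T. ?c v) = j"
      using card_level_Suc_grow[OF D(1) T(2), of ?c] T'(4) unfolding eq[symmetric] by simp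
    then show ?thesis using eq by (intro bexI[of _ ?c]) auto
  qed
qed

text \<open>Stars and bars, through an enumeration of A. The truncated subtraction is also right for
  empty A: it gives 1 for j = 0 and 0 otherwise.\<close>

lemma card_fun_sum:
  assumes "finite A"
  shows "card (compositions A j) = (card A + j - 1) choose j"
    and "finite (compositions A j)"
proof -
  obtain xs where xs: "set xs = A" "distinct xs" using finite_distinct_list[OF assms] by blast
  have len: "length xs = card A" using xs distinct_card by fastforce
  have bij: "bij_betw (\<lambda>c. map c xs) (compositions A j)
     {l. length l = card A \<and> sum_list l = j}"
  proof (rule bij_betwI')
    show "map c xs = map c' xs \<longleftrightarrow> c = c'"
      if "c \<in> compositions A j" "c' \<in> compositions A j" for c c'
    proof
      assume "map c xs = map c' xs"
      then have "\<forall>x\<in>A. c x = c' x" using xs by auto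
      then show "c = c'" using that by (intro PiE_ext[of c A "\<lambda>_. UNIV"]) auto
    qed simp
    show "map c xs \<in> {l. length l = card A \<and> sum_list l = j}"
      if "c \<in> compositions A j" for c
      using that xs len by (auto simp: sum_list_distinct_conv_sum_set)
    show "\<exists>c\<in>compositions A j. l = map c xs"
      if "l \<in> {l. length l = card A \<and> sum_list l = j}" for l
    proof -
      let ?c = "restrict (\<lambda>x. the (map_of (zip xs l) x)) A"
      have l: "length l = length xs" "sum_list l = j" using that len by auto
      have "map ?c xs = l"
        using l xs by (intro nth_equalityI) (auto simp: map_of_zip_nth)
      moreover from this have "(\<Sum>v\<in>A. ?c v) = j"
        using sum_list_distinct_conv_sum_set[OF xs(2), of ?c] l(2) xs(1) by simp
      ultimately show ?thesis by (intro bexI[of _ ?c]) auto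
    qed
  qed
  have "finite {l. length l = card A \<and> sum_list l = j}"
    by (rule finite_subset[OF _ finite_lists_length_eq[of "{..j}" "card A"]])
      (auto intro: member_le_sum_list)
  then show "finite (compositions A j)"
    using bij_betw_finite[OF bij] by simp
  show "card (compositions A j) = (card A + j - 1) choose j"
    unfolding bij_betw_same_card[OF bij] card_length_sum_list by (simp add: add.commute)
qed

lemma card_extensions:
  assumes T: "T \<in> Trees_fin" "\<forall>v\<in>T. length v \<le> r" and r: "r \<ge> 1"
  shows "card (extensions r T j) = (card (level r T) + j - 1) choose j" "finite (extensions r T j)"
  using card_fun_sum[OF finite_level[OF Trees_fin_D(1)[OF T(1)]], of r j]
    bij_betw_same_card[OF bij_betw_grow[OF assms, of j]] bij_betw_finite[OF bij_betw_grow[OF assms, of j]]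
  by auto

text \<open>The negative binomial series of (1 - g x_m)^(-K): its coefficients count how K vertices
  can share j children, whose subtrees account for \<open>htgf m ^ j\<close>.\<close>

lemma htgf_Suc_power_nth:
  "fps_nth (htgf (Suc m) ^ K) n = (\<Sum>j\<le>n. real ((K + j - 1) choose j) * fps_nth (htgf m ^ j) (n - j))"
proof -
  let ?h = "fps_X * htgf m"
  have h0: "fps_nth ?h 0 = 0" by simp
  have "htgf (Suc m) = inverse (1 - fps_X) oo ?h"
    by (subst fps_inverse_compose[OF h0]) (simp_all add: fps_compose_sub_distrib)
  then have "htgf (Suc m) ^ K = inverse ((1 - fps_X) ^ K) oo ?h"
    by (simp only: fps_compose_power[OF h0] fps_inverse_power)
  also have "inverse ((1 - fps_X :: real fps) ^ K) = Abs_fps (\<lambda>k. real ((K + k - 1) choose k))"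
  proof (cases "K = 0")
    case True
    have "(k - 1) choose k = (if k = 0 then 1 else 0)" for k :: nat
      by (cases k) auto
    then show ?thesis unfolding True by (intro fps_ext) simp
  next
    case False
    then show ?thesis using one_minus_const_fps_X_neg_power'[of K "1::real"] by simp
  qed
  also have "fps_nth (\<dots> oo ?h) n = (\<Sum>j=0..n. real ((K + j - 1) choose j) * fps_nth (?h ^ j) n)"
    by (simp add: fps_compose_nth)
  also have "\<dots> = (\<Sum>j\<le>n. real ((K + j - 1) choose j) * fps_nth (htgf m ^ j) (n - j))"
    by (intro sum.cong) (auto simp: power_mult_distrib fps_X_power_mult_nth)
  finally show ?thesis .
qed

definition descendants :: "nat \<Rightarrow> nat list set \<Rightarrow> nat \<Rightarrow> nat \<Rightarrow> nat list set set" where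
  "descendants r T m n = {T' \<in> Trees_fin. ball_tree r T' = T \<and> (\<forall>v\<in>T'. length v \<le> r + m)
     \<and> card T' = card T + n}"

lemma card_extension:
  assumes "T1 \<in> extensions r T j"
  shows "card T1 = card T + j"
proof -
  have T1: "T1 \<in> Trees_fin" "ball_tree r T1 = T" "\<forall>v\<in>T1. length v \<le> Suc r" "card (level (Suc r) T1) = j"
    using assms by (auto simp: extensions_def)
  have "T1 = T \<union> level (Suc r) T1" "T \<inter> level (Suc r) T1 = {}"
    using T1(2,3) by (auto simp: ball_tree_def level_def)
  moreover have "finite T" using T1 finite_ball_tree[OF Trees_fin_D(1)[OF T1(1)]] by auto
  ultimately show ?thesis
    using T1(4) finite_level[OF Trees_fin_D(1)[OF T1(1)], of "Suc r"] by (metis card_Un_disjoint)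
qed

lemma descendants_Suc:
  assumes "r \<ge> 1"
  shows "descendants r T (Suc m) n = (\<Union>j\<in>{..n}. \<Union>T1\<in>extensions r T j. descendants (Suc r) T1 m (n - j))"
proof (intro set_eqI iffI)
  fix T' assume T': "T' \<in> descendants r T (Suc m) n"
  then have tr: "T' \<in> Trees_fin" by (simp add: descendants_def)
  define T1 where "T1 = ball_tree (Suc r) T'"
  define j where "j = card (level (Suc r) T')"
  have T1: "T1 \<in> extensions r T j"
    using T' tr assms
    by (auto simp: extensions_def descendants_def T1_def j_def ball_tree_in_Trees_fin Trees_fin_D
        ball_tree_ball_tree level_ball_tree mem_ball_tree)
  have "T1 \<subseteq> T'" by (auto simp: T1_def ball_tree_def)
  then have "card T1 \<le> card T'" using Trees_fin_D(2)[OF tr] by (rule card_mono[rotated])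
  then have j: "j \<le> n" using card_extension[OF T1] T' by (simp add: descendants_def)
  then have "T' \<in> descendants (Suc r) T1 m (n - j)"
    using T' card_extension[OF T1] by (auto simp: descendants_def T1_def[symmetric])
  then show "T' \<in> (\<Union>j\<in>{..n}. \<Union>T1\<in>extensions r T j. descendants (Suc r) T1 m (n - j))"
    using T1 j by auto
next
  fix T' assume "T' \<in> (\<Union>j\<in>{..n}. \<Union>T1\<in>extensions r T j. descendants (Suc r) T1 m (n - j))"
  then obtain j T1 where j: "j \<le> n" "T1 \<in> extensions r T j" "T' \<in> descendants (Suc r) T1 m (n - j)"
    by auto
  have "ball_tree r T' = ball_tree r (ball_tree (Suc r) T')" by (simp add: ball_tree_ball_tree)
  then show "T' \<in> descendants r T (Suc m) n"
    using j card_extension[OF j(2)] by (auto simp: descendants_def extensions_def)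
qed

text \<open>Below the K vertices of the top level hangs a forest of K plane trees. The induction
  peels off the first new level rather than the last, so r and T must vary.\<close>

lemma card_descendants:
  assumes "T \<in> Trees_fin" "\<forall>v\<in>T. length v \<le> r" "r \<ge> 1"
  shows "finite (descendants r T m n) \<and> real (card (descendants r T m n)) = fps_nth (htgf m ^ card (level r T)) n"
  using assms
proof (induction m arbitrary: r T n)
  case 0
  have "T' = T" if "T' \<in> descendants r T 0 n" for T'
    using that by (auto simp: descendants_def ball_tree_def)
  then have "descendants r T 0 n \<subseteq> (if n = 0 then {T} else {})"
    by (fastforce simp: descendants_def)
  moreover have "T \<in> descendants r T 0 0"
    using 0 by (auto simp: descendants_def ball_tree_def)
  ultimately have "descendants r T 0 n = (if n = 0 then {T} else {})"
    by (auto split: if_splits)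
  then show ?case by simp
next
  case (Suc m)
  have ext: "T1 \<in> Trees_fin" "\<forall>v\<in>T1. length v \<le> Suc r" "card (level (Suc r) T1) = j"
    if "T1 \<in> extensions r T j" for T1 j
    using that by (auto simp: extensions_def)
  have IH: "finite (descendants (Suc r) T1 m (n - j))"
    "real (card (descendants (Suc r) T1 m (n - j))) = fps_nth (htgf m ^ j) (n - j)"
    if "T1 \<in> extensions r T j" for T1 j
    using Suc.IH[OF ext(1,2)[OF that], of "n - j"] ext(3)[OF that] by auto
  let ?U = "\<lambda>j. \<Union>T1\<in>extensions r T j. descendants (Suc r) T1 m (n - j)"
  note fin = card_extensions(2)[OF Suc.prems]
  have fin2: "finite (?U j)" for j
    using fin IH by auto
  have disj: "descendants (Suc r) T1 m a \<inter> descendants (Suc r) T2 m b = {}" if "T1 \<noteq> T2" for T1 T2 a b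
    using that by (auto simp: descendants_def)
  have disj2: "extensions r T j \<inter> extensions r T j' = {}" if "j \<noteq> j'" for j j'
    using that by (auto simp: extensions_def)
  have "real (card (descendants r T (Suc m) n))
     = real (\<Sum>j\<le>n. card (?U j))"
    unfolding descendants_Suc[OF Suc.prems(3)]
  proof (subst card_UN_disjoint)
    show "\<forall>j\<in>{..n}. \<forall>j'\<in>{..n}. j \<noteq> j' \<longrightarrow>
      ?U j \<inter> ?U j' = {}"
    proof (intro ballI impI equals0I)
      fix j j' T' assume "j \<noteq> j'" and "T' \<in> ?U j \<inter> ?U j'"
      then obtain T1 T2 where "T1 \<in> extensions r T j" "T2 \<in> extensions r T j'"
        "T' \<in> descendants (Suc r) T1 m (n - j)" "T' \<in> descendants (Suc r) T2 m (n - j')" by auto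
      with disj2[OF \<open>j \<noteq> j'\<close>] disj[of T1 T2 "n - j" "n - j'"] show False by blast
    qed
  qed (use fin2 in auto)
  also have "\<dots> = (\<Sum>j\<le>n. \<Sum>T1\<in>extensions r T j. real (card (descendants (Suc r) T1 m (n - j))))"
    unfolding of_nat_sum
  proof (intro sum.cong refl)
    fix j
    have "card (?U j)
      = (\<Sum>T1\<in>extensions r T j. card (descendants (Suc r) T1 m (n - j)))"
      using fin IH disj by (intro card_UN_disjoint) auto
    then show "real (card (?U j))
      = (\<Sum>T1\<in>extensions r T j. real (card (descendants (Suc r) T1 m (n - j))))" by simp
  qed
  also have "\<dots> = (\<Sum>j\<le>n. real ((card (level r T) + j - 1) choose j) * fps_nth (htgf m ^ j) (n - j))"
    using IH card_extensions(1)[OF Suc.prems] by (intro sum.cong refl) simp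
  also have "\<dots> = fps_nth (htgf (Suc m) ^ card (level r T)) n"
    by (rule htgf_Suc_power_nth[symmetric])
  finally show ?case
    unfolding descendants_Suc[OF Suc.prems(3)] using fin2 by auto
qed

text \<open>A vertex of length l brings its l + 1 prefixes along, so N edges bound the height by N
  and \<open>card_descendants\<close> applies.\<close>

lemma finite_trees_N: "finite (trees_N N)"
proof -
  have prefix: "(\<lambda>k. take k v) ` {..length v} \<subseteq> T" if "T \<in> Trees" "v \<in> T" for T v
    using that(2)
  proof (induction v rule: rev_induct)
    case (snoc i v)
    then have "v \<in> T" using Trees_D(2)[OF that(1)] by blast
    with snoc have "take k (v @ [i]) \<in> T" if "k \<le> Suc (length v)" for k
      using that by (cases "k = Suc (length v)") auto
    then show ?case by auto
  qed auto
  have "trees_N N \<subseteq> descendants 1 edge_tree N (N - 1)"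
  proof
    fix T assume "T \<in> trees_N N"
    then have T: "T \<in> Trees_fin" "card T - 1 = N" by (auto simp: trees_N_def edges_def)
    note fin = Trees_fin_D(2)[OF T(1)] and tr = Trees_fin_D(1)[OF T(1)]
    have "length v \<le> N" if v: "v \<in> T" for v
    proof -
      have "inj_on (\<lambda>k. take k v) {..length v}" by (auto simp: inj_on_def) (metis length_take min.absorb2)
      then show ?thesis
        using card_mono[OF fin prefix[OF tr v]] T(2) by (simp add: card_image)
    qed
    moreover have "edge_tree \<subseteq> T" using ball_tree_1[OF tr] by (auto simp: ball_tree_def)
    then have "card edge_tree \<le> card T" by (rule card_mono[OF fin])
    ultimately show "T \<in> descendants 1 edge_tree N (N - 1)"
      using T ball_tree_1[OF tr] by (auto simp: descendants_def edge_tree_def le_SucI)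
  qed
  moreover have "finite (descendants 1 edge_tree N (N - 1))"
    using card_descendants[OF edge_tree_Trees_fin, of 1 N "N - 1"] by (auto simp: edge_tree_def)
  ultimately show ?thesis by (rule finite_subset)
qed

lemma card_level_height:
  assumes "T \<in> Trees_fin"
  shows "1 \<le> card (level (height T) T)" "card (level (height T) T) \<le> edges T"
proof -
  have fin: "finite (level (height T) T)" using finite_level Trees_fin_D(1)[OF assms] by blast
  then show "1 \<le> card (level (height T) T)"
    using level_height_nonempty[OF assms] by (simp add: Suc_le_eq card_gt_0_iff)
  have "level (height T) T \<subseteq> T - {[]}" using height_ge_1[OF assms] by (auto simp: mem_level)
  then have "card (level (height T) T) \<le> card (T - {[]})"
    using Trees_fin_D(2)[OF assms] by (intro card_mono) auto
  also have "\<dots> = edges T"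
    using Trees_fin_D[OF assms] Trees_D(1)[of T] by (simp add: edges_def)
  finally show "card (level (height T) T) \<le> edges T" .
qed

lemma card_eq_Suc_edges:
  assumes "T \<in> Trees_fin"
  shows "card T = Suc (edges T)"
proof -
  have "card T > 0" using Trees_fin_D[OF assms] by (simp add: card_gt_0_iff)
  then show ?thesis by (simp add: edges_def)
qed

section \<open>Cylinder weights in terms of height sums\<close>

lemma sums_geometric_from:
  fixes q :: real
  assumes "\<bar>q\<bar> < 1"
  shows "(\<lambda>m. if d \<le> m then q ^ m else 0) sums (q ^ d / (1 - q))"
proof -
  have "(\<lambda>m. q ^ d * q ^ m) sums (q ^ d * (1 / (1 - q)))"
    using assms by (intro sums_mult geometric_sums) auto
  then have "(\<lambda>m. if d \<le> m + d then q ^ (m + d) else 0) sums (q ^ d / (1 - q))"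
    by (simp add: power_add mult.commute)
  then show ?thesis
    by (subst (asm) sums_zero_iff_shift) auto
qed

abbreviation gibbs :: "real \<Rightarrow> nat \<Rightarrow> nat list set \<Rightarrow> real" where
  "gibbs \<mu> N T \<equiv> exp (- \<mu> * real (height T)) / Z \<mu> N"

context height_coupling
begin

text \<open>Summation by parts: for q = exp(-\<mu>), q^h is 1 - q times the sum of q^m over m \<ge>
  h. The sum over exact heights thus becomes a sum over m of counts of bounded height, which
  \<open>card_descendants\<close> supplies.\<close>

lemma weighted_sum_cyl:
  assumes T0: "T0 \<in> Trees_fin" and N: "edges T0 \<le> N"
  shows "(\<Sum>T\<in>cyl T0 \<inter> trees_N N. exp (- \<mu> * real (height T)))
     = exp (- \<mu> * real (height T0)) * (1 - exp (- \<mu>))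
        * hsum (card (level (height T0) T0)) (N - edges T0)"
proof -
  define S where "S = cyl T0 \<inter> trees_N N"
  define r where "r = height T0"
  define q where "q = exp (- \<mu>)"
  have q: "0 < q" "q < 1" "\<bar>q\<bar> < 1" using \<mu>_pos by (auto simp: q_def)
  have qp: "exp (- \<mu> * real m) = q ^ m" for m
    unfolding q_def by (simp add: exp_of_nat_mult[symmetric] mult.commute)
  have fin: "finite S" unfolding S_def using finite_trees_N by simp
  have S: "T \<in> Trees_fin" "ball_tree r T = T0" "edges T = N" if "T \<in> S" for T
    using that by (auto simp: S_def trees_N_def cyl_def r_def)
  have hr: "r \<le> height T" if "T \<in> S" for T
    using height_ge_ball[OF S(1)[OF that] _ T0] S(2)[OF that] by (simp add: r_def)
  have desc: "{T\<in>S. height T \<le> r + m} = descendants r T0 m (N - edges T0)" for m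
    using N by (auto simp: S_def trees_N_def cyl_def r_def descendants_def height_le_iff card_eq_Suc_edges[OF T0]
      card_eq_Suc_edges Trees_fin_D)
  have len: "\<forall>v\<in>T0. length v \<le> r" using height_le_iff[OF T0, of r] by (simp add: r_def)
  have card: "real (card {T\<in>S. height T \<le> r + m}) = fps_nth (htgf m ^ card (level r T0)) (N - edges T0)" for m
    unfolding desc using card_descendants[OF T0 len] height_ge_1[OF T0] by (simp add: r_def)
  have "(\<lambda>m. \<Sum>T\<in>S. if height T - r \<le> m then q ^ m else 0) sums (\<Sum>T\<in>S. q ^ (height T - r) / (1 - q))"
    by (intro sums_sum sums_geometric_from q)
  also have "(\<lambda>m. \<Sum>T\<in>S. if height T - r \<le> m then q ^ m else 0)
    = (\<lambda>m. exp (- \<mu> * real m) * fps_nth (htgf m ^ card (level r T0)) (N - edges T0))"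
  proof
    fix m
    have "(\<Sum>T\<in>S. if height T - r \<le> m then q ^ m else 0) = (\<Sum>T\<in>{T\<in>S. height T \<le> r + m}. q ^ m)"
      using fin by (intro sum.mono_neutral_cong_right) (auto simp: le_diff_conv)
    also have "\<dots> = q ^ m * real (card {T\<in>S. height T \<le> r + m})" by simp
    finally show "(\<Sum>T\<in>S. if height T - r \<le> m then q ^ m else 0)
      = exp (- \<mu> * real m) * fps_nth (htgf m ^ card (level r T0)) (N - edges T0)"
      unfolding card qp .
  qed
  finally have "hsum (card (level r T0)) (N - edges T0) = (\<Sum>T\<in>S. q ^ (height T - r) / (1 - q))"
    unfolding hsum_def by (rule sums_unique[symmetric])
  then have "q ^ r * (1 - q) * hsum (card (level r T0)) (N - edges T0) = (\<Sum>T\<in>S. q ^ r * (1 - q) * (q ^ (height T - r) / (1 - q)))"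
    by (simp only: sum_distrib_left)
  also have "\<dots> = (\<Sum>T\<in>S. q ^ height T)"
  proof (intro sum.cong refl)
    fix T assume "T \<in> S"
    then have "q ^ r * q ^ (height T - r) = q ^ height T"
      using hr by (simp add: power_add[symmetric])
    then show "q ^ r * (1 - q) * (q ^ (height T - r) / (1 - q)) = q ^ height T"
      using q by simp
  qed
  finally show ?thesis unfolding S_def qp r_def q_def by simp
qed

lemma Z_eq:
  assumes "N \<ge> 1"
  shows "Z \<mu> N = exp (- \<mu>) * (1 - exp (- \<mu>)) * hsum 1 (N - 1)"
proof -
  have "cyl edge_tree \<inter> trees_N N = trees_N N"
    unfolding cyl_edge_tree by (auto simp: trees_N_def Trees_fin_def)
  then show ?thesis
    using weighted_sum_cyl[OF edge_tree_Trees_fin, of N] assms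
    unfolding Z_def height_edge_tree level_edge_tree edges_edge_tree by simp
qed

lemma hsum_1_pos: "\<forall>\<^sub>F n in sequentially. hsum 1 n > 0"
proof -
  have "(\<lambda>n. hsum 1 n / (4 ^ (n + 1) * part (n + 1))) \<longlonglongrightarrow> 1 / 2"
    using hsum_asymptotics[of 1] by (simp add: branch_poly_def)
  then have "\<forall>\<^sub>F n in sequentially. hsum 1 n / (4 ^ (n + 1) * part (n + 1)) > 0"
    by (rule order_tendstoD) simp
  moreover have "\<forall>\<^sub>F n in sequentially. part (n + 1) > 0"
    by (rule eventually_sequentially_seg[THEN iffD2], rule part_pos)
  ultimately show ?thesis
  proof eventually_elim
    case (elim n)
    then have pos: "4 ^ (n + 1) * part (n + 1) > 0" by simp
    show ?case using mult_pos_pos[OF elim(1) pos] elim(2) by simp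
  qed
qed

text \<open>Not for all N: \<open>trees_N 0\<close> is empty because the root has degree 1.\<close>

lemma Z_pos: "\<forall>\<^sub>F N in sequentially. Z \<mu> N > 0"
proof -
  have "\<forall>\<^sub>F N in sequentially. hsum 1 (N + 1 - 1) > 0" using hsum_1_pos by simp
  then have "\<forall>\<^sub>F N in sequentially. hsum 1 (N - 1) > 0"
    by (rule eventually_sequentially_seg[THEN iffD1])
  then show ?thesis
    using eventually_ge_at_top[of 1]
  proof eventually_elim
    case (elim N)
    then show ?case using \<mu>_pos unfolding Z_eq[OF elim(2)] by simp
  qed
qed

lemma cyl_formula_eq:
  "cyl_formula \<mu> T = exp (- \<mu> * (real (height T) - 1)) * (1 / 4) ^ edges T *
     2 ^ (card (level (height T) T) + 1) * branch_poly \<mu> (card (level (height T) T))"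
  by (simp add: cyl_formula_def branch_poly_def Let_def)

theorem cyl_weight_tendsto:
  assumes T0: "T0 \<in> Trees_fin"
  shows "(\<lambda>N. (\<Sum>T\<in>cyl T0 \<inter> trees_N N. gibbs \<mu> N T)) \<longlonglongrightarrow> cyl_formula \<mu> T0"
proof -
  define r where "r = height T0"
  define K where "K = card (level r T0)"
  have lim: "(\<lambda>N. exp (- \<mu> * (real r - 1)) * (hsum K (N - edges T0) / hsum 1 (N - 1))) \<longlonglongrightarrow>
    exp (- \<mu> * (real r - 1)) * ((1 / 4) ^ edges T0 * 2 ^ (K + 1) * branch_poly \<mu> K)"
    using card_level_height[OF T0] unfolding K_def r_def by (intro tendsto_mult_left hsum_ratio)
  have "\<forall>\<^sub>F N in sequentially. (\<Sum>T\<in>cyl T0 \<inter> trees_N N. gibbs \<mu> N T)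
     = exp (- \<mu> * (real r - 1)) * (hsum K (N - edges T0) / hsum 1 (N - 1))"
    using eventually_ge_at_top[of "edges T0"] eventually_ge_at_top[of 1]
  proof eventually_elim
    case (elim N)
    have "exp (- \<mu> * real r) = exp (- \<mu> * (real r - 1)) * exp (- \<mu>)"
      by (simp add: exp_add[symmetric] algebra_simps)
    moreover have "1 - exp (- \<mu>) \<noteq> 0" using \<mu>_pos by simp
    ultimately show ?case
      unfolding sum_divide_distrib[symmetric] weighted_sum_cyl[OF T0 elim(1)] Z_eq[OF elim(2)] K_def r_def
      by simp
  qed
  then show ?thesis
    using lim unfolding cyl_formula_eq K_def[symmetric] r_def[symmetric]
    by (simp add: tendsto_cong mult.assoc)
qed

end

section \<open>The topology of local convergence\<close>

lemma tree_dist_le: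
  assumes "r \<ge> 1" "ball_tree r T = ball_tree r T'"
  shows "tree_dist T T' \<le> 1 / real r"
  unfolding tree_dist_def using assms by (intro cInf_lower bdd_belowI[of _ 0]) auto

text \<open>The infimum is over a nonempty set, as all trees agree up to height 1; if it is below 1
  / r, then the balls agree at some radius beyond r.\<close>

lemma ball_tree_eq_of_tree_dist:
  assumes "T \<in> Trees" "T' \<in> Trees" "r \<ge> 1" "tree_dist T T' < 1 / real r"
  shows "ball_tree r T = ball_tree r T'"
proof -
  have "(\<lambda>r. 1 / real r) ` {r. r \<ge> 1 \<and> ball_tree r T = ball_tree r T'} \<noteq> {}"
    using ball_tree_1[OF assms(1)] ball_tree_1[OF assms(2)] by auto
  from cInf_lessD[OF this assms(4)[unfolded tree_dist_def]]
  obtain s where s: "s \<ge> 1" "ball_tree s T = ball_tree s T'" "1 / real s < 1 / real r" by auto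
  then have "r \<le> s" using assms(3) by (simp add: field_simps)
  with s(2) show ?thesis by (rule ball_tree_mono_eq)
qed

text \<open>Replaces metric balls by agreement up to a finite height. The \<open>topology\<close>
  constructor can only be unfolded once \<open>istopology\<close> is shown.\<close>

lemma openin_tree_top:
  "openin tree_top U \<longleftrightarrow> U \<subseteq> Trees \<and>
     (\<forall>T\<in>U. \<exists>r\<ge>1. \<forall>T'\<in>Trees. ball_tree r T' = ball_tree r T \<longrightarrow> T' \<in> U)"
proof -
  let ?D = "\<lambda>T e. {T' \<in> Trees. tree_dist T T' < e}"
  let ?B = "\<lambda>T r. \<forall>T'\<in>Trees. ball_tree r T' = ball_tree r T \<longrightarrow> T' \<in> U"
  let ?P = "\<lambda>U. U \<subseteq> Trees \<and> (\<forall>T\<in>U. \<exists>e>0. ?D T e \<subseteq> U)"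
  have "istopology ?P"
    unfolding istopology_def
  proof (intro conjI allI impI)
    fix S S' assume S: "?P S" and S': "?P S'"
    have "\<exists>e>0. ?D T e \<subseteq> S \<inter> S'" if T: "T \<in> S \<inter> S'" for T
    proof -
      obtain e e' where "e > 0" "e' > 0" "?D T e \<subseteq> S"
        "?D T e' \<subseteq> S'" using S S' T by blast
      then show ?thesis by (intro exI[of _ "min e e'"]) auto
    qed
    then show "S \<inter> S' \<subseteq> Trees" "\<forall>T\<in>S \<inter> S'. \<exists>e>0. ?D T e \<subseteq> S \<inter> S'"
      using S by blast+
  next
    fix \<K> :: "nat list set set set" assume "\<forall>K\<in>\<K>. ?P K"
    then show "\<Union>\<K> \<subseteq> Trees" "\<forall>T\<in>\<Union>\<K>. \<exists>e>0. ?D T e \<subseteq> \<Union>\<K>"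
      by (blast, meson UnionE Union_upper subset_trans)
  qed
  then have "openin tree_top U \<longleftrightarrow> ?P U" unfolding tree_top_def by (simp add: topology_inverse')
  also have "\<dots> \<longleftrightarrow> U \<subseteq> Trees \<and>
     (\<forall>T\<in>U. \<exists>r\<ge>1. ?B T r)"
  proof (intro conj_cong ball_cong refl)
    fix T assume U: "U \<subseteq> Trees" and T: "T \<in> U"
    show "(\<exists>e>0. ?D T e \<subseteq> U)
      \<longleftrightarrow> (\<exists>r\<ge>1. ?B T r)"
    proof
      assume "\<exists>e>0. ?D T e \<subseteq> U"
      then obtain e where e: "e > 0" "?D T e \<subseteq> U" by blast
      obtain n where n: "n \<noteq> 0" "inverse (real n) < e"
        using real_arch_inverse[of e] e(1) by auto
      have "T' \<in> U" if "T' \<in> Trees" "ball_tree n T' = ball_tree n T" for T'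
        using tree_dist_le[of n T T'] that n e(2) by (auto simp: inverse_eq_divide)
      then show "\<exists>r\<ge>1. ?B T r"
        using n(1) by (intro exI[of _ n]) auto
    next
      assume "\<exists>r\<ge>1. ?B T r"
      then obtain r where r: "r \<ge> 1" "?B T r" by blast
      have "T' \<in> U" if "T' \<in> Trees" "tree_dist T T' < 1 / real r" for T'
        using ball_tree_eq_of_tree_dist[of T T' r] that U T r by auto
      then show "\<exists>e>0. ?D T e \<subseteq> U"
        using r(1) by (intro exI[of _ "1 / real r"]) auto
    qed
  qed
  finally show ?thesis .
qed

lemma topspace_tree_top: "topspace tree_top = Trees"
proof
  show "topspace tree_top \<subseteq> Trees" using openin_tree_top by (auto simp: topspace_def)
  have "openin tree_top Trees" unfolding openin_tree_top by auto
  then show "Trees \<subseteq> topspace tree_top" by (rule openin_subset)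
qed

lemma openin_cyl:
  assumes "T0 \<in> Trees_fin"
  shows "openin tree_top (cyl T0)"
  unfolding openin_tree_top using height_ge_1[OF assms] by (auto simp: cyl_def)

lemma open_tree_subset: "{U. openin tree_top U} \<subseteq> Pow Trees"
  using openin_tree_top by auto

lemma space_tree_borel: "space tree_borel = Trees"
  unfolding tree_borel_def by (rule space_measure_of[OF open_tree_subset])

lemma sets_tree_borel: "sets tree_borel = sigma_sets Trees {U. openin tree_top U}"
  unfolding tree_borel_def by (rule sets_measure_of[OF open_tree_subset])

lemma open_in_sets_tree_borel: "openin tree_top U \<Longrightarrow> U \<in> sets tree_borel"
  unfolding sets_tree_borel by (auto intro: sigma_sets.Basic)

lemma cyl_in_sets: "T0 \<in> Trees_fin \<Longrightarrow> cyl T0 \<in> sets tree_borel"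
  by (intro open_in_sets_tree_borel openin_cyl)

lemma countable_Trees_fin: "countable Trees_fin"
  by (rule countable_subset[OF _ countable_Collect_finite]) (auto simp: Trees_fin_def)

section \<open>Cylinders generate the Borel sets\<close>

lemma level_empty_mono:
  assumes "T \<in> Trees" "level r T = {}" "r \<le> s"
  shows "level s T = {}"
  using assms(3)
proof (induction rule: dec_induct)
  case (step s)
  then show ?case by (simp add: level_Suc[OF assms(1)])
qed (use assms in simp)

lemma ball_tree_eq_self:
  assumes "T \<in> Trees" "level (Suc r) T = {}"
  shows "ball_tree r T = T"
proof -
  have "length v \<le> r" if "v \<in> T" for v
    using level_empty_mono[OF assms, of "length v"] that mem_level[of v "length v" T]
    by (cases "length v \<le> r") auto
  then show ?thesis by (auto simp: mem_ball_tree)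
qed

lemma self_in_cyl: "T0 \<in> Trees_fin \<Longrightarrow> T0 \<in> cyl T0"
  by (simp add: cyl_def Trees_fin_D ball_tree_height_id)

text \<open>The larger ball of a tree determines the smaller one, so cylinders behave like balls of
  an ultrametric space: disjoint or nested.\<close>

lemma cyl_disjoint:
  assumes "height S \<le> height S'" "cyl S \<inter> cyl S' \<noteq> {}"
  shows "cyl S' \<subseteq> cyl S"
proof -
  obtain T where T: "ball_tree (height S) T = S" "ball_tree (height S') T = S'"
    using assms(2) by (auto simp: cyl_def)
  have "ball_tree (height S) T' = S" if "ball_tree (height S') T' = S'" for T'
    using ball_tree_mono_eq[of "height S'" T' T "height S"] that T assms(1) by simp
  then show ?thesis by (auto simp: cyl_def)
qed

lemma level_nonempty_sets: "{T \<in> Trees. level r T \<noteq> {}} \<in> sets tree_borel"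
proof (cases "r = 0")
  case True
  have "level 0 T \<noteq> {}" if "T \<in> Trees" for T
    using Trees_D(1)[OF that] mem_level[of "[]" 0 T] by auto
  then have "{T \<in> Trees. level r T \<noteq> {}} = space tree_borel"
    using True space_tree_borel by auto
  then show ?thesis by (simp only: sets.top)
next
  case False
  let ?I = "{S \<in> Trees_fin. height S = r}"
  have "{T \<in> Trees. level r T \<noteq> {}} = (\<Union>S\<in>?I. cyl S)"
  proof (intro set_eqI iffI)
    fix T assume T: "T \<in> {T \<in> Trees. level r T \<noteq> {}}"
    then have "ball_tree r T \<in> ?I"
      using False height_ball_tree[of T r] by (auto intro: ball_tree_in_Trees_fin)
    moreover have "T \<in> cyl (ball_tree r T)"
      using T False height_ball_tree[of T r] by (simp add: cyl_def)
    ultimately show "T \<in> (\<Union>S\<in>?I. cyl S)" by blast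
  next
    fix T assume "T \<in> (\<Union>S\<in>?I. cyl S)"
    then have T: "T \<in> Trees" "height (ball_tree r T) = r" "ball_tree r T \<in> Trees_fin"
      by (auto simp: cyl_def)
    then show "T \<in> {T \<in> Trees. level r T \<noteq> {}}"
      using level_height_nonempty[OF T(3)] level_ball_tree[of r r T] by simp
  qed
  also have "\<dots> \<in> sets tree_borel"
    by (intro sets.countable_UN' countable_subset[OF _ countable_Trees_fin]) (auto intro: cyl_in_sets)
  finally show ?thesis .
qed

text \<open>The empty set is included because disjoint cylinders would otherwise break stability
  under intersection.\<close>

definition cyls :: "nat list set set set" where
  "cyls = insert {} (cyl ` Trees_fin)"

lemma cyls_subset: "cyls \<subseteq> Pow Trees"
  by (auto simp: cyls_def cyl_def)

lemma Int_stable_cyls: "Int_stable cyls"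
proof (rule Int_stableI)
  fix A B assume AB: "A \<in> cyls" "B \<in> cyls"
  show "A \<inter> B \<in> cyls"
  proof (cases "A \<inter> B = {}")
    case True
    then show ?thesis by (simp add: cyls_def)
  next
    case False
    then obtain S S' where S: "A = cyl S" "B = cyl S'"
      using AB by (auto simp: cyls_def)
    have "A \<inter> B = A \<or> A \<inter> B = B"
      using cyl_disjoint[of S S'] cyl_disjoint[of S' S] False unfolding S
      by (cases "height S \<le> height S'") auto
    then show ?thesis using AB by auto
  qed
qed

text \<open>A member of \<open>cyl S\<close> other than S reaches one level higher and so lies in a
  cylinder of the next height. Singletons matter because a ball condition with radius above the
  height of S selects S alone, and this set is not a cylinder.\<close>

lemma singleton_eq_cyl_diff:
  assumes S: "S \<in> Trees_fin"
  shows "{S} = cyl S - (\<Union>S'\<in>{S' \<in> Trees_fin. height S' = Suc (height S)}. cyl S')"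
proof (intro set_eqI iffI)
  fix T assume "T \<in> {S}"
  then have T: "T = S" by simp
  have "S \<notin> cyl S'" if "height S' = Suc (height S)" for S'
    using that ball_tree_height_id[OF S, of "Suc (height S)"] by (auto simp: cyl_def)
  then show "T \<in> cyl S - (\<Union>S'\<in>{S' \<in> Trees_fin. height S' = Suc (height S)}. cyl S')"
    using self_in_cyl[OF S] unfolding T by auto
next
  fix T assume T: "T \<in> cyl S - (\<Union>S'\<in>{S' \<in> Trees_fin. height S' = Suc (height S)}. cyl S')"
  then have tr: "T \<in> Trees" "ball_tree (height S) T = S" by (auto simp: cyl_def)
  have "level (Suc (height S)) T = {}"
  proof (rule ccontr)
    let ?S' = "ball_tree (Suc (height S)) T"
    assume ne: "level (Suc (height S)) T \<noteq> {}"
    then have "height ?S' = Suc (height S)" using height_ball_tree[OF tr(1), of "Suc (height S)"] by simp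
    moreover have "?S' \<in> Trees_fin" using tr by (intro ball_tree_in_Trees_fin) auto
    ultimately show False using T tr(1) by (auto simp: cyl_def)
  qed
  then show "T \<in> {S}" using ball_tree_eq_self[OF tr(1)] tr(2) by auto
qed

lemma cyl_in_sigma: "S \<in> Trees_fin \<Longrightarrow> cyl S \<in> sigma_sets Trees cyls"
  by (auto simp: cyls_def)

lemma singleton_in_sigma:
  assumes S: "S \<in> Trees_fin"
  shows "{S} \<in> sigma_sets Trees cyls"
proof -
  interpret sigma_algebra Trees "sigma_sets Trees cyls"
    by (rule sigma_algebra_sigma_sets[OF cyls_subset])
  show ?thesis
    unfolding singleton_eq_cyl_diff[OF S]
    by (intro Diff cyl_in_sigma S countable_UN' countable_subset[OF _ countable_Trees_fin]) (auto intro: cyl_in_sigma)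
qed

lemma ball_class_in_sigma:
  assumes S: "S \<in> Trees_fin" and r: "r \<ge> 1"
  shows "{T \<in> Trees. ball_tree r T = S} \<in> sigma_sets Trees cyls"
proof -
  consider "height S = r" | "height S > r" | "height S < r" by linarith
  then show ?thesis
  proof cases
    case 1
    then show ?thesis using cyl_in_sigma[OF S] by (simp add: cyl_def)
  next
    case 2
    have "height (ball_tree r T) \<le> r" if "T \<in> Trees" for T
      using ball_tree_in_Trees_fin[OF that r] by (simp add: height_le_iff mem_ball_tree)
    then have empty: "{T \<in> Trees. ball_tree r T = S} = {}" using 2 leD by blast
    show ?thesis unfolding empty by (rule sigma_sets.Empty)
  next
    case 3
    have "T = S" if T: "T \<in> Trees" "ball_tree r T = S" for T
    proof -
      have "level r T = {}"
        using height_ball_tree[OF T(1) r] T(2) 3 by auto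
      then have "level (Suc r) T = {}" using level_empty_mono[OF T(1), of r "Suc r"] by simp
      from ball_tree_eq_self[OF T(1) this] T(2) show ?thesis by simp
    qed
    then have "{T \<in> Trees. ball_tree r T = S} = {S}"
      using S ball_tree_height_id[OF S, of r] 3 by (auto simp: Trees_fin_D)
    then show ?thesis using singleton_in_sigma[OF S] by simp
  qed
qed

text \<open>There are only countably many finite trees, so every open set is a countable union of
  ball classes, each of which \<open>ball_class_in_sigma\<close> builds from cylinders.\<close>

lemma sets_tree_borel_eq_cyls: "sets tree_borel = sigma_sets Trees cyls"
proof
  interpret sigma_algebra Trees "sigma_sets Trees cyls"
    by (rule sigma_algebra_sigma_sets[OF cyls_subset])
  show "sets tree_borel \<subseteq> sigma_sets Trees cyls"
    unfolding sets_tree_borel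
  proof (rule sigma_sets_subset, safe)
    fix U assume U: "openin tree_top U"
    let ?I = "{(r, S). S \<in> Trees_fin \<and> r \<ge> 1 \<and> {T \<in> Trees. ball_tree r T = S} \<subseteq> U}"
    have "U = (\<Union>(r, S)\<in>?I. {T \<in> Trees. ball_tree r T = S})"
    proof (intro set_eqI iffI)
      fix T assume T: "T \<in> U"
      then have tr: "T \<in> Trees" using U openin_tree_top by blast
      obtain r where r: "r \<ge> 1" "\<forall>T'\<in>Trees. ball_tree r T' = ball_tree r T \<longrightarrow> T' \<in> U"
        using U T unfolding openin_tree_top by blast
      then have "(r, ball_tree r T) \<in> ?I" using ball_tree_in_Trees_fin[OF tr r(1)] by auto
      then show "T \<in> (\<Union>(r, S)\<in>?I. {T \<in> Trees. ball_tree r T = S})"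
        using tr by (intro UN_I[of "(r, ball_tree r T)"]) auto
    qed auto
    also have "\<dots> \<in> sigma_sets Trees cyls"
    proof (rule countable_UN')
      show "countable ?I"
        by (rule countable_subset[of _ "UNIV \<times> Trees_fin"]) (auto intro: countable_Trees_fin)
    qed (auto intro: ball_class_in_sigma)
    finally show "U \<in> sigma_sets Trees cyls" .
  qed
  show "sigma_sets Trees cyls \<subseteq> sets tree_borel"
    unfolding space_tree_borel[symmetric]
    by (rule sets.sigma_sets_subset) (auto simp: cyls_def cyl_in_sets)
qed

lemma tree_measure_eqI:
  assumes "prob_space M" "sets M = sets tree_borel" "prob_space N" "sets N = sets tree_borel"
    and eq: "\<And>S. S \<in> Trees_fin \<Longrightarrow> measure M (cyl S) = measure N (cyl S)"
  shows "M = N"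
proof -
  interpret M: prob_space M by fact
  interpret N: prob_space N by fact
  show ?thesis
  proof (rule measure_eqI_generator_eq[where A = "\<lambda>_::nat. Trees"])
    show "Int_stable cyls" "cyls \<subseteq> Pow Trees" by (rule Int_stable_cyls, rule cyls_subset)
    show "emeasure M X = emeasure N X" if "X \<in> cyls" for X
      using that eq by (auto simp: cyls_def M.emeasure_eq_measure N.emeasure_eq_measure)
    show "sets M = sigma_sets Trees cyls" "sets N = sigma_sets Trees cyls"
      using assms sets_tree_borel_eq_cyls by auto
    show "range (\<lambda>_::nat. Trees) \<subseteq> cyls"
      using cyl_edge_tree edge_tree_Trees_fin by (auto simp: cyls_def)
    show "emeasure M Trees \<noteq> \<infinity>" by (simp add: M.emeasure_eq_measure)
  qed simp
qed

section \<open>Weak convergence from convergence on cylinders\<close>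

lemma continuous_map_tree_measurable:
  assumes "continuous_map tree_top euclideanreal f"
  shows "f \<in> borel_measurable tree_borel"
proof (rule borel_measurableI)
  fix S :: "real set" assume "open S"
  then have "openin tree_top {x \<in> topspace tree_top. f x \<in> S}"
    using assms by (auto intro: openin_continuous_map_preimage)
  moreover have "{x \<in> topspace tree_top. f x \<in> S} = f -` S \<inter> space tree_borel"
    by (auto simp: topspace_tree_top space_tree_borel)
  ultimately show "f -` S \<inter> space tree_borel \<in> sets tree_borel"
    by (simp add: open_in_sets_tree_borel)
qed

lemma continuous_map_tree_ball:
  assumes f: "continuous_map tree_top euclideanreal f" and T: "T \<in> Trees" and "e > 0"
  shows "\<exists>r\<ge>1. \<forall>T'\<in>Trees. ball_tree r T' = ball_tree r T \<longrightarrow> \<bar>f T' - f T\<bar> < e"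
proof -
  have "openin tree_top {x \<in> topspace tree_top. f x \<in> ball (f T) e}"
    by (rule openin_continuous_map_preimage[OF f]) simp
  moreover have "T \<in> {x \<in> topspace tree_top. f x \<in> ball (f T) e}"
    using T \<open>e > 0\<close> by (simp add: topspace_tree_top)
  ultimately have "\<exists>r\<ge>1. \<forall>T'\<in>Trees. ball_tree r T' = ball_tree r T \<longrightarrow> T' \<in> {x \<in> topspace tree_top. f x \<in> ball (f T) e}"
    unfolding openin_tree_top by blast
  then show ?thesis by (auto simp: dist_real_def abs_minus_commute)
qed

text \<open>Fix \<open>\<epsilon>\<close>. On \<open>\<nu>\<close>-almost every tree \<open>f\<close> oscillates by less than \<open>\<epsilon>\<close> on the cylinder of a
  large ball, so at some fixed height finitely many disjoint cylinders with this property carry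
  \<open>\<nu>\<close>-mass \<open>1 - \<epsilon>\<close>, and on those the integrals converge by assumption.\<close>
lemma weak_conv_treesI:
  assumes M: "\<forall>\<^sub>F N in sequentially. prob_space (M N) \<and> sets (M N) = sets tree_borel"
    and \<nu>: "prob_space \<nu>" "sets \<nu> = sets tree_borel"
    and lim: "\<And>S. S \<in> Trees_fin \<Longrightarrow> (\<lambda>N. measure (M N) (cyl S)) \<longlonglongrightarrow> measure \<nu> (cyl S)"
    and inf: "AE T in \<nu>. \<forall>r. level r T \<noteq> {}"
  shows "weak_conv_trees M \<nu>"
  unfolding weak_conv_trees_def
proof (intro allI impI, elim conjE exE)
  fix f B assume f: "continuous_map tree_top euclideanreal f" and B: "\<forall>T\<in>Trees. \<bar>f T\<bar> \<le> B"
  interpret \<nu>: prob_space \<nu> by fact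
  have B0: "B \<ge> 0" using B edge_tree_Trees_fin Trees_fin_D(1) abs_ge_zero order.trans by blast
  have fm[measurable]: "f \<in> borel_measurable tree_borel" by (rule continuous_map_tree_measurable[OF f])
  show "(\<lambda>N. integral\<^sup>L (M N) f) \<longlonglongrightarrow> integral\<^sup>L \<nu> f"
  proof (rule tendstoI)
    fix \<epsilon>' :: real assume "\<epsilon>' > 0"
    \<comment> \<open>The final error is below (3 + 2 B) \<epsilon>, hence below 4 (B + 1)
      \<epsilon>.\<close>
    define \<epsilon> where "\<epsilon> = \<epsilon>' / (4 * (B + 1))"
    have \<epsilon>: "\<epsilon> > 0" using \<open>\<epsilon>' > 0\<close> B0 by (simp add: \<epsilon>_def)
    \<comment> \<open>The finite tree \<open>S\<close> lies in its own cylinder, so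
      \<open>f S\<close> serves as the reference value there.\<close>
    define Good where "Good r = {S \<in> Trees_fin. height S = r \<and> (\<forall>T\<in>cyl S. \<bar>f T - f S\<bar> \<le> \<epsilon>)}" for r
    have count: "countable (Good r)" for r
      by (rule countable_subset[OF _ countable_Trees_fin]) (auto simp: Good_def)
    define U where "U r = (\<Union>S\<in>Good r. cyl S)" for r
    have U_sets: "U r \<in> sets tree_borel" for r
      unfolding U_def by (intro sets.countable_UN' count) (auto simp: Good_def cyl_in_sets)
    \<comment> \<open>\<open>U\<close> need not be monotone, as trees of height below s are missing
      from \<open>U s\<close>. Intersecting over all s \<ge> r gives an increasing family.\<close>
    define A where "A r = (\<Inter>s\<in>{r..}. U s)" for r
    have A_sets: "A r \<in> sets \<nu>" for r
      unfolding A_def \<nu>(2) by (intro sets.countable_INT') (use U_sets in auto)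
    have "incseq A" by (auto simp: A_def incseq_def)
    have "AE T in \<nu>. T \<in> (\<Union>r. A r)"
      using inf AE_space
    proof eventually_elim
      case (elim T)
      then have T: "T \<in> Trees" using \<nu>(2) space_tree_borel sets_eq_imp_space_eq by blast
      obtain r where r: "r \<ge> 1" "\<forall>T'\<in>Trees. ball_tree r T' = ball_tree r T \<longrightarrow> \<bar>f T' - f T\<bar> < \<epsilon> / 2"
        using continuous_map_tree_ball[OF f T, of "\<epsilon> / 2"] \<epsilon> by auto
      have "T \<in> U s" if s: "s \<ge> r" for s
      proof -
        let ?S = "ball_tree s T"
        have S: "?S \<in> Trees_fin" "height ?S = s"
          using s r elim(1) T by (auto intro!: ball_tree_in_Trees_fin height_ball_tree)
        have close: "\<bar>f T' - f T\<bar> < \<epsilon> / 2" if "T' \<in> Trees" "ball_tree s T' = ?S" for T'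
          using r(2) ball_tree_mono_eq[OF that(2) s] that(1) by blast
        have "\<bar>f T' - f ?S\<bar> \<le> \<epsilon>" if "T' \<in> cyl ?S" for T'
        proof -
          have "\<bar>f T' - f T\<bar> < \<epsilon> / 2" using that S(2) by (intro close) (auto simp: cyl_def)
          moreover have "\<bar>f ?S - f T\<bar> < \<epsilon> / 2"
            using S(1) by (intro close) (auto simp: Trees_fin_D ball_tree_ball_tree)
          ultimately show ?thesis by linarith
        qed
        then have "?S \<in> Good s" using S by (simp add: Good_def)
        moreover have "T \<in> cyl ?S" using T S(2) by (simp add: cyl_def)
        ultimately show ?thesis unfolding U_def by blast
      qed
      then show ?case by (auto simp: A_def)
    qed
    then have "\<nu>.prob (\<Union>r. A r) = 1"
      using A_sets by (intro \<nu>.prob_eq_1[THEN iffD2]) auto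
    moreover have "(\<lambda>r. \<nu>.prob (A r)) \<longlonglongrightarrow> \<nu>.prob (\<Union>r. A r)"
      using A_sets \<open>incseq A\<close> by (intro \<nu>.finite_Lim_measure_incseq) auto
    ultimately have "\<forall>\<^sub>F r in sequentially. \<nu>.prob (A r) > 1 - \<epsilon>"
      using \<epsilon> by (intro order_tendstoD) auto
    then obtain r where "\<nu>.prob (A r) > 1 - \<epsilon>" by (auto simp: eventually_sequentially)
    also have "\<nu>.prob (A r) \<le> \<nu>.prob (U r)"
      using U_sets \<nu>(2) by (intro \<nu>.finite_measure_mono) (auto simp: A_def)
    finally have Ur: "\<nu>.prob (U r) > 1 - \<epsilon>" .
    have disj: "cyl S \<inter> cyl S' = {}" if "S \<in> Good r" "S' \<in> Good r" "S \<noteq> S'" for S S'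
      using that by (auto simp: Good_def cyl_def)
    \<comment> \<open>Convergence of masses is known for single cylinders, so it carries over only
      to finite unions.\<close>
    obtain F where F: "finite F" "F \<subseteq> Good r" "\<nu>.prob (\<Union>S\<in>F. cyl S) > 1 - \<epsilon>"
    proof (cases "finite (Good r)")
      case True
      then show ?thesis using Ur that[of "Good r"] by (simp add: U_def)
    next
      case False
      define e where "e = from_nat_into (Good r)"
      have bij: "bij_betw e UNIV (Good r)" unfolding e_def by (rule bij_betw_from_nat_into[OF count False])
      define V where "V n = (\<Union>i\<in>{..<n}. cyl (e i))" for n
      have eG: "e i \<in> Good r" for i using bij by (auto simp: bij_betw_def)
      then have V: "V n \<in> sets \<nu>" for n
        unfolding V_def \<nu>(2) by (intro sets.finite_UN cyl_in_sets) (auto simp: Good_def)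
      have "(\<Union>n. V n) = (\<Union>i. cyl (e i))" by (auto simp: V_def)
      also have "\<dots> = (\<Union>S\<in>range e. cyl S)" by simp
      also have "range e = Good r" using bij by (simp add: bij_betw_def)
      also have "(\<Union>S\<in>Good r. cyl S) = U r" by (simp add: U_def)
      finally have UV: "(\<Union>n. V n) = U r" .
      have "incseq V" unfolding V_def incseq_def by (intro allI impI UN_mono) auto
      then have "(\<lambda>n. \<nu>.prob (V n)) \<longlonglongrightarrow> \<nu>.prob (\<Union>n. V n)"
        using V by (intro \<nu>.finite_Lim_measure_incseq) auto
      then have "\<forall>\<^sub>F n in sequentially. \<nu>.prob (V n) > 1 - \<epsilon>"
        using Ur unfolding UV by (intro order_tendstoD) auto
      then obtain n where "\<nu>.prob (V n) > 1 - \<epsilon>" by (auto simp: eventually_sequentially)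
      then show ?thesis using eG that[of "e ` {..<n}"] by (auto simp: V_def)
    qed
    have F_fin: "S \<in> Trees_fin" if "S \<in> F" for S using that F(2) by (auto simp: Good_def)
    define W where "W = (\<Union>S\<in>F. cyl S)"
    have W_sets: "W \<in> sets tree_borel" unfolding W_def using F(1) F_fin by (intro sets.finite_UN cyl_in_sets) auto
    define g where "g T = (\<Sum>S\<in>F. f S * indicator (cyl S) T)" for T
    have g_bound: "\<bar>f T - g T\<bar> \<le> \<epsilon> + B * indicator (Trees - W) T" if T: "T \<in> Trees" for T
    proof (cases "T \<in> W")
      case True
      then obtain S where S: "S \<in> F" "T \<in> cyl S" by (auto simp: W_def)
      have "g T = (\<Sum>S'\<in>{S}. f S' * indicator (cyl S') T)"
        unfolding g_def using F(1,2) S disj by (intro sum.mono_neutral_right) (auto simp: indicator_def)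
      then have "g T = f S" using S by simp
      then show ?thesis using S F(2) True by (auto simp: Good_def)
    next
      case False
      then have "g T = 0" unfolding g_def W_def by (auto simp: indicator_def)
      then show ?thesis using False T B \<epsilon> by (auto simp: indicator_def intro: order.trans)
    qed
    \<comment> \<open>Stated for any \<open>P\<close> because it is applied both to \<nu> and to the
      measures \<open>M N\<close>.\<close>
    have approx: "\<bar>integral\<^sup>L P f - (\<Sum>S\<in>F. f S * measure P (cyl S))\<bar> \<le> \<epsilon> + B * (1 - measure P W)"
      "measure P W = (\<Sum>S\<in>F. measure P (cyl S))"
      if P: "prob_space P" "sets P = sets tree_borel" for P
    proof -
      interpret P: prob_space P by fact
      have sp: "space P = Trees" using P(2) space_tree_borel sets_eq_imp_space_eq by blast
      have cyl_P: "cyl S \<in> sets P" if "S \<in> F" for S using that F_fin cyl_in_sets P(2) by simp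
      have W_P: "W \<in> sets P" using W_sets P(2) by simp
      have compl_W: "Trees - W \<in> sets P" using sets.compl_sets[OF W_P] sp by simp
      have f_P: "f \<in> borel_measurable P" using fm measurable_cong_sets[OF P(2) refl] by blast
      have int_f: "integrable P f"
        using B by (intro P.integrable_const_bound[of _ B] f_P) (auto simp: sp intro!: AE_I2)
      have int_i: "integrable P (indicator A :: _ \<Rightarrow> real)" if "A \<in> sets P" for A
        using that by (intro integrable_real_indicator) (auto simp: P.emeasure_eq_measure)
      have int_c: "integrable P (\<lambda>T. f S * indicator (cyl S) T)" if "S \<in> F" for S
        by (intro integrable_mult_right int_i cyl_P that)
      have int_g: "integrable P g" unfolding g_def by (intro Bochner_Integration.integrable_sum int_c)
      have "integral\<^sup>L P g = (\<Sum>S\<in>F. f S * measure P (cyl S))"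
        unfolding g_def using int_c cyl_P
        by (subst Bochner_Integration.integral_sum) (auto intro!: sum.cong simp: P.emeasure_eq_measure)
      then have "\<bar>integral\<^sup>L P f - (\<Sum>S\<in>F. f S * measure P (cyl S))\<bar> = \<bar>\<integral>T. f T - g T \<partial>P\<bar>"
        using int_f int_g by simp
      also have "\<dots> \<le> (\<integral>T. \<bar>f T - g T\<bar> \<partial>P)" by (rule integral_abs_bound)
      also have "\<dots> \<le> (\<integral>T. \<epsilon> + B * indicator (Trees - W) T \<partial>P)"
      proof (rule integral_mono)
        show "integrable P (\<lambda>T. \<bar>f T - g T\<bar>)"
          by (intro integrable_abs Bochner_Integration.integrable_diff int_f int_g)
        show "integrable P (\<lambda>T. \<epsilon> + B * indicator (Trees - W) T)"
          by (intro Bochner_Integration.integrable_add P.integrable_const integrable_mult_right int_i compl_W)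
      qed (use g_bound sp in auto)
      also have "\<dots> = (\<integral>T. \<epsilon> \<partial>P) + (\<integral>T. B * indicator (Trees - W) T \<partial>P)"
        by (intro Bochner_Integration.integral_add P.integrable_const integrable_mult_right int_i compl_W)
      also have "(\<integral>T. \<epsilon> \<partial>P) = \<epsilon>" by (simp add: P.prob_space)
      also have "(\<integral>T. B * indicator (Trees - W) T \<partial>P) = B * measure P (Trees - W)"
        using sets.Int_space_eq2[OF compl_W] by simp
      also have "measure P (Trees - W) = 1 - measure P W"
        using P.prob_compl[OF W_P] sp by simp
      finally show "\<bar>integral\<^sup>L P f - (\<Sum>S\<in>F. f S * measure P (cyl S))\<bar> \<le> \<epsilon> + B * (1 - measure P W)" .
      show "measure P W = (\<Sum>S\<in>F. measure P (cyl S))"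
      proof -
        have "disjoint_family_on cyl F" unfolding disjoint_family_on_def using disj F(2) by blast
        then show ?thesis
          unfolding W_def using F(1) cyl_P by (intro P.finite_measure_finite_Union) auto
      qed
    qed
    have lim1: "(\<lambda>N. \<Sum>S\<in>F. f S * measure (M N) (cyl S)) \<longlonglongrightarrow> (\<Sum>S\<in>F. f S * measure \<nu> (cyl S))"
      by (intro tendsto_sum tendsto_mult_left lim F_fin)
    have "(\<lambda>N. \<Sum>S\<in>F. measure (M N) (cyl S)) \<longlonglongrightarrow> (\<Sum>S\<in>F. measure \<nu> (cyl S))"
      by (intro tendsto_sum lim F_fin)
    moreover have "(\<Sum>S\<in>F. measure \<nu> (cyl S)) > 1 - \<epsilon>"
      using F(3) approx(2)[OF \<nu>] by (simp add: W_def)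
    ultimately have ev1: "\<forall>\<^sub>F N in sequentially. (\<Sum>S\<in>F. measure (M N) (cyl S)) > 1 - \<epsilon>"
      by (rule order_tendstoD)
    have ev2: "\<forall>\<^sub>F N in sequentially. \<bar>(\<Sum>S\<in>F. f S * measure (M N) (cyl S)) - (\<Sum>S\<in>F. f S * measure \<nu> (cyl S))\<bar> < \<epsilon>"
      using tendstoD[OF lim1 \<epsilon>] by (simp add: dist_real_def)
    show "\<forall>\<^sub>F N in sequentially. dist (integral\<^sup>L (M N) f) (integral\<^sup>L \<nu> f) < \<epsilon>'"
      using M ev1 ev2
    proof eventually_elim
      case (elim N)
      have "\<bar>integral\<^sup>L (M N) f - (\<Sum>S\<in>F. f S * measure (M N) (cyl S))\<bar> \<le> \<epsilon> + B * (1 - measure (M N) W)"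
        "measure (M N) W = (\<Sum>S\<in>F. measure (M N) (cyl S))" using elim approx[of "M N"] by auto
      moreover have "B * (1 - measure (M N) W) \<le> B * \<epsilon>" "B * (1 - measure \<nu> W) \<le> B * \<epsilon>"
        using elim calculation(2) F(3) B0 by (auto intro!: mult_left_mono simp: W_def)
      ultimately have "\<bar>integral\<^sup>L (M N) f - integral\<^sup>L \<nu> f\<bar> < 3 * \<epsilon> + 2 * (B * \<epsilon>)"
        using approx(1)[OF \<nu>] elim(3) by linarith
      also have "\<dots> \<le> 4 * (B + 1) * \<epsilon>" using \<epsilon> B0 by (simp add: algebra_simps)
      also have "\<dots> = \<epsilon>'" using B0 by (simp add: \<epsilon>_def)
      finally show ?case by (simp add: dist_real_def)
    qed
  qed
qed

section \<open>The limit measure\<close>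

lemma negative_binomial_sums:
  fixes x :: real
  assumes "n \<ge> 1" "\<bar>x\<bar> < 1"
  shows "(\<lambda>i. real ((n + i - 1) choose i) * x ^ i) sums (1 / (1 - x) ^ n)"
proof -
  have "(\<lambda>i. (- real n gchoose i) * (- x) ^ i) sums (1 + - x) powr (- real n)"
    using assms by (intro gen_binomial_real) auto
  moreover have "(- real n gchoose i) * (- x) ^ i = real ((n + i - 1) choose i) * x ^ i" for i
  proof -
    have n: "real n + real i - 1 = real (n + i - 1)" using assms by (simp add: of_nat_diff)
    have sign: "(- 1 :: real) ^ i * (- x) ^ i = x ^ i" by (simp add: power_mult_distrib[symmetric])
    have "(- real n gchoose i) * (- x) ^ i = (real (n + i - 1) gchoose i) * ((- 1) ^ i * (- x) ^ i)"
      unfolding gbinomial_minus n by (simp only: mult_ac)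
    then show ?thesis
      unfolding sign by (simp only: binomial_gbinomial)
  qed
  moreover have "(1 + - x) powr (- real n) = 1 / (1 - x) ^ n"
    using assms by (simp add: powr_minus powr_realpow divide_inverse)
  ultimately show ?thesis by simp
qed

text \<open>With n = K + j - 1, C(n, j) C(j, R) = C(n, j - R) C(K + R - 1, R). The last factor does
  not depend on j, and what remains is a negative binomial series at 1/2 with exponent K +
  R.\<close>

lemma choose_product_sums:
  assumes "K \<ge> 1"
  shows "(\<lambda>j. real ((K + j - 1) choose j) * real (j choose R) * (1 / 2) ^ j)
    sums (real ((K + R - 1) choose R) * 2 ^ K)"
proof -
  have "(\<lambda>i. real ((K + R - 1) choose R) * (1 / 2) ^ R * (real ((K + R + i - 1) choose i) * (1 / 2) ^ i))
    sums (real ((K + R - 1) choose R) * (1 / 2) ^ R * (1 / (1 - 1 / 2) ^ (K + R)))"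
    using assms by (intro sums_mult negative_binomial_sums) auto
  also have "real ((K + R - 1) choose R) * (1 / 2) ^ R * (1 / (1 - 1 / 2) ^ (K + R)) = real ((K + R - 1) choose R) * 2 ^ K"
    by (simp add: power_add power_divide)
  also have "(\<lambda>i. real ((K + R - 1) choose R) * (1 / 2) ^ R * (real ((K + R + i - 1) choose i) * (1 / 2) ^ i))
     = (\<lambda>i. real ((K + (i + R) - 1) choose (i + R)) * real ((i + R) choose R) * (1 / 2) ^ (i + R))"
  proof
    fix i
    let ?n = "K + R + i - 1"
    have "(?n choose (i + R)) * ((i + R) choose i) = (?n choose i) * ((?n - i) choose (i + R - i))"
      using assms by (intro choose_mult) auto
    moreover have "(i + R) choose i = (i + R) choose R" by (subst binomial_symmetric) auto
    moreover have "?n - i = K + R - 1" "K + (i + R) - 1 = ?n" using assms by auto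
    ultimately have "((K + (i + R) - 1) choose (i + R)) * ((i + R) choose R) = (?n choose i) * ((K + R - 1) choose R)"
      by simp
    then have "real ((K + (i + R) - 1) choose (i + R)) * real ((i + R) choose R)
       = real (?n choose i) * real ((K + R - 1) choose R)"
      by (metis of_nat_mult)
    then show "real ((K + R - 1) choose R) * (1 / 2) ^ R * (real ((K + R + i - 1) choose i) * (1 / 2) ^ i)
      = real ((K + (i + R) - 1) choose (i + R)) * real ((i + R) choose R) * (1 / 2) ^ (i + R)"
      by (simp add: power_add mult_ac)
  qed
  finally show ?thesis
    by (subst (asm) sums_zero_iff_shift) auto
qed

lemma branch_poly_alt:
  assumes "K \<le> n"
  shows "branch_poly \<mu> K = (\<Sum>t<n. real (K choose Suc t) * \<mu> ^ t / fact t)"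
proof -
  have "branch_poly \<mu> K = (\<Sum>t<K. real (K choose Suc t) * \<mu> ^ t / fact t)"
    unfolding branch_poly_def by (rule sum.reindex_bij_witness[of _ Suc "\<lambda>R. R - 1"]) auto
  also have "\<dots> = (\<Sum>t<n. real (K choose Suc t) * \<mu> ^ t / fact t)"
    using assms by (intro sum.mono_neutral_left) auto
  finally show ?thesis .
qed

text \<open>Vandermonde splits C(K + t, t + 1) into products C(K, s + 1) C(t, s), which makes the
  series a Cauchy product of \<open>branch_poly\<close> with the exponential series. Only s < K
  contributes, so just a finite sum is interchanged with the series.\<close>

lemma choose_exp_sums: "(\<lambda>t. real ((K + t) choose Suc t) * \<mu> ^ t / fact t) sums (exp \<mu> * branch_poly \<mu> K)"
proof -
  let ?a = "\<lambda>s. real (K choose Suc s) * \<mu> ^ s / fact s"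
  let ?b = "\<lambda>s t. if s \<le> t then \<mu> ^ (t - s) / fact (t - s) else 0"
  have exp: "(\<lambda>t. ?b s t) sums exp \<mu>" for s
  proof -
    have "(\<lambda>t. \<mu> ^ t / fact t) sums exp \<mu>"
      using exp_converges[of \<mu>] by (simp add: divide_inverse mult.commute)
    then have "(\<lambda>t. if s \<le> t + s then \<mu> ^ (t + s - s) / fact (t + s - s) else 0) sums exp \<mu>" by simp
    then show ?thesis by (subst (asm) sums_zero_iff_shift) auto
  qed
  have "(\<lambda>t. \<Sum>s<K. ?a s * ?b s t)
    sums (\<Sum>s<K. ?a s * exp \<mu>)"
    by (intro sums_sum sums_mult exp)
  also have "(\<Sum>s<K. ?a s * exp \<mu>) = exp \<mu> * branch_poly \<mu> K"
    unfolding branch_poly_alt[OF le_refl] sum_distrib_left by (intro sum.cong refl) simp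
  also have "(\<lambda>t. \<Sum>s<K. ?a s * ?b s t)
     = (\<lambda>t. real ((K + t) choose Suc t) * \<mu> ^ t / fact t)"
  proof
    fix t
    have "real ((K + t) choose Suc t) = (\<Sum>R\<le>Suc t. real (K choose R) * real (t choose (Suc t - R)))"
      unfolding vandermonde[symmetric] by simp
    also have "\<dots> = (\<Sum>s\<le>t. real (K choose Suc s) * real (t choose (t - s)))"
      unfolding sum.atMost_Suc_shift by simp
    also have "\<dots> = (\<Sum>s\<le>t. real (K choose Suc s) * (fact t / (fact s * fact (t - s))))"
      by (intro sum.cong refl) (simp add: binomial_fact binomial_symmetric[symmetric])
    finally have "real ((K + t) choose Suc t) * \<mu> ^ t / fact t
       = (\<Sum>s\<le>t. real (K choose Suc s) * (fact t / (fact s * fact (t - s))) * \<mu> ^ t / fact t)"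
      by (simp only: sum_distrib_right sum_divide_distrib)
    also have "\<dots> = (\<Sum>s\<le>t. ?a s * (\<mu> ^ (t - s) / fact (t - s)))"
    proof (intro sum.cong refl)
      fix s assume "s \<in> {..t}"
      then have "\<mu> ^ t = \<mu> ^ s * \<mu> ^ (t - s)" by (simp add: power_add[symmetric])
      then show "real (K choose Suc s) * (fact t / (fact s * fact (t - s))) * \<mu> ^ t / fact t
        = ?a s * (\<mu> ^ (t - s) / fact (t - s))" by simp
    qed
    also have "\<dots> = (\<Sum>s\<in>{..t} \<inter> {..<K}. ?a s * (\<mu> ^ (t - s) / fact (t - s)))"
      by (intro sum.mono_neutral_right) (auto simp: not_less)
    also have "\<dots> = (\<Sum>s<K. ?a s * ?b s t)"
      by (intro sum.mono_neutral_cong_left) auto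
    finally show "(\<Sum>s<K. ?a s * ?b s t)
      = real ((K + t) choose Suc t) * \<mu> ^ t / fact t" by simp
  qed
  finally show ?thesis .
qed

section \<open>Consistency of the cylinder weights\<close>

context height_coupling
begin

lemma branch_poly_pos:
  assumes "K \<ge> 1"
  shows "branch_poly \<mu> K > 0"
proof -
  have "(\<Sum>R\<in>{1}. real (K choose R) * \<mu> ^ (R - 1) / fact (R - 1)) \<le> branch_poly \<mu> K"
    unfolding branch_poly_def using assms \<mu>_pos by (intro sum_mono2) auto
  then show ?thesis using assms by simp
qed

lemma branch_poly_0: "branch_poly \<mu> 0 = 0"
  by (simp add: branch_poly_def)

lemma branch_poly_nonneg: "branch_poly \<mu> K \<ge> 0"
  using branch_poly_pos[of K] branch_poly_0 by (cases K) auto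

text \<open>All terms are nonnegative, so the sums over j and t can be exchanged in the extended
  reals; the inner one is \<open>choose_product_sums\<close>, the outer one
  \<open>choose_exp_sums\<close>. The factor \<open>exp \<mu>\<close> is what one more level costs
  in \<open>cyl_formula\<close>.\<close>

lemma offspring_normalization:
  assumes K: "K \<ge> 1"
  shows "(\<Sum>j. ennreal (real ((K + j - 1) choose j) * (1 / 2) ^ j * branch_poly \<mu> j)) = ennreal (exp \<mu> * 2 ^ K * branch_poly \<mu> K)"
proof -
  let ?f = "\<lambda>t j. real ((K + j - 1) choose j) * real (j choose Suc t) * (1 / 2) ^ j * (\<mu> ^ t / fact t)"
  have nonneg: "0 \<le> ?f t j" for t j using \<mu>_pos by simp
  have "ennreal (real ((K + j - 1) choose j) * (1 / 2) ^ j * branch_poly \<mu> j) = (\<Sum>t. ennreal (?f t j))" for j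
  proof -
    have "(\<lambda>t. ?f t j) sums (\<Sum>t<j. ?f t j)"
      by (intro sums_finite) auto
    then have "(\<Sum>t. ennreal (?f t j)) = ennreal (\<Sum>t<j. ?f t j)"
      using nonneg by (intro suminf_ennreal_eq)
    also have "(\<Sum>t<j. ?f t j) = real ((K + j - 1) choose j) * (1 / 2) ^ j * branch_poly \<mu> j"
      unfolding branch_poly_alt[OF le_refl] sum_distrib_left by (intro sum.cong refl) simp
    finally show ?thesis by simp
  qed
  then have "(\<Sum>j. ennreal (real ((K + j - 1) choose j) * (1 / 2) ^ j * branch_poly \<mu> j))
    = (\<integral>\<^sup>+j. (\<Sum>t. ennreal (?f t j)) \<partial>count_space UNIV)"
    by (simp add: nn_integral_count_space_nat)
  also have "\<dots> = (\<Sum>t. \<integral>\<^sup>+j. ennreal (?f t j) \<partial>count_space UNIV)"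
    by (intro nn_integral_suminf) auto
  also have "\<dots> = (\<Sum>t. ennreal (real ((K + t) choose Suc t) * 2 ^ K * (\<mu> ^ t / fact t)))"
  proof (intro suminf_cong)
    fix t
    have "(\<lambda>j. ?f t j) sums (real ((K + Suc t - 1) choose Suc t) * 2 ^ K * (\<mu> ^ t / fact t))"
      by (intro sums_mult2 choose_product_sums K)
    then show "(\<integral>\<^sup>+j. ennreal (?f t j) \<partial>count_space UNIV) = ennreal (real ((K + t) choose Suc t) * 2 ^ K * (\<mu> ^ t / fact t))"
      unfolding nn_integral_count_space_nat by (intro suminf_ennreal_eq nonneg) simp
  qed
  also have "\<dots> = ennreal (exp \<mu> * 2 ^ K * branch_poly \<mu> K)"
  proof (rule suminf_ennreal_eq)
    show "0 \<le> real ((K + t) choose Suc t) * 2 ^ K * (\<mu> ^ t / fact t)" for t using \<mu>_pos by simp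
    show "(\<lambda>t. real ((K + t) choose Suc t) * 2 ^ K * (\<mu> ^ t / fact t)) sums (exp \<mu> * 2 ^ K * branch_poly \<mu> K)"
      using sums_mult[OF choose_exp_sums[of K \<mu>], of "2 ^ K"] by (simp add: mult_ac)
  qed
  finally show ?thesis .
qed

text \<open>Only trees that really grow: stopping is excluded, and no mass is lost by that since
  \<open>branch_poly \<mu> 0 = 0\<close>.\<close>

definition next_trees :: "nat list set \<Rightarrow> nat list set set" where
  "next_trees T = {T1 \<in> Trees_fin. height T1 = Suc (height T) \<and> ball_tree (height T) T1 = T}"

lemma extensions_eq_next_trees:
  assumes "j \<ge> 1"
  shows "extensions (height T) T j = {T1 \<in> next_trees T. card (level (Suc (height T)) T1) = j}"
proof -
  have "height T1 = Suc (height T)"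
    if "T1 \<in> Trees_fin" "\<forall>v\<in>T1. length v \<le> Suc (height T)" "card (level (Suc (height T)) T1) = j" for T1
  proof (rule antisym)
    show "height T1 \<le> Suc (height T)" using that by (simp add: height_le_iff)
    have "level (Suc (height T)) T1 \<noteq> {}" using that assms by auto
    then obtain v where "v \<in> level (Suc (height T)) T1" by blast
    then show "Suc (height T) \<le> height T1"
      using height_le_iff[OF that(1), of "height T1"] by (auto simp: mem_level)
  qed
  moreover have "\<forall>v\<in>T1. length v \<le> Suc (height T)" if "T1 \<in> Trees_fin" "height T1 = Suc (height T)" for T1
    using height_le_iff[OF that(1), of "Suc (height T)"] that(2) by simp
  ultimately show ?thesis
    unfolding extensions_def next_trees_def by blast
qed

lemma card_level_next_tree:
  assumes "T1 \<in> next_trees T"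
  shows "card (level (Suc (height T)) T1) \<ge> 1"
proof -
  have "T1 \<in> Trees_fin" "height T1 = Suc (height T)" using assms by (auto simp: next_trees_def)
  then show ?thesis using card_level_height(1)[of T1] by simp
qed

lemma cyl_formula_pos:
  assumes "T \<in> Trees_fin"
  shows "cyl_formula \<mu> T > 0"
  unfolding cyl_formula_eq using card_level_height(1)[OF assms]
  by (intro mult_pos_pos branch_poly_pos) auto

lemma cyl_formula_extension:
  assumes T: "T \<in> Trees_fin" and "j \<ge> 1" and T1: "T1 \<in> extensions (height T) T j"
  shows "cyl_formula \<mu> T1 = exp (- \<mu> * real (height T)) * (1 / 4) ^ edges T * 2 * ((1 / 2) ^ j * branch_poly \<mu> j)"
proof -
  have n: "T1 \<in> next_trees T" "card (level (Suc (height T)) T1) = j"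
    using T1 unfolding extensions_eq_next_trees[OF assms(2)] by auto
  then have h: "height T1 = Suc (height T)" "T1 \<in> Trees_fin" by (auto simp: next_trees_def)
  have "edges T1 = edges T + j"
    using card_extension[OF T1] card_eq_Suc_edges[OF T] card_eq_Suc_edges[OF h(2)] by simp
  moreover have "(1 / 4 :: real) ^ j * 2 ^ j = (1 / 2) ^ j" by (simp add: power_mult_distrib[symmetric])
  ultimately show ?thesis
    unfolding cyl_formula_eq h n(2) by (simp add: power_add)
qed

lemma next_trees_total:
  assumes T: "T \<in> Trees_fin"
  shows "(\<integral>\<^sup>+T1. ennreal (cyl_formula \<mu> T1) * indicator (next_trees T) T1 \<partial>count_space UNIV) = ennreal (cyl_formula \<mu> T)"
proof -
  define r where "r = height T"
  define K where "K = card (level r T)"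
  define C where "C = exp (- \<mu> * real r) * (1 / 4) ^ edges T * 2"
  have C: "C \<ge> 0" by (simp add: C_def)
  have K: "K \<ge> 1" unfolding K_def r_def by (rule card_level_height(1)[OF T])
  have len: "\<forall>v\<in>T. length v \<le> r" using height_le_iff[OF T, of r] by (simp add: r_def)
  have r: "r \<ge> 1" using height_ge_1[OF T] by (simp add: r_def)
  \<comment> \<open>The density turns the sum over a countable disjoint union into countable
    additivity.\<close>
  define D where "D = density (count_space UNIV) (\<lambda>T1. ennreal (cyl_formula \<mu> T1))"
  define E where "E j = (if j = 0 then {} else extensions r T j)" for j
  have E: "next_trees T = (\<Union>j. E j)"
  proof (intro set_eqI iffI)
    fix T1 assume T1: "T1 \<in> next_trees T"
    have "T1 \<in> E (card (level (Suc r) T1))"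
      using T1 card_level_next_tree[OF T1]
      by (simp add: E_def r_def extensions_eq_next_trees)
    then show "T1 \<in> (\<Union>j. E j)" by blast
  next
    fix T1 assume "T1 \<in> (\<Union>j. E j)"
    then obtain j where j: "T1 \<in> E j" by blast
    then have "j \<ge> 1" "T1 \<in> extensions (height T) T j" by (auto simp: E_def r_def split: if_splits)
    then show "T1 \<in> next_trees T" using extensions_eq_next_trees[of j T] by simp
  qed
  have "(\<integral>\<^sup>+T1. ennreal (cyl_formula \<mu> T1) * indicator (next_trees T) T1 \<partial>count_space UNIV) = emeasure D (next_trees T)"
    unfolding D_def by (subst emeasure_density) auto
  also have "\<dots> = (\<Sum>j. emeasure D (E j))"
    unfolding E by (intro suminf_emeasure[symmetric]) (auto simp: D_def disjoint_family_on_def E_def extensions_def split: if_splits)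
  also have "\<dots> = (\<Sum>j. ennreal (C * (real ((K + j - 1) choose j) * (1 / 2) ^ j * branch_poly \<mu> j)))"
  proof (intro suminf_cong)
    fix j
    show "emeasure D (E j) = ennreal (C * (real ((K + j - 1) choose j) * (1 / 2) ^ j * branch_poly \<mu> j))"
    proof (cases "j = 0")
      case True
      then show ?thesis by (simp add: E_def branch_poly_0)
    next
      case False
      then have j: "j \<ge> 1" by simp
      have fin: "finite (extensions r T j)" and card: "card (extensions r T j) = (K + j - 1) choose j"
        using card_extensions[OF T len r, of j] by (auto simp: K_def)
      have "emeasure D (E j) = (\<integral>\<^sup>+T1. ennreal (cyl_formula \<mu> T1) * indicator (extensions r T j) T1 \<partial>count_space UNIV)"
        unfolding D_def using False by (subst emeasure_density) (auto simp: E_def)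
      also have "\<dots> = (\<Sum>T1\<in>extensions r T j. ennreal (cyl_formula \<mu> T1) * indicator (extensions r T j) T1)"
        using fin by (intro nn_integral_count_space') auto
      also have "\<dots> = (\<Sum>T1\<in>extensions r T j. ennreal (C * ((1 / 2) ^ j * branch_poly \<mu> j)))"
        using cyl_formula_extension[OF T j] by (intro sum.cong refl) (simp add: r_def C_def)
      also have "\<dots> = ennreal (real ((K + j - 1) choose j)) * ennreal (C * ((1 / 2) ^ j * branch_poly \<mu> j))"
        by (simp add: card ennreal_of_nat_eq_real_of_nat)
      also have "\<dots> = ennreal (real ((K + j - 1) choose j) * (C * ((1 / 2) ^ j * branch_poly \<mu> j)))"
        using C branch_poly_nonneg by (intro ennreal_mult[symmetric]) auto
      finally show ?thesis by (simp add: mult_ac)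
    qed
  qed
  also have "\<dots> = ennreal C * (\<Sum>j. ennreal (real ((K + j - 1) choose j) * (1 / 2) ^ j * branch_poly \<mu> j))"
    using C branch_poly_nonneg by (subst ennreal_suminf_cmult[symmetric]) (simp add: ennreal_mult)
  also have "\<dots> = ennreal (C * (exp \<mu> * 2 ^ K * branch_poly \<mu> K))"
    unfolding offspring_normalization[OF K] using C branch_poly_nonneg by (intro ennreal_mult[symmetric]) auto
  also have "C * (exp \<mu> * 2 ^ K * branch_poly \<mu> K) = cyl_formula \<mu> T"
  proof -
    have "exp (- \<mu> * real r) * exp \<mu> = exp (- \<mu> * (real r - 1))"
      by (simp add: exp_add[symmetric] algebra_simps)
    then show ?thesis
      unfolding cyl_formula_eq C_def K_def r_def[symmetric] by (simp add: mult_ac)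
  qed
  finally show ?thesis .
qed

end

section \<open>A random infinite tree grown from successors\<close>

lemma prod_telescope:
  fixes f :: "nat \<Rightarrow> real"
  assumes "n \<ge> 1" "\<And>i. i \<ge> 1 \<Longrightarrow> f i \<noteq> 0"
  shows "(\<Prod>i\<in>{1..<n}. f (Suc i) / f i) = f n / f 1"
  using assms(1)
proof (induction n rule: nat_induct_at_least)
  case base
  then show ?case using assms(2)[of 1] by simp
next
  case (Suc n)
  then show ?case using assms(2)[of n] by (simp add: prod.atLeastLessThan_Suc)
qed

text \<open>An assignment \<eta> names a successor for every finite tree; a tree S follows it if all
  its balls arise by iterating \<eta> from \<open>edge_tree\<close>.\<close>

definition follows :: "nat list set \<Rightarrow> (nat list set \<Rightarrow> nat list set) \<Rightarrow> bool" where
  "follows S \<eta> \<longleftrightarrow> (\<forall>i\<in>{1..<height S}. \<eta> (ball_tree i S) = ball_tree (Suc i) S)"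

definition never_stops :: "(nat list set \<Rightarrow> nat list set) \<Rightarrow> bool" where
  "never_stops \<eta> \<longleftrightarrow> (\<forall>n. \<exists>S\<in>{S \<in> Trees_fin. height S = Suc n}. follows S \<eta>)"

text \<open>The default keeps the value in \<open>Trees\<close> for every assignment; by
  \<open>AE_never_stops\<close> it is taken only on a null set.\<close>

definition limit_tree :: "(nat list set \<Rightarrow> nat list set) \<Rightarrow> nat list set" where
  "limit_tree \<eta> = (if never_stops \<eta> then \<Union>{S \<in> Trees_fin. follows S \<eta>} else edge_tree)"

lemma height_ball_le:
  assumes "S \<in> Trees_fin" "1 \<le> i" "i \<le> height S"
  shows "height (ball_tree i S) = i"
proof (rule height_ball_tree[OF Trees_fin_D(1)[OF assms(1)] assms(2)])
  show "level i S \<noteq> {}"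
    using level_empty_mono[OF Trees_fin_D(1)[OF assms(1)] _ assms(3)] level_height_nonempty[OF assms(1)] by blast
qed

text \<open>Both trees start from \<open>edge_tree\<close> and \<eta> determines every further ball,
  so the trees that follow \<eta> form a chain.\<close>

lemma follows_unique:
  assumes S: "S \<in> Trees_fin" "follows S \<eta>" and S': "S' \<in> Trees_fin" "follows S' \<eta>" and le: "height S \<le> height S'"
  shows "ball_tree (height S) S' = S"
proof -
  have "i \<le> height S \<longrightarrow> ball_tree i S = ball_tree i S'" if "i \<ge> 1" for i
    using that
  proof (induction i rule: nat_induct_at_least)
    case base
    show ?case using ball_tree_1[of S] ball_tree_1[of S'] S(1) S'(1) by (simp add: Trees_fin_D)
  next
    case (Suc i)
    show ?case
    proof
      assume i: "Suc i \<le> height S"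
      then have "ball_tree i S = ball_tree i S'" using Suc by simp
      moreover have "\<eta> (ball_tree i S) = ball_tree (Suc i) S" "\<eta> (ball_tree i S') = ball_tree (Suc i) S'"
        using S(2)[unfolded follows_def, rule_format, of i] S'(2)[unfolded follows_def, rule_format, of i]
          i le Suc.hyps by simp_all
      ultimately show "ball_tree (Suc i) S = ball_tree (Suc i) S'" by simp
    qed
  qed
  then have "ball_tree (height S) S = ball_tree (height S) S'"
    using height_ge_1[OF S(1)] by blast
  then show ?thesis using ball_tree_height_id[OF S(1), of "height S"] by simp
qed

lemma ball_tree_limit_tree:
  assumes "never_stops \<eta>" "S \<in> Trees_fin" "follows S \<eta>"
  shows "ball_tree (height S) (limit_tree \<eta>) = S"
proof (intro set_eqI iffI)
  fix v assume "v \<in> ball_tree (height S) (limit_tree \<eta>)"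
  then obtain S' where S': "S' \<in> Trees_fin" "follows S' \<eta>" "v \<in> S'" "length v \<le> height S"
    using assms(1) by (auto simp: limit_tree_def mem_ball_tree)
  show "v \<in> S"
  proof (cases "height S \<le> height S'")
    case True
    then show ?thesis using follows_unique[OF assms(2,3) S'(1,2)] S'(3,4) mem_ball_tree by blast
  next
    case False
    then show ?thesis using follows_unique[OF S'(1,2) assms(2,3)] S'(3) mem_ball_tree by (metis nat_le_linear)
  qed
next
  fix v assume "v \<in> S"
  then show "v \<in> ball_tree (height S) (limit_tree \<eta>)"
    using assms height_le_iff[OF assms(2), of "height S"] by (auto simp: limit_tree_def mem_ball_tree)
qed

lemma limit_tree_in_Trees: "limit_tree \<eta> \<in> Trees"
proof (cases "never_stops \<eta>")
  case False
  then show ?thesis using edge_tree_Trees_fin by (simp add: limit_tree_def Trees_fin_D)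
next
  case True
  then have L: "v \<in> limit_tree \<eta> \<longleftrightarrow> (\<exists>S. S \<in> Trees_fin \<and> follows S \<eta> \<and> v \<in> S)" for v
    by (auto simp: limit_tree_def)
  obtain S1 where S1: "S1 \<in> Trees_fin" "follows S1 \<eta>"
    using True unfolding never_stops_def by blast
  have "is_tree (limit_tree \<eta>)"
    unfolding is_tree_def
  proof (intro conjI allI impI ballI)
    show "[] \<in> limit_tree \<eta>" using S1 Trees_D(1)[OF Trees_fin_D(1)[OF S1(1)]] L by blast
    show "v \<in> limit_tree \<eta>" if "v @ [i] \<in> limit_tree \<eta>" for v i
      using that Trees_D(2)[OF Trees_fin_D(1)] unfolding L by blast
    show "v @ [j] \<in> limit_tree \<eta>" if "v @ [i] \<in> limit_tree \<eta> \<and> j < i" for v i j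
      using that Trees_D(3)[OF Trees_fin_D(1)] unfolding L by blast
    show "finite {i. v @ [i] \<in> limit_tree \<eta>}" for v
    proof -
      \<comment> \<open>Up to one level beyond v the union agrees with a single finite tree, which
        makes the set of children of v finite.\<close>
      obtain S where S: "S \<in> Trees_fin" "height S = Suc (length v)" "follows S \<eta>"
        using True unfolding never_stops_def by blast
      have "v @ [i] \<in> limit_tree \<eta> \<longleftrightarrow> v @ [i] \<in> S" for i
        using ball_tree_limit_tree[OF True S(1,3)] S(2) mem_ball_tree[of "v @ [i]" "Suc (length v)" "limit_tree \<eta>"]
        by simp
      then have "{i. v @ [i] \<in> limit_tree \<eta>} = (\<lambda>i. v @ [i]) -` S" by auto
      then show ?thesis using Trees_fin_D(2)[OF S(1)] by (simp add: finite_vimageI inj_def)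
    qed
    have "[i] \<in> limit_tree \<eta> \<longleftrightarrow> i = 0" for i
      using S1 Trees_D(5)[OF Trees_fin_D(1)] unfolding L by auto
    then show "{i. [i] \<in> limit_tree \<eta>} = {0}" by auto
  qed
  then show ?thesis by (simp add: Trees_def)
qed

lemma limit_tree_in_cyl_iff:
  assumes "never_stops \<eta>" "S \<in> Trees_fin"
  shows "limit_tree \<eta> \<in> cyl S \<longleftrightarrow> follows S \<eta>"
proof
  assume L: "limit_tree \<eta> \<in> cyl S"
  \<comment> \<open>\<open>never_stops\<close> speaks of heights of the form \<open>Suc n\<close>,
    and the height of \<open>S\<close> is at least 1.\<close>
  obtain S' where S': "S' \<in> Trees_fin" "height S' = Suc (height S - 1)" "follows S' \<eta>"
    using assms(1) unfolding never_stops_def by blast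
  then have h: "height S' = height S" using height_ge_1[OF assms(2)] by simp
  have "S' = S"
    using ball_tree_limit_tree[OF assms(1) S'(1,3)] L unfolding h by (simp add: cyl_def)
  then show "follows S \<eta>" using S'(3) by simp
next
  assume "follows S \<eta>"
  then show "limit_tree \<eta> \<in> cyl S"
    using ball_tree_limit_tree[OF assms] limit_tree_in_Trees by (simp add: cyl_def)
qed

lemma level_limit_tree:
  assumes "never_stops \<eta>"
  shows "level r (limit_tree \<eta>) \<noteq> {}"
proof -
  obtain S where S: "S \<in> Trees_fin" "height S = Suc r" "follows S \<eta>"
    using assms unfolding never_stops_def by blast
  have "level (Suc r) (limit_tree \<eta>) = level (Suc r) S"
    using level_ball_tree[of "Suc r" "Suc r" "limit_tree \<eta>"] ball_tree_limit_tree[OF assms S(1,3)] S(2) by simp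
  then have "level (Suc r) (limit_tree \<eta>) \<noteq> {}"
    using level_height_nonempty[OF S(1)] S(2) by simp
  then show ?thesis using level_empty_mono[OF limit_tree_in_Trees, of r \<eta> "Suc r"] by auto
qed

context height_coupling
begin

lemma cyl_formula_edge_tree: "cyl_formula \<mu> edge_tree = 1"
  by (simp add: cyl_formula_eq height_edge_tree level_edge_tree[unfolded One_nat_def] edges_edge_tree branch_poly_def)

text \<open>Transition probabilities are quotients of cylinder weights, and
  \<open>next_trees_total\<close> makes them sum to 1. Outside \<open>Trees_fin\<close> the value is
  some pmf about which nothing is claimed, which still allows a product over all arguments.\<close>

definition offspring :: "nat list set \<Rightarrow> nat list set pmf" where
  "offspring T = embed_pmf (\<lambda>T1. cyl_formula \<mu> T1 * indicator (next_trees T) T1 / cyl_formula \<mu> T)"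

lemma pmf_offspring:
  assumes T: "T \<in> Trees_fin"
  shows "pmf (offspring T) T1 = cyl_formula \<mu> T1 * indicator (next_trees T) T1 / cyl_formula \<mu> T"
  unfolding offspring_def
proof (rule pmf_embed_pmf)
  let ?F = "cyl_formula \<mu> T"
  have F: "?F > 0" by (rule cyl_formula_pos[OF T])
  have pos: "cyl_formula \<mu> T1 * indicator (next_trees T) T1 \<ge> 0" for T1
    using cyl_formula_pos[of T1] by (auto simp: indicator_def next_trees_def)
  then show "0 \<le> cyl_formula \<mu> T1 * indicator (next_trees T) T1 / ?F" for T1
    using F by simp
  have "(\<integral>\<^sup>+T1. ennreal (cyl_formula \<mu> T1 * indicator (next_trees T) T1 / ?F) \<partial>count_space UNIV)
      = (\<integral>\<^sup>+T1. ennreal (cyl_formula \<mu> T1) * indicator (next_trees T) T1 * ennreal (1 / ?F) \<partial>count_space UNIV)"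
  proof (intro nn_integral_cong)
    fix T1
    show "ennreal (cyl_formula \<mu> T1 * indicator (next_trees T) T1 / ?F)
       = ennreal (cyl_formula \<mu> T1) * indicator (next_trees T) T1 * ennreal (1 / ?F)"
    proof (cases "T1 \<in> next_trees T")
      case True
      then have "cyl_formula \<mu> T1 > 0" using cyl_formula_pos[of T1] by (simp add: next_trees_def)
      then show ?thesis using True F by (simp add: ennreal_mult[symmetric])
    qed simp
  qed
  also have "\<dots> = (\<integral>\<^sup>+T1. ennreal (cyl_formula \<mu> T1) * indicator (next_trees T) T1 \<partial>count_space UNIV) * ennreal (1 / ?F)"
    by (rule nn_integral_multc) simp
  also have "\<dots> = ennreal (?F * (1 / ?F))"
    unfolding next_trees_total[OF T] using F by (intro ennreal_mult[symmetric]) auto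
  also have "?F * (1 / ?F) = 1" using F by simp
  finally show "(\<integral>\<^sup>+T1. ennreal (cyl_formula \<mu> T1 * indicator (next_trees T) T1 / ?F) \<partial>count_space UNIV) = 1"
    by simp
qed

text \<open>Sampling the successor of every finite tree independently avoids a Markov kernel
  construction: a growing tree visits each finite tree at most once.\<close>
definition successors :: "(nat list set \<Rightarrow> nat list set) measure" where
  "successors = PiM UNIV (\<lambda>T. measure_pmf (offspring T))"

lemma space_successors: "space successors = UNIV"
  by (simp add: successors_def space_PiM)

lemma prob_space_successors: "prob_space successors"
  unfolding successors_def by (intro prob_space_PiM measure_pmf.prob_space_axioms)

text \<open>The balls of S have different heights, hence are distinct coordinates and independent;
  the product of quotients telescopes down to the weight 1 of \<open>edge_tree\<close>.\<close>

lemma emeasure_follows: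
  assumes S: "S \<in> Trees_fin"
  shows "emeasure successors {\<eta>. follows S \<eta>} = ennreal (cyl_formula \<mu> S)"
proof -
  interpret succ: product_prob_space "\<lambda>T. measure_pmf (offspring T)" UNIV
    by (intro product_prob_spaceI measure_pmf.prob_space_axioms)
  define h where "h = height S"
  have h: "h \<ge> 1" using height_ge_1[OF S] by (simp add: h_def)
  define J where "J = (\<lambda>i. ball_tree i S) ` {1..<h}"
  have ht: "height (ball_tree i S) = i" if "1 \<le> i" "i \<le> h" for i
    using that S by (intro height_ball_le) (auto simp: h_def)
  have fin: "ball_tree i S \<in> Trees_fin" if "1 \<le> i" for i
    using that S by (intro ball_tree_in_Trees_fin Trees_fin_D)
  have inj: "inj_on (\<lambda>i. ball_tree i S) {1..<h}"
    by (rule inj_on_inverseI[of _ height]) (auto intro: ht)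
  have next_mem: "ball_tree (Suc i) S \<in> next_trees (ball_tree i S)" if "i \<in> {1..<h}" for i
    using that ht[of i] ht[of "Suc i"] fin[of "Suc i"] by (auto simp: next_trees_def ball_tree_ball_tree)
  \<comment> \<open>On \<open>J\<close> the radius of a ball is its height, so the required
    successor is a function of the coordinate alone.\<close>
  have "{\<eta>. follows S \<eta>} = {\<eta> \<in> space (PiM UNIV (\<lambda>T. measure_pmf (offspring T))).
      \<forall>T\<in>J. \<eta> T \<in> {ball_tree (Suc (height T)) S}}"
    using ht by (auto simp: follows_def J_def h_def[symmetric] space_PiM)
  then have "emeasure successors {\<eta>. follows S \<eta>}
     = (\<Prod>T\<in>J. emeasure (measure_pmf (offspring T)) {ball_tree (Suc (height T)) S})"
    unfolding successors_def by (simp only:) (rule succ.emeasure_PiM_Collect, auto simp: J_def)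
  also have "\<dots> = (\<Prod>i\<in>{1..<h}. emeasure (measure_pmf (offspring (ball_tree i S))) {ball_tree (Suc (height (ball_tree i S))) S})"
    unfolding J_def by (subst prod.reindex[OF inj]) simp
  also have "\<dots> = (\<Prod>i\<in>{1..<h}. ennreal (cyl_formula \<mu> (ball_tree (Suc i) S) / cyl_formula \<mu> (ball_tree i S)))"
    using next_mem by (intro prod.cong refl) (simp add: ht emeasure_pmf_single pmf_offspring fin)
  also have "\<dots> = ennreal (\<Prod>i\<in>{1..<h}. cyl_formula \<mu> (ball_tree (Suc i) S) / cyl_formula \<mu> (ball_tree i S))"
    using cyl_formula_pos[OF fin] by (intro prod_ennreal) (auto intro!: divide_nonneg_nonneg less_imp_le)
  also have "(\<Prod>i\<in>{1..<h}. cyl_formula \<mu> (ball_tree (Suc i) S) / cyl_formula \<mu> (ball_tree i S))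
     = cyl_formula \<mu> (ball_tree h S) / cyl_formula \<mu> (ball_tree 1 S)"
    using cyl_formula_pos[OF fin] by (intro prod_telescope h) (metis less_irrefl)
  also have "ball_tree 1 S = edge_tree" by (intro ball_tree_1 Trees_fin_D S)
  also have "ball_tree h S = S" using S by (simp add: h_def ball_tree_height_id)
  finally show ?thesis by (simp add: cyl_formula_edge_tree)
qed

lemma follows_sets: "{\<eta>. follows S \<eta>} \<in> sets successors"
proof -
  have "{\<eta> \<in> space successors. \<forall>i\<in>{1..<height S}. \<eta> (ball_tree i S) = ball_tree (Suc i) S} \<in> sets successors"
  proof (rule sets.sets_Collect_finite_All)
    fix i
    have "(\<lambda>\<eta>. \<eta> (ball_tree i S)) \<in> measurable successors (count_space UNIV)"
      unfolding successors_def by (rule measurable_component_singleton[where M = "\<lambda>T. measure_pmf (offspring T)", simplified]) simp?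
    then show "{\<eta> \<in> space successors. \<eta> (ball_tree i S) = ball_tree (Suc i) S} \<in> sets successors"
      by measurable
  qed simp
  then show ?thesis by (simp add: follows_def space_successors)
qed

lemma never_stops_sets: "{\<eta>. never_stops \<eta>} \<in> sets successors"
proof -
  have "{\<eta>. never_stops \<eta>} = (\<Inter>n. \<Union>S\<in>{S \<in> Trees_fin. height S = Suc n}. {\<eta>. follows S \<eta>})"
    by (auto simp: never_stops_def)
  also have "\<dots> \<in> sets successors"
    by (intro sets.countable_INT sets.countable_UN' countable_subset[OF _ countable_Trees_fin] follows_sets image_subsetI)
      (auto intro!: sets.countable_UN' countable_subset[OF _ countable_Trees_fin] follows_sets)
  finally show ?thesis .
qed

text \<open>Almost surely all of the countably many finite trees pick a proper one-level extension,
  and then iteration from \<open>edge_tree\<close> reaches every height.\<close>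

lemma AE_never_stops: "AE \<eta> in successors. never_stops \<eta>"
proof -
  have "AE \<eta> in successors. \<eta> T \<in> next_trees T" if T: "T \<in> Trees_fin" for T
    unfolding successors_def
  proof (rule AE_PiM_component)
    show "AE T1 in measure_pmf (offspring T). T1 \<in> next_trees T"
      by (auto simp: AE_measure_pmf_iff set_pmf_iff pmf_offspring[OF T] indicator_def split: if_splits)
  qed (auto intro: measure_pmf.prob_space_axioms)
  then have "AE \<eta> in successors. \<forall>T\<in>Trees_fin. \<eta> T \<in> next_trees T"
    using countable_Trees_fin by (simp add: AE_ball_countable)
  then show ?thesis
  proof eventually_elim
    case (elim \<eta>)
    have "\<exists>S\<in>{S \<in> Trees_fin. height S = Suc n}. follows S \<eta>" for n
    proof (induction n)
      case 0
      have "follows edge_tree \<eta>" by (simp add: follows_def height_edge_tree)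
      then show ?case using edge_tree_Trees_fin height_edge_tree by auto
    next
      case (Suc n)
      then obtain S where S: "S \<in> Trees_fin" "height S = Suc n" "follows S \<eta>" by blast
      then have S': "\<eta> S \<in> Trees_fin" "height (\<eta> S) = Suc (Suc n)" "ball_tree (Suc n) (\<eta> S) = S"
        using elim by (auto simp: next_trees_def)
      have "\<eta> (ball_tree i (\<eta> S)) = ball_tree (Suc i) (\<eta> S)" if i: "i \<in> {1..<Suc (Suc n)}" for i
      proof (cases "i = Suc n")
        case True
        then show ?thesis using S' ball_tree_height_id[OF S'(1), of "Suc (Suc n)"] by simp
      next
        case False
        then have "ball_tree i (\<eta> S) = ball_tree i S" "ball_tree (Suc i) (\<eta> S) = ball_tree (Suc i) S"
          using i ball_tree_ball_tree[of i "Suc n" "\<eta> S"] ball_tree_ball_tree[of "Suc i" "Suc n" "\<eta> S"] S'(3)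
          by auto
        moreover have "\<eta> (ball_tree i S) = ball_tree (Suc i) S"
          using S(2,3) i False by (auto simp: follows_def)
        ultimately show ?thesis by simp
      qed
      then have "follows (\<eta> S) \<eta>" using S'(2) by (simp add: follows_def)
      then show ?case using S' by blast
    qed
    then show ?case by (simp add: never_stops_def)
  qed
qed

lemma limit_tree_measurable: "limit_tree \<in> measurable successors tree_borel"
proof (rule measurable_sigma_sets[OF sets_tree_borel_eq_cyls cyls_subset])
  show "limit_tree \<in> space successors \<rightarrow> Trees" using limit_tree_in_Trees by auto
  fix A assume "A \<in> cyls"
  then consider "A = {}" | S where "S \<in> Trees_fin" "A = cyl S" by (auto simp: cyls_def)
  then show "limit_tree -` A \<inter> space successors \<in> sets successors"
  proof cases
    case 2
    \<comment> \<open>The second set stems from the default value of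
      \<open>limit_tree\<close>.\<close>
    have "limit_tree -` A \<inter> space successors = ({\<eta>. follows S \<eta>} \<inter> {\<eta>. never_stops \<eta>}) \<union>
       (if edge_tree \<in> cyl S then space successors - {\<eta>. never_stops \<eta>} else {})"
      using limit_tree_in_cyl_iff[OF _ 2(1)] unfolding 2(2) space_successors
      by (auto simp: limit_tree_def split: if_splits)
    also have "\<dots> \<in> sets successors"
      by (intro sets.Un sets.Int follows_sets never_stops_sets) (simp add: never_stops_sets sets.compl_sets)
    finally show ?thesis .
  qed simp
qed

theorem infinite_tree_measure:
  "\<exists>\<nu>. prob_space \<nu> \<and> sets \<nu> = sets tree_borel \<and> (\<forall>S\<in>Trees_fin. measure \<nu> (cyl S) = cyl_formula \<mu> S)
     \<and> (AE T in \<nu>. \<forall>r. level r T \<noteq> {})"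
proof (intro exI conjI ballI)
  interpret P: prob_space successors by (rule prob_space_successors)
  let ?\<nu> = "distr successors tree_borel limit_tree"
  show "prob_space ?\<nu>" by (rule P.prob_space_distr[OF limit_tree_measurable])
  show "sets ?\<nu> = sets tree_borel" by simp
  fix S assume S: "S \<in> Trees_fin"
  have "emeasure ?\<nu> (cyl S) = emeasure successors (limit_tree -` cyl S \<inter> space successors)"
    by (rule emeasure_distr[OF limit_tree_measurable cyl_in_sets[OF S]])
  also have "\<dots> = emeasure successors {\<eta>. follows S \<eta>}"
  proof (rule emeasure_eq_AE)
    show "AE \<eta> in successors. \<eta> \<in> limit_tree -` cyl S \<inter> space successors \<longleftrightarrow> \<eta> \<in> {\<eta>. follows S \<eta>}"
      using AE_never_stops
      by eventually_elim (simp add: limit_tree_in_cyl_iff[OF _ S] space_successors)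
    show "limit_tree -` cyl S \<inter> space successors \<in> sets successors"
      by (rule measurable_sets[OF limit_tree_measurable cyl_in_sets[OF S]])
  qed (rule follows_sets)
  finally show "measure ?\<nu> (cyl S) = cyl_formula \<mu> S"
    unfolding emeasure_follows[OF S] using cyl_formula_pos[OF S] by (simp add: measure_def)
next
  have "AE T in distr successors tree_borel limit_tree. level r T \<noteq> {}" for r
  proof (subst AE_distr_iff[OF limit_tree_measurable])
    show "{T \<in> space tree_borel. level r T \<noteq> {}} \<in> sets tree_borel"
      using level_nonempty_sets by (simp add: space_tree_borel)
    show "AE \<eta> in successors. level r (limit_tree \<eta>) \<noteq> {}"
      using AE_never_stops by eventually_elim (rule level_limit_tree)
  qed
  then show "AE T in distr successors tree_borel limit_tree. \<forall>r. level r T \<noteq> {}"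
    by (simp add: AE_all_countable)
qed

end

section \<open>Convergence\<close>

text \<open>\<open>measure_of\<close> yields the given set function only if that is a measure;
  recognising it as the push-forward of a finite discrete measure settles this.\<close>

lemma nu_N_eq_distr:
  assumes Z: "Z \<mu> N > 0"
  shows "nu_N \<mu> N = distr (density (count_space (trees_N N)) (\<lambda>T. ennreal (gibbs \<mu> N T)))
     tree_borel (\<lambda>T. T)" (is "_ = ?D")
    and "A \<in> sets tree_borel \<Longrightarrow> emeasure (nu_N \<mu> N) A
     = ennreal (\<Sum>T\<in>A \<inter> trees_N N. gibbs \<mu> N T)"
proof -
  let ?w = "\<lambda>T. gibbs \<mu> N T"
  let ?M = "density (count_space (trees_N N)) (\<lambda>T. ennreal (?w T))"
  have sub: "trees_N N \<subseteq> Trees" by (auto simp: trees_N_def Trees_fin_def)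
  have meas: "(\<lambda>T. T) \<in> measurable ?M tree_borel"
    using sub by (auto simp: measurable_def space_tree_borel)
  have em: "emeasure ?D A = ennreal (\<Sum>T\<in>A \<inter> trees_N N. ?w T)" if A: "A \<in> sets tree_borel" for A
  proof -
    have "emeasure ?D A = emeasure ?M (A \<inter> trees_N N)"
      using emeasure_distr[OF meas A] by simp
    also have "\<dots> = (\<integral>\<^sup>+T. ennreal (?w T) * indicator (A \<inter> trees_N N) T \<partial>count_space (trees_N N))"
      by (rule emeasure_density) auto
    also have "\<dots> = (\<Sum>T\<in>A \<inter> trees_N N. ennreal (?w T) * indicator (A \<inter> trees_N N) T)"
      by (rule nn_integral_count_space') (auto simp: finite_trees_N)
    also have "\<dots> = (\<Sum>T\<in>A \<inter> trees_N N. ennreal (?w T))"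
      by (intro sum.cong) auto
    also have "\<dots> = ennreal (\<Sum>T\<in>A \<inter> trees_N N. ?w T)"
      using Z by (intro sum_ennreal) auto
    finally show ?thesis .
  qed
  have "nu_N \<mu> N = measure_of Trees (sets tree_borel) (emeasure ?D)"
    unfolding nu_N_def
  proof (rule measure_of_eq)
    show "sets tree_borel \<subseteq> Pow Trees" using sets.space_closed[of tree_borel] by (simp add: space_tree_borel)
    fix A assume "A \<in> sigma_sets Trees (sets tree_borel)"
    then have "A \<in> sets tree_borel"
      using sets.sigma_sets_eq[of tree_borel] by (simp add: space_tree_borel)
    then show "ennreal (\<Sum>T\<in>A \<inter> trees_N N. ?w T) = emeasure ?D A" by (simp only: em)
  qed
  also have "\<dots> = ?D"
    using measure_of_of_measure[of ?D] by (simp add: space_tree_borel)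
  finally show eq: "nu_N \<mu> N = ?D" .
  show "A \<in> sets tree_borel \<Longrightarrow> emeasure (nu_N \<mu> N) A = ennreal (\<Sum>T\<in>A \<inter> trees_N N. ?w T)"
    unfolding eq by (rule em)
qed

lemma prob_space_nu_N:
  assumes Z: "Z \<mu> N > 0"
  shows "prob_space (nu_N \<mu> N)" "sets (nu_N \<mu> N) = sets tree_borel"
proof -
  show sets: "sets (nu_N \<mu> N) = sets tree_borel" by (simp add: nu_N_eq_distr(1)[OF Z])
  have sp: "space (nu_N \<mu> N) = Trees" by (simp add: nu_N_eq_distr(1)[OF Z] space_tree_borel)
  have "Trees \<inter> trees_N N = trees_N N" by (auto simp: trees_N_def Trees_fin_def)
  moreover have "(\<Sum>T\<in>trees_N N. gibbs \<mu> N T) = 1"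
  proof -
    have "(\<Sum>T\<in>trees_N N. gibbs \<mu> N T) = Z \<mu> N / Z \<mu> N"
      by (simp only: Z_def sum_divide_distrib)
    then show ?thesis using Z by simp
  qed
  moreover have "Trees \<in> sets tree_borel"
    using sets.top[of tree_borel] by (simp add: space_tree_borel)
  ultimately have "emeasure (nu_N \<mu> N) (space (nu_N \<mu> N)) = 1"
    unfolding sp by (simp add: nu_N_eq_distr(2)[OF Z])
  then show "prob_space (nu_N \<mu> N)" by (rule prob_spaceI)
qed

lemma measure_nu_N_cyl:
  assumes Z: "Z \<mu> N > 0" and S: "S \<in> Trees_fin"
  shows "measure (nu_N \<mu> N) (cyl S) = (\<Sum>T\<in>cyl S \<inter> trees_N N. gibbs \<mu> N T)"
  unfolding measure_def nu_N_eq_distr(2)[OF Z cyl_in_sets[OF S]]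
  using Z by (intro enn2real_ennreal sum_nonneg) auto

theorem mainTheorem13:
  fixes \<mu> :: real
  assumes "\<mu> > 0"
  shows "\<exists>\<nu>. prob_space \<nu> \<and> sets \<nu> = sets tree_borel
      \<and> weak_conv_trees (nu_N \<mu>) \<nu>
      \<and> (\<forall>T0\<in>Trees_fin. height T0 \<ge> 1 \<longrightarrow> measure \<nu> (cyl T0) = cyl_formula \<mu> T0)
      \<and> (\<forall>\<nu>'. prob_space \<nu>' \<and> sets \<nu>' = sets tree_borel
             \<and> (\<forall>T0\<in>Trees_fin. height T0 \<ge> 1 \<longrightarrow> measure \<nu>' (cyl T0) = cyl_formula \<mu> T0)
             \<longrightarrow> \<nu>' = \<nu>)"
proof -
  interpret height_coupling \<mu> by unfold_locales (rule assms)
  obtain \<nu> where \<nu>: "prob_space \<nu>" "sets \<nu> = sets tree_borel"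
    "\<And>S. S \<in> Trees_fin \<Longrightarrow> measure \<nu> (cyl S) = cyl_formula \<mu> S" "AE T in \<nu>. \<forall>r. level r T \<noteq> {}"
    using infinite_tree_measure by blast
  have "weak_conv_trees (nu_N \<mu>) \<nu>"
  proof (rule weak_conv_treesI[OF _ \<nu>(1,2) _ \<nu>(4)])
    show "\<forall>\<^sub>F N in sequentially. prob_space (nu_N \<mu> N) \<and> sets (nu_N \<mu> N) = sets tree_borel"
      using Z_pos by eventually_elim (simp add: prob_space_nu_N)
    fix S assume S: "S \<in> Trees_fin"
    have "\<forall>\<^sub>F N in sequentially. measure (nu_N \<mu> N) (cyl S)
       = (\<Sum>T\<in>cyl S \<inter> trees_N N. gibbs \<mu> N T)"
      using Z_pos by eventually_elim (rule measure_nu_N_cyl[OF _ S])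
    then show "(\<lambda>N. measure (nu_N \<mu> N) (cyl S)) \<longlonglongrightarrow> measure \<nu> (cyl S)"
      using cyl_weight_tendsto[OF S] unfolding \<nu>(3)[OF S] by (simp add: tendsto_cong)
  qed
  moreover have "\<nu>' = \<nu>" if "prob_space \<nu>'" "sets \<nu>' = sets tree_borel"
    "\<forall>T0\<in>Trees_fin. height T0 \<ge> 1 \<longrightarrow> measure \<nu>' (cyl T0) = cyl_formula \<mu> T0" for \<nu>'
    using that \<nu>(3) height_ge_1 by (intro tree_measure_eqI[OF that(1,2) \<nu>(1,2)]) simp
  ultimately show ?thesis using \<nu>(1-3) by blast
qed

end
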